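(* Let $W$ be a binary-input cq channel, fix $R<I(W)$ and $\beta<1/2$. For each $N=2^n$ let $\mathcal A_N\subset\{1,\dots,N\}$ be any set with $|\mathcal A_N|=\lfloor NR\rfloor$ satisfying the polar coding rule $F(W_N^{(i)})\le F(W_N^{(j)})$ for all $i\in\mathcal A_N$, $j\notin\mathcal A_N$, and let $P_e(N,R)=P_e(N,\lfloor NR\rfloor,\mathcal A_N)$. Then $P_e(N,R)=o\big(2^{-\frac12N^\beta}\big)$.
   Context: A binary-input cq channel $W$ assigns to $x\in\{0,1\}$ a density operator $\rho_x$ on a finite-dimensional Hilbert space. For $V:x\mapsto\sigma_x$: $I(V)=H(\tfrac12(\sigma_0+\sigma_1))-\tfrac12H(\sigma_0)-\tfrac12H(\sigma_1)$ with $H(\sigma)=-\mathrm{Tr}\{\sigma\log_2\sigma\}$, and $F(V)=\|\sqrt{\sigma_0}\sqrt{\sigma_1}\|_1^2$. Channel combining: for $N=2^n$ define $\rho_{u^N}$ on $B^N$ recursively by $\rho_{u_1}=\rho_{u_1}$ ($N=1$) and $\rho_{u^{2N}}=\rho^{B_1\cdots B_N}_{u_o\oplus u_e}\otimes\rho^{B_{N+1}\cdots B_{2N}}_{u_e}$ with $u_o=(u_1,u_3,\dots)$, $u_e=(u_2,u_4,\dots)$. Let $\overline\rho_{u_1^i}=\sum_{u_{i+1}^N}2^{-(N-i)}\rho_{u^N}$ and split channel $W_N^{(i)}:u_i\mapsto\sum_{u_1^{i-1}}2^{-(i-1)}|u_1^{i-1}\rangle\langle u_1^{i-1}|\otimes\overline\rho_{u_1^i}$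 (classical register with orthonormal basis $\{|u_1^{i-1}\rangle\}$). Decoder: for $i\in\mathcal A$, $\Pi_{(i),u_1^{i-1}0}=\{\sqrt{\overline\rho_{u_1^{i-1}0}}-\sqrt{\overline\rho_{u_1^{i-1}1}}\ge0\}$ (projector onto nonnegative eigenspace), $\Pi_{(i),u_1^{i-1}1}=I-\Pi_{(i),u_1^{i-1}0}$; for $i\notin\mathcal A$, $\Pi_{(i),u_1^{i-1}u_i}=I$. With $\Pi_i=\Pi_{(i),u_1^{i-1}u_i}$, $P_e(N,K,\mathcal A)=1-2^{-N}\sum_{u^N\in\{0,1\}^N}\mathrm{Tr}\{\Pi_N\cdots\Pi_1\rho_{u^N}\Pi_1\cdots\Pi_N\}$ (block error probability of quantum successive cancellation decoding averaged uniformly over information and frozen bits). *)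

theory Defs
  imports "Jordan_Normal_Form.Schur_Decomposition" "HOL-Library.Landau_Symbols"
begin

definition mtrace :: "complex mat \<Rightarrow> complex" where
  "mtrace A = (\<Sum>i<dim_row A. A $$ (i,i))"

definition hermitian_mat :: "complex mat \<Rightarrow> bool" where
  "hermitian_mat A \<longleftrightarrow> square_mat A \<and> mat_adjoint A = A"

definition unitary_mat :: "nat \<Rightarrow> complex mat \<Rightarrow> bool" where
  "unitary_mat n U \<longleftrightarrow> U \<in> carrier_mat n n \<and> U * mat_adjoint U = 1\<^sub>m n"

definition density_op :: "nat \<Rightarrow> complex mat \<Rightarrow> bool" where
  "density_op d \<rho> \<longleftrightarrow> \<rho> \<in> carrier_mat d d \<and> hermitian_mat \<rho> \<and>
     (\<forall>v \<in> carrier_vec d. 0 \<le> Re (conjugate v \<bullet> (\<rho> *\<^sub>v v))) \<and> mtrace \<rho> = 1"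

text \<open>Functional calculus for Hermitian matrices via a spectral decomposition
  A = U D U^*, f(A) = U f(D) U^*  (independent of the chosen decomposition).\<close>
definition mfun :: "(real \<Rightarrow> real) \<Rightarrow> complex mat \<Rightarrow> complex mat" where
  "mfun f A = (SOME B. \<exists>U D. unitary_mat (dim_row A) U \<and> D \<in> carrier_mat (dim_row A) (dim_row A) \<and>
      diagonal_mat D \<and> (\<forall>i<dim_row A. D $$ (i,i) \<in> \<real>) \<and> A = U * D * mat_adjoint U \<and>
      B = U * mat_diag (dim_row A) (\<lambda>i. complex_of_real (f (Re (D $$ (i,i))))) * mat_adjoint U)"

definition msqrt :: "complex mat \<Rightarrow> complex mat" where
  "msqrt A = mfun sqrt A"

definition nonneg_proj :: "complex mat \<Rightarrow> complex mat" where
  "nonneg_proj A = mfun (\<lambda>x. if 0 \<le> x then 1 else 0) A"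

text \<open>von Neumann entropy H(\<sigma>) = -Tr \<sigma> log2 \<sigma> (with 0 log 0 = 0).\<close>
definition vN_entropy :: "complex mat \<Rightarrow> real" where
  "vN_entropy \<sigma> = Re (mtrace (mfun (\<lambda>x. - (x * log 2 x)) \<sigma>))"

definition trace_norm :: "complex mat \<Rightarrow> real" where
  "trace_norm X = Re (mtrace (msqrt (mat_adjoint X * X)))"

text \<open>F(V) = \<parallel>sqrt \<sigma>0 sqrt \<sigma>1\<parallel>_1^2 for the binary cq channel V : x \<mapsto> \<sigma> x (False = 0, True = 1).\<close>
definition fid :: "(bool \<Rightarrow> complex mat) \<Rightarrow> real" where
  "fid \<sigma> = (trace_norm (msqrt (\<sigma> False) * msqrt (\<sigma> True)))\<^sup>2"

definition symm_info :: "(bool \<Rightarrow> complex mat) \<Rightarrow> real" where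
  "symm_info \<sigma> = vN_entropy ((1/2 :: complex) \<cdot>\<^sub>m (\<sigma> False + \<sigma> True))
      - vN_entropy (\<sigma> False) / 2 - vN_entropy (\<sigma> True) / 2"

text \<open>Kronecker (tensor) product; basis |a> \<otimes> |b> has index a * dim B + b.\<close>
definition kron :: "complex mat \<Rightarrow> complex mat \<Rightarrow> complex mat" where
  "kron A B = mat (dim_row A * dim_row B) (dim_col A * dim_col B)
     (\<lambda>(i,j). A $$ (i div dim_row B, j div dim_col B) * B $$ (i mod dim_row B, j mod dim_col B))"

definition msum :: "nat \<Rightarrow> 'a set \<Rightarrow> ('a \<Rightarrow> complex mat) \<Rightarrow> complex mat" where
  "msum D S f = mat D D (\<lambda>ij. \<Sum>x\<in>S. f x $$ ij)"

definition bits :: "nat \<Rightarrow> bool list set" where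
  "bits k = {u. length u = k}"

text \<open>Channel combining: comb \<rho> n u = \<rho>_{u^N} for N = 2^n, u a bit list of length N
  (bit False = 0, True = 1; list positions are 0-based, so u_o = u!0,u!2,..., u_e = u!1,u!3,...).\<close>
primrec comb :: "(bool \<Rightarrow> complex mat) \<Rightarrow> nat \<Rightarrow> bool list \<Rightarrow> complex mat" where
  "comb \<rho> 0 u = \<rho> (u ! 0)"
| "comb \<rho> (Suc n) u =
     kron (comb \<rho> n (map (\<lambda>k. u ! (2*k) \<noteq> u ! (2*k+1)) [0..<2^n]))
          (comb \<rho> n (map (\<lambda>k. u ! (2*k+1)) [0..<2^n]))"

definition rhobar :: "(bool \<Rightarrow> complex mat) \<Rightarrow> nat \<Rightarrow> nat \<Rightarrow> bool list \<Rightarrow> complex mat" where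
  "rhobar \<rho> d n v = msum (d ^ (2^n)) (bits (2^n - length v))
     (\<lambda>w. complex_of_real (1 / 2 ^ (2^n - length v)) \<cdot>\<^sub>m comb \<rho> n (v @ w))"

text \<open>Binary encoding of a classical register value u_1^{i-1}.\<close>
definition bidx :: "bool list \<Rightarrow> nat" where
  "bidx v = (\<Sum>k<length v. if v ! k then 2^k else 0)"

definition ketbra :: "nat \<Rightarrow> nat \<Rightarrow> complex mat" where
  "ketbra m k = mat m m (\<lambda>(a,c). if a = k \<and> c = k then 1 else 0)"

text \<open>Output states of the split channel W_N^{(i)} (i is 1-based).\<close>
definition split_out :: "(bool \<Rightarrow> complex mat) \<Rightarrow> nat \<Rightarrow> nat \<Rightarrow> nat \<Rightarrow> bool \<Rightarrow> complex mat" where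
  "split_out \<rho> d n i b = msum (2^(i-1) * d ^ (2^n)) (bits (i-1))
     (\<lambda>v. complex_of_real (1 / 2^(i-1)) \<cdot>\<^sub>m kron (ketbra (2^(i-1)) (bidx v)) (rhobar \<rho> d n (v @ [b])))"

definition split_fid :: "(bool \<Rightarrow> complex mat) \<Rightarrow> nat \<Rightarrow> nat \<Rightarrow> nat \<Rightarrow> real" where
  "split_fid \<rho> d n i = fid (split_out \<rho> d n i)"

text \<open>Decoder projector \<Pi>_{(i), u_1^{i-1} u_i} (i is 1-based).\<close>
definition dec_proj :: "(bool \<Rightarrow> complex mat) \<Rightarrow> nat \<Rightarrow> nat \<Rightarrow> nat set \<Rightarrow> bool list \<Rightarrow> nat \<Rightarrow> complex mat" where
  "dec_proj \<rho> d n A u i =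
     (if i \<in> A then
        (let v = take (i-1) u;
             P0 = nonneg_proj (msqrt (rhobar \<rho> d n (v @ [False])) - msqrt (rhobar \<rho> d n (v @ [True])))
         in if u ! (i-1) then 1\<^sub>m (d ^ (2^n)) - P0 else P0)
      else 1\<^sub>m (d ^ (2^n)))"

definition Pe :: "(bool \<Rightarrow> complex mat) \<Rightarrow> nat \<Rightarrow> nat \<Rightarrow> nat set \<Rightarrow> real" where
  "Pe \<rho> d n A = 1 - (1 / 2^(2^n)) * (\<Sum>u\<in>bits (2^n).
      Re (mtrace (
        foldl (\<lambda>M i. dec_proj \<rho> d n A u i * M) (1\<^sub>m (d ^ (2^n))) [1..<2^n+1]
        * comb \<rho> n u *
        foldl (\<lambda>M i. M * dec_proj \<rho> d n A u i) (1\<^sub>m (d ^ (2^n))) [1..<2^n+1])))"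

end

theory Submission
  imports Defs "HOL-Analysis.L2_Norm" "HOL-Real_Asymp.Real_Asymp" "Jordan_Normal_Form.Spectral_Radius"
begin

text \<open>
  Reliability of a binary cq channel is measured by the least Bhattacharyya coefficient \<open>Z\<close> that a
  projective rank-one measurement attains. Product measurements give \<open>Z(W\<^sup>+) \<le> Z(W)\<^sup>2\<close> and, by the
  classical inequality, \<open>Z(W\<^sup>-) \<le> 2 Z(W) - Z(W)\<^sup>2\<close>, and \<open>Z\<close> dominates \<open>sqrt F\<close>. Hence the mean
  of \<open>sqrt Z\<close> strictly decreases as long as a positive fraction of the split channels is
  intermediate, so \<open>Z\<close> polarizes to 0 and 1. The mean of the Holevo information is conserved by
  additivity of entropy, it is at most 1, and it is small where \<open>Z\<close> is close to 1, with a bound free of the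
  dimension; so the fraction of good channels tends to at least \<open>I(W)\<close>. For the rate, a negative power
  of \<open>log (1/Z)\<close> contracts in the mean along the two branches, which yields \<open>Z \<le> 2^(-N^\<beta>)\<close> directly.
  The decoder is controlled by viewing \<open>sqrt \<rho>\<close> as a Hilbert--Schmidt vector, on which the
  projectors act as contractions, and by the test \<open>{sqrt \<rho>0 - sqrt \<rho>1 \<ge> 0}\<close>, whose error is
  at most \<open>Tr (sqrt \<rho>0 sqrt \<rho>1) / 2\<close>.\<close>

section \<open>Matrices and spectral decompositions\<close>

text \<open>The coding rule ranks channels by fidelity, whereas polarization needs a parameter with
  closed recursions under both transforms. Fixing product bases turns the minus transform into a
  scalar inequality between outcome distributions, which is why \<open>Z\<close> is an infimum over
  measurements. The comparison \<open>sqrt F \<le> Z\<close> goes one way only, but counting closes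
  the gap: for large \<open>N\<close> at least \<open>N R\<close> indices have
  \<open>Z \<le> \<theta>\<close>, so a set of \<open>floor (N R)\<close> indices of least fidelity
  cannot contain one with \<open>sqrt F > \<theta>\<close>. A second obstacle is that the dimension
  grows doubly exponentially with \<open>n\<close>, so every continuity estimate for the entropy
  must be free of it; comparing each state with the average state, which dominates half of it,
  supplies such estimates. The factor \<open>1/2\<close> in the exponent of the theorem arises in
  the decoder: each projector displaces \<open>sqrt \<rho>\<close> by the square root of an error
  probability, and the mean of that probability is at most \<open>sqrt F / 2\<close>. A rate
  exponent strictly between \<beta> and \<open>1/2\<close> then absorbs the prefactor of order
  \<open>N\<close> left by the telescoping sum.\<close>

abbreviation adj :: "complex mat \<Rightarrow> complex mat" where "adj \<equiv> mat_adjoint"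

abbreviation rdiag :: "nat \<Rightarrow> (nat \<Rightarrow> real) \<Rightarrow> complex mat" where
  "rdiag D q \<equiv> mat_diag D (\<lambda>i. complex_of_real (q i))"

lemma adj_dim [simp]: "dim_row (adj A) = dim_col A" "dim_col (adj A) = dim_row A"
  by (auto simp: mat_adjoint_def)

lemma adj_carrier [simp]: "A \<in> carrier_mat n m \<Longrightarrow> adj A \<in> carrier_mat m n"
  by (metis adj_dim carrier_matD carrier_matI)

lemma adj_index [simp]:
  "i < dim_col A \<Longrightarrow> j < dim_row A \<Longrightarrow> adj A $$ (i,j) = cnj (A $$ (j,i))"
  by (auto simp: mat_adjoint_def mat_of_rows_def)

lemma adj_adj [simp]: "adj (adj A) = A"
  by (rule eq_matI) auto

lemma mult_index:
  assumes "A \<in> carrier_mat n m" "B \<in> carrier_mat m p" "i < n" "j < p"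
  shows "(A * B) $$ (i,j) = (\<Sum>k<m. A $$ (i,k) * B $$ (k,j))"
  using assms by (auto simp: scalar_prod_def atLeast0LessThan intro!: sum.cong)

lemma adj_mult:
  assumes "A \<in> carrier_mat n m" "B \<in> carrier_mat m p"
  shows "adj (A * B) = adj B * adj A"
  by (rule eq_matI) (use assms in \<open>auto simp: scalar_prod_def mult.commute intro!: sum.cong\<close>)

lemma sq_mult [simp]: "A \<in> carrier_mat D D \<Longrightarrow> B \<in> carrier_mat D D \<Longrightarrow> A * B \<in> carrier_mat D D"
  by auto

lemma sq_assoc:
  "A \<in> carrier_mat D D \<Longrightarrow> B \<in> carrier_mat D D \<Longrightarrow> C \<in> carrier_mat D D \<Longrightarrow> A * B * C = A * (B * C)"
  by (rule assoc_mult_mat)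

lemma sq_one [simp]: fixes A :: "complex mat" shows "A \<in> carrier_mat D D \<Longrightarrow> A * 1\<^sub>m D = A" "A \<in> carrier_mat D D \<Longrightarrow> 1\<^sub>m D * A = A"
  by (simp_all add: left_mult_one_mat[of A D D] right_mult_one_mat[of A D D])

lemma adj_one [simp]: "adj (1\<^sub>m n) = 1\<^sub>m n"
  by (rule eq_matI) auto

lemma adj_add: "A \<in> carrier_mat n m \<Longrightarrow> B \<in> carrier_mat n m \<Longrightarrow> adj (A + B) = adj A + adj B"
  by (rule eq_matI) auto

lemma adj_minus: "A \<in> carrier_mat n m \<Longrightarrow> B \<in> carrier_mat n m \<Longrightarrow> adj (A - B) = adj A - adj B"
  by (rule eq_matI) auto

lemma adj_smult: "adj (c \<cdot>\<^sub>m A) = cnj c \<cdot>\<^sub>m adj A"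
  by (rule eq_matI) auto

lemma adj_rdiag [simp]: "adj (rdiag D q) = rdiag D q"
  by (rule eq_matI) (auto simp: mat_diag_def)

lemma mult_rdiag_index:
  assumes "U \<in> carrier_mat n D" "V \<in> carrier_mat D m" "i < n" "j < m"
  shows "(U * rdiag D q * V) $$ (i,j) = (\<Sum>k<D. U $$ (i,k) * of_real (q k) * V $$ (k,j))"
proof -
  have "U * rdiag D q = Matrix.mat n D (\<lambda>(i,j). U $$ (i,j) * of_real (q j))"
    by (rule mat_diag_mult_right) (use assms in auto)
  then show ?thesis using assms
    by (auto simp: scalar_prod_def atLeast0LessThan intro!: sum.cong)
qed

lemma unitary_carrier: "unitary_mat D U \<Longrightarrow> U \<in> carrier_mat D D"
  by (simp add: unitary_mat_def)

lemma unitary_right: "unitary_mat D U \<Longrightarrow> U * adj U = 1\<^sub>m D"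
  by (simp add: unitary_mat_def)

lemma unitary_left: "unitary_mat D U \<Longrightarrow> adj U * U = 1\<^sub>m D"
  using mat_mult_left_right_inverse[of U D "adj U"] by (auto simp: unitary_mat_def)

lemma unitary_one [simp]: "unitary_mat D (1\<^sub>m D)"
  by (simp add: unitary_mat_def)

lemma unitary_mult:
  assumes "unitary_mat D U" "unitary_mat D V"
  shows "unitary_mat D (U * V)"
proof -
  note c = unitary_carrier[OF assms(1)] unitary_carrier[OF assms(2)]
  have "U * V * adj (U * V) = U * (V * adj V) * adj U"
    using c by (simp add: adj_mult[OF c] sq_assoc[of _ D])
  also have "\<dots> = 1\<^sub>m D"
    using c by (simp add: unitary_right[OF assms(1)] unitary_right[OF assms(2)])
  finally show ?thesis using c by (simp add: unitary_mat_def)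
qed

lemma unitary_adj: "unitary_mat D U \<Longrightarrow> unitary_mat D (adj U)"
  using unitary_left unitary_carrier by (auto simp: unitary_mat_def)

lemma unitary_row_norm:
  assumes "unitary_mat D U" "i < D"
  shows "(\<Sum>k<D. (cmod (U $$ (i,k)))\<^sup>2) = 1"
proof -
  note c = unitary_carrier[OF assms(1)]
  have "(U * adj U) $$ (i,i) = (\<Sum>k<D. U $$ (i,k) * adj U $$ (k,i))"
    using mult_index[OF c adj_carrier[OF c]] assms(2) by blast
  also have "\<dots> = (\<Sum>k<D. of_real ((cmod (U $$ (i,k)))\<^sup>2))"
    using c assms(2) by (intro sum.cong) (auto simp: complex_norm_square[symmetric])
  finally show ?thesis using unitary_right[OF assms(1)] assms(2)
    by (simp del: of_real_power) (metis (mono_tags) of_real_sum of_real_eq_1_iff)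
qed

lemma unitary_col_norm:
  assumes "unitary_mat D U" "i < D"
  shows "(\<Sum>k<D. (cmod (U $$ (k,i)))\<^sup>2) = 1"
  using unitary_row_norm[OF unitary_adj[OF assms(1)] assms(2)] unitary_carrier[OF assms(1)] assms(2)
  by simp

section \<open>Spectral decompositions and the functional calculus\<close>

definition spec :: "nat \<Rightarrow> complex mat \<Rightarrow> (nat \<Rightarrow> real) \<Rightarrow> complex mat \<Rightarrow> bool" where
  "spec D U q A \<longleftrightarrow> unitary_mat D U \<and> A = U * rdiag D q * adj U"

lemma specD:
  assumes "spec D U q A"
  shows "unitary_mat D U" "A = U * rdiag D q * adj U" "U \<in> carrier_mat D D" "A \<in> carrier_mat D D"
    "adj U \<in> carrier_mat D D"
  using assms unitary_carrier[of D U] by (auto simp: spec_def)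

lemma spec_cong: "spec D U q A \<Longrightarrow> (\<And>i. i < D \<Longrightarrow> q i = p i) \<Longrightarrow> spec D U p A"
proof -
  assume a: "spec D U q A" "\<And>i. i < D \<Longrightarrow> q i = p i"
  have "rdiag D q = rdiag D p" by (rule eq_matI) (auto simp: mat_diag_def a)
  then show ?thesis using a by (simp add: spec_def)
qed

lemma unitary_cancel:
  assumes "unitary_mat D U" "X \<in> carrier_mat D D"
  shows "adj U * (U * X) = X" "U * (adj U * X) = X"
  using assms unitary_carrier[OF assms(1)]
  by (simp_all add: sq_assoc[of _ D, symmetric] unitary_left unitary_right)

text \<open>\<open>adj V * U\<close> intertwines the two diagonal matrices, so its entry
  \<open>(i,j)\<close> can be nonzero only if \<open>p i = q j\<close>; hence it also intertwines
  their images under \<open>f\<close>. This makes \<open>mfun\<close> independent of the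
  decomposition picked by its choice operator.\<close>

lemma spec_unique:
  assumes "spec D U q A" "spec D V p A"
  shows "U * rdiag D (\<lambda>i. f (q i)) * adj U = V * rdiag D (\<lambda>i. f (p i)) * adj V"
proof -
  note U = specD[OF assms(1)] and V = specD[OF assms(2)]
  define W where "W = adj V * U"
  have W: "W \<in> carrier_mat D D" using U(3) V(5) by (simp add: W_def)
  note as = sq_assoc[of _ D]
  have 1: "rdiag D p * W = adj V * A * U"
    unfolding V(2) W_def using V(3,5) U(3,5)
    by (simp add: as unitary_cancel[OF V(1)])
  have 2: "W * rdiag D q = adj V * A * U"
    unfolding U(2) W_def using V(3,5) U(3,5)
    by (simp add: as unitary_left[OF U(1)])
  have ent: "of_real (p i) * W $$ (i,j) = W $$ (i,j) * of_real (q j)" if "i < D" "j < D" for i j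
  proof -
    have "(rdiag D p * W) $$ (i,j) = (W * rdiag D q) $$ (i,j)" using 1 2 by simp
    then show ?thesis using that W
      by (simp add: mat_diag_mult_left[OF W] mat_diag_mult_right[OF W])
  qed
  have ent': "of_real (f (p i)) * W $$ (i,j) = W $$ (i,j) * of_real (f (q j))" if "i < D" "j < D" for i j
  proof (cases "W $$ (i,j) = 0")
    case False
    then have "p i = q j" using ent[OF that] by simp
    then show ?thesis by simp
  qed simp
  have eq: "rdiag D (\<lambda>i. f (p i)) * W = W * rdiag D (\<lambda>i. f (q i))"
    unfolding mat_diag_mult_left[OF W] mat_diag_mult_right[OF W]
    by (rule eq_matI) (auto simp: ent')
  have "V * rdiag D (\<lambda>i. f (p i)) * adj V = V * (rdiag D (\<lambda>i. f (p i)) * W) * adj U"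
    unfolding W_def using V(3,5) U(3,5) by (simp add: as unitary_right[OF U(1)])
  also have "\<dots> = U * rdiag D (\<lambda>i. f (q i)) * adj U"
    unfolding eq unfolding W_def using V(3,5) U(3,5) by (simp add: as unitary_cancel[OF V(1)])
  finally show ?thesis by simp
qed

lemma mfun_spec:
  assumes "spec D U q A"
  shows "mfun f A = U * rdiag D (\<lambda>i. f (q i)) * adj U"
proof -
  note U = specD[OF assms]
  have dimA: "dim_row A = D" using U by auto
  let ?P = "\<lambda>B. \<exists>U E. unitary_mat (dim_row A) U \<and> E \<in> carrier_mat (dim_row A) (dim_row A) \<and>
      diagonal_mat E \<and> (\<forall>i<dim_row A. E $$ (i,i) \<in> \<real>) \<and> A = U * E * adj U \<and>
      B = U * mat_diag (dim_row A) (\<lambda>i. complex_of_real (f (Re (E $$ (i,i))))) * adj U"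
  have mprob: "mat_diag D (\<lambda>i. complex_of_real (f (Re (rdiag D q $$ (i,i))))) = rdiag D (\<lambda>i. f (q i))"
    by (rule eq_matI) (auto simp: mat_diag_def)
  have "?P (U * rdiag D (\<lambda>i. f (q i)) * adj U)"
  proof (rule exI[of _ U], rule exI[of _ "rdiag D q"], intro conjI)
    show "diagonal_mat (rdiag D q)" by (auto simp: diagonal_mat_def mat_diag_def)
    show "\<forall>i<dim_row A. rdiag D q $$ (i,i) \<in> \<real>" unfolding dimA by (simp add: mat_diag_def)
    show "A = U * rdiag D q * adj U" by (rule U(2))
    show "unitary_mat (dim_row A) U" unfolding dimA by (rule U(1))
    show "rdiag D q \<in> carrier_mat (dim_row A) (dim_row A)" unfolding dimA by (rule mat_diag_dim)
    show "U * rdiag D (\<lambda>i. f (q i)) * adj U =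
        U * mat_diag (dim_row A) (\<lambda>i. complex_of_real (f (Re (rdiag D q $$ (i,i))))) * adj U"
      unfolding dimA mprob ..
  qed
  then have "?P (mfun f A)" unfolding mfun_def by (rule someI[where P = ?P])
  then obtain V E where V: "unitary_mat D V" "E \<in> carrier_mat D D" "diagonal_mat E"
    "\<forall>i<D. E $$ (i,i) \<in> \<real>" "A = V * E * adj V"
    and eq: "mfun f A = V * mat_diag D (\<lambda>i. complex_of_real (f (Re (E $$ (i,i))))) * adj V"
    unfolding dimA by blast
  have "E = rdiag D (\<lambda>i. Re (E $$ (i,i)))"
    using V(2,3,4) by (intro eq_matI) (auto simp: mat_diag_def diagonal_mat_def complex_is_Real_iff complex_eq_iff)
  then have "spec D V (\<lambda>i. Re (E $$ (i,i))) A" using V by (simp add: spec_def)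
  from spec_unique[OF assms this] show ?thesis unfolding eq by simp
qed

lemma spec_mfun: "spec D U q A \<Longrightarrow> spec D U (\<lambda>i. f (q i)) (mfun f A)"
  using mfun_spec[of D U q A f] by (simp add: spec_def)

lemma mtrace_comm:
  assumes "A \<in> carrier_mat n m" "B \<in> carrier_mat m n"
  shows "mtrace (A * B) = mtrace (B * A)"
proof -
  have "mtrace (A * B) = (\<Sum>i<n. \<Sum>k<m. A $$ (i,k) * B $$ (k,i))"
    unfolding mtrace_def using assms by (auto intro!: sum.cong simp: mult_index[OF assms] simp del: index_mult_mat(1))
  also have "\<dots> = (\<Sum>k<m. \<Sum>i<n. B $$ (k,i) * A $$ (i,k))"
    by (subst sum.swap) (simp add: mult.commute)
  also have "\<dots> = mtrace (B * A)"
    unfolding mtrace_def using assms by (auto intro!: sum.cong simp: mult_index[OF assms(2,1)] simp del: index_mult_mat(1))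
  finally show ?thesis .
qed

lemma mtrace_conj:
  assumes "unitary_mat D U" "A \<in> carrier_mat D D"
  shows "mtrace (adj U * A * U) = mtrace A" "mtrace (U * A * adj U) = mtrace A"
proof -
  note c = unitary_carrier[OF assms(1)]
  have "mtrace (adj U * A * U) = mtrace (U * (adj U * A))"
    by (rule mtrace_comm[of _ D D]) (use c assms in auto)
  then show "mtrace (adj U * A * U) = mtrace A" by (simp only: unitary_cancel[OF assms])
  have "mtrace (U * A * adj U) = mtrace (adj U * (U * A))"
    by (rule mtrace_comm[of _ D D]) (use c assms in auto)
  then show "mtrace (U * A * adj U) = mtrace A" by (simp only: unitary_cancel[OF assms])
qed

lemma spec_trace:
  assumes "spec D U q A"
  shows "mtrace A = of_real (\<Sum>i<D. q i)"
  using mtrace_conj(2)[OF specD(1)[OF assms], of "rdiag D q"] specD(2)[OF assms]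
  by (simp add: mtrace_def) (simp add: mat_diag_def)

lemma spec_conj:
  assumes "spec D U q A"
  shows "adj U * A * U = rdiag D q"
  using specD(3,5)[OF assms] unfolding specD(2)[OF assms]
  by (simp add: sq_assoc[of _ D] unitary_left[OF specD(1)[OF assms]] unitary_cancel[OF specD(1)[OF assms]])

section \<open>The spectral theorem for Hermitian matrices\<close>

lemma unitaryI:
  assumes "U \<in> carrier_mat D D"
    "\<And>i j. i < D \<Longrightarrow> j < D \<Longrightarrow> (\<Sum>k<D. cnj (U $$ (k,i)) * U $$ (k,j)) = (if i = j then 1 else 0)"
  shows "unitary_mat D U"
proof -
  have "adj U * U = 1\<^sub>m D"
  proof (rule eq_matI)
    fix i j assume "i < dim_row (1\<^sub>m D)" "j < dim_col (1\<^sub>m D)"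
    then have ij: "i < D" "j < D" by auto
    have "(adj U * U) $$ (i,j) = (\<Sum>k<D. adj U $$ (i,k) * U $$ (k,j))"
      by (rule mult_index) (use assms ij in auto)
    also have "\<dots> = (\<Sum>k<D. cnj (U $$ (k,i)) * U $$ (k,j))"
      using assms(1) ij by (intro sum.cong) auto
    finally show "(adj U * U) $$ (i,j) = 1\<^sub>m D $$ (i,j)" using assms(2)[OF ij] ij by simp
  qed (use assms in auto)
  then have "U * adj U = 1\<^sub>m D"
    using mat_mult_left_right_inverse[of "adj U" D U] assms(1) by auto
  then show ?thesis using assms(1) by (simp add: unitary_mat_def)
qed

lemma unitaryD:
  assumes "unitary_mat D U" "i < D" "j < D"
  shows "(\<Sum>k<D. cnj (U $$ (k,i)) * U $$ (k,j)) = (if i = j then 1 else 0)"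
proof -
  note c = unitary_carrier[OF assms(1)]
  have "(adj U * U) $$ (i,j) = (\<Sum>k<D. adj U $$ (i,k) * U $$ (k,j))"
    by (rule mult_index) (use c assms in auto)
  also have "\<dots> = (\<Sum>k<D. cnj (U $$ (k,i)) * U $$ (k,j))"
    using c assms by (intro sum.cong) auto
  finally show ?thesis using unitary_left[OF assms(1)] assms by simp
qed

text \<open>Gram-Schmidt started at \<open>v\<close> keeps its first vector, and the columns are
  then normalized. The scalar \<open>c\<close> is left unspecified because an eigenvector matters
  only up to scaling.\<close>

lemma unitary_completion:
  assumes v: "v \<in> carrier_vec n" "v \<noteq> 0\<^sub>v n"
  shows "\<exists>W c. unitary_mat n W \<and> (\<forall>i<n. W $$ (i,0) = c * v $ i)"
proof -
  interpret cof_vec_space n "TYPE(complex)" .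
  define b where "b = basis_completion v"
  define ws where "ws = gram_schmidt n b"
  from basis_completion[OF v, folded b_def]
  have dist_b: "distinct b" and indep: "\<not> lin_dep (set b)" and b: "set b \<subseteq> carrier_vec n"
    and hdb: "hd b = v" and len_b: "length b = n" by auto
  have n: "0 < n" using v by (cases n) auto
  from hdb len_b n obtain vs where bv: "b = v # vs" by (cases b) auto
  from gram_schmidt_result[OF b dist_b indep refl, folded ws_def]
  have ws: "set ws \<subseteq> carrier_vec n" "corthogonal ws" "length ws = n"
    by (auto simp: len_b)
  from gram_schmidt_hd[OF v(1), of vs, folded bv] have hdws: "hd ws = v" unfolding ws_def .
  have ws0: "ws ! 0 = v" using hdws ws(3) n by (cases ws) auto
  define N where "N j = (\<Sum>k<n. (cmod (ws ! j $ k))\<^sup>2)" for j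
  have sp: "(\<Sum>k<n. cnj (ws ! i $ k) * ws ! j $ k) = ws ! j \<bullet>c ws ! i" if "i < n" "j < n" for i j
  proof -
    have "dim_vec (ws ! i) = n"
      using ws that by (metis carrier_vecD nth_mem subsetD)
    then show ?thesis by (auto simp: scalar_prod_def atLeast0LessThan intro!: sum.cong)
  qed
  have NN: "(\<Sum>k<n. cnj (ws ! i $ k) * ws ! i $ k) = of_real (N i)" for i
    by (simp add: N_def complex_norm_square[symmetric] mult.commute[of "cnj _"])
  have Npos: "N i > 0" if "i < n" for i
  proof -
    have "of_real (N i) \<noteq> (0::complex)"
      unfolding NN[symmetric] sp[OF that that] using corthogonalD[OF ws(2)] that ws(3) by auto
    moreover have "N i \<ge> 0" by (simp add: N_def sum_nonneg)
    ultimately show ?thesis by (metis less_eq_real_def of_real_0)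
  qed
  define W where "W = Matrix.mat n n (\<lambda>(i,j). ws ! j $ i / of_real (sqrt (N j)))"
  have "unitary_mat n W"
  proof (rule unitaryI)
    fix i j assume ij: "i < n" "j < n"
    have "(\<Sum>k<n. cnj (W $$ (k,i)) * W $$ (k,j)) =
        (\<Sum>k<n. cnj (ws ! i $ k) * ws ! j $ k) / (of_real (sqrt (N i)) * of_real (sqrt (N j)))"
      using ij by (auto simp: W_def sum_divide_distrib intro!: sum.cong)
    also have "\<dots> = (if i = j then 1 else 0)"
    proof (cases "i = j")
      case True
      have "complex_of_real (sqrt (N j)) * of_real (sqrt (N j)) = of_real (N j)"
        using Npos[OF ij(2)] by (simp flip: of_real_mult)
      then show ?thesis using Npos[OF ij(2)] NN[of j] True by simp
    next
      case False
      then show ?thesis unfolding sp[OF ij] using corthogonalD[OF ws(2), of j i] ij ws(3) by auto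
    qed
    finally show "(\<Sum>k<n. cnj (W $$ (k,i)) * W $$ (k,j)) = (if i = j then 1 else 0)" .
  qed (simp add: W_def)
  moreover have "\<forall>i<n. W $$ (i,0) = (1 / of_real (sqrt (N 0))) * v $ i"
    using n by (simp add: W_def ws0)
  ultimately show ?thesis by blast
qed

text \<open>The direct sum of the one-dimensional identity and \<open>V\<close>, which lifts a
  diagonalization of the deflated matrix to the full one.\<close>

definition ext1 :: "nat \<Rightarrow> complex mat \<Rightarrow> complex mat" where
  "ext1 n V = Matrix.mat (Suc n) (Suc n) (\<lambda>(i,j). case i of 0 \<Rightarrow> (if j = 0 then 1 else 0)
     | Suc i' \<Rightarrow> (case j of 0 \<Rightarrow> 0 | Suc j' \<Rightarrow> V $$ (i',j')))"

lemma ext1_unitary: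
  assumes "unitary_mat n V"
  shows "unitary_mat (Suc n) (ext1 n V)"
proof (rule unitaryI)
  fix i j assume "i < Suc n" "j < Suc n"
  then show "(\<Sum>k<Suc n. cnj (ext1 n V $$ (k,i)) * ext1 n V $$ (k,j)) = (if i = j then 1 else 0)"
    unfolding sum.lessThan_Suc_shift
    by (cases i; cases j) (auto simp: ext1_def unitaryD[OF assms])
qed (simp add: ext1_def)

lemma mat_mult_spec:
  assumes "unitary_mat D W" "spec D V q (adj W * A * W)" "A \<in> carrier_mat D D"
  shows "spec D (W * V) q A"
proof -
  note V = specD[OF assms(2)] and W = unitary_carrier[OF assms(1)]
  have "A = W * (adj W * A * W) * adj W"
    using W assms(3) by (simp add: sq_assoc[of _ D] unitary_cancel[OF assms(1)] unitary_right[OF assms(1)])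
  also have "\<dots> = W * V * rdiag D q * adj (W * V)"
    unfolding V(2) adj_mult[OF W V(3)] using W V(3,5) by (simp add: sq_assoc[of _ D])
  finally show ?thesis using unitary_mult[OF assms(1) V(1)] by (simp add: spec_def)
qed

text \<open>Induction by deflation: in an orthonormal basis that starts with an eigenvector, the
  first column of the matrix is \<open>e\<close> times the first unit vector; Hermitian symmetry
  then clears the first row as well and makes \<open>e\<close> real.\<close>

lemma hermitian_spec:
  assumes "A \<in> carrier_mat D D" "adj A = A"
  shows "\<exists>U q. spec D U q A"
  using assms
proof (induction D arbitrary: A)
  case 0
  then have "A = 1\<^sub>m 0 * rdiag 0 (\<lambda>_. 0) * adj (1\<^sub>m 0)" by (intro eq_matI) (auto simp: mat_diag_def)
  then have "spec 0 (1\<^sub>m 0) (\<lambda>_. 0) A" unfolding spec_def by (intro conjI unitary_one)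
  then show ?case by blast
next
  case (Suc n A)
  note A = Suc.prems(1)
  obtain e where "eigenvalue A e"
    using spectrum_non_empty[OF A] by (auto simp: spectrum_def)
  then obtain v where "eigenvector A v e" by (auto simp: eigenvalue_def)
  then have v: "v \<in> carrier_vec (Suc n)" "v \<noteq> 0\<^sub>v (Suc n)" and ev: "A *\<^sub>v v = e \<cdot>\<^sub>v v"
    using A by (auto simp: eigenvector_def)
  obtain W c where W: "unitary_mat (Suc n) W" and Wc: "\<And>i. i < Suc n \<Longrightarrow> W $$ (i,0) = c * v $ i"
    using unitary_completion[OF v] by blast
  note Wcar = unitary_carrier[OF W]
  have AW: "(A * W) $$ (k,0) = e * W $$ (k,0)" if k: "k < Suc n" for k
  proof -
    have "(A * W) $$ (k,0) = (\<Sum>l<Suc n. A $$ (k,l) * (c * v $ l))"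
      by (subst mult_index[OF A Wcar k]) (auto simp: Wc simp del: sum.lessThan_Suc intro!: sum.cong)
    also have "\<dots> = c * (\<Sum>l<Suc n. A $$ (k,l) * v $ l)"
      by (simp add: sum_distrib_left algebra_simps del: sum.lessThan_Suc)
    also have "(\<Sum>l<Suc n. A $$ (k,l) * v $ l) = (A *\<^sub>v v) $ k"
      using A v k by (auto simp: scalar_prod_def atLeast0LessThan simp del: sum.lessThan_Suc intro!: sum.cong)
    finally show ?thesis using v k Wc[OF k] by (simp add: ev)
  qed
  define A' where "A' = adj W * A * W"
  have A'car: "A' \<in> carrier_mat (Suc n) (Suc n)" using A Wcar by (simp add: A'_def)
  have A'herm: "adj A' = A'"
    using A Wcar by (simp add: A'_def adj_mult[of _ "Suc n" "Suc n" _ "Suc n"] Suc.prems(2) sq_assoc[of _ "Suc n"])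
  have A'0: "A' $$ (i,0) = (if i = 0 then e else 0)" if i: "i < Suc n" for i
  proof -
    have "A' $$ (i,0) = (adj W * (A * W)) $$ (i,0)"
      using A Wcar by (simp add: A'_def sq_assoc[of _ "Suc n"])
    also have "\<dots> = (\<Sum>k<Suc n. adj W $$ (i,k) * (A * W) $$ (k,0))"
      by (rule mult_index) (use A Wcar i in auto)
    also have "\<dots> = (\<Sum>k<Suc n. cnj (W $$ (k,i)) * (e * W $$ (k,0)))"
      by (intro sum.cong refl) (use Wcar i AW in \<open>auto simp del: index_mult_mat(1)\<close>)
    also have "\<dots> = e * (\<Sum>k<Suc n. cnj (W $$ (k,i)) * W $$ (k,0))"
      by (simp add: sum_distrib_left algebra_simps del: sum.lessThan_Suc)
    also have "\<dots> = (if i = 0 then e else 0)"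
      using unitaryD[OF W i, of 0] by (simp del: sum.lessThan_Suc)
    finally show ?thesis .
  qed
  have herm: "A' $$ (i,j) = cnj (A' $$ (j,i))" if "i < Suc n" "j < Suc n" for i j
    using adj_index[of i A' j] that A'car A'herm by auto
  have e: "e = of_real (Re e)"
    using herm[of 0 0] A'0[of 0] by (simp add: complex_eq_iff)
  have A'0': "A' $$ (0,Suc j) = 0" if "j < n" for j
    using herm[of 0 "Suc j"] A'0[of "Suc j"] that by simp
  define B where "B = Matrix.mat n n (\<lambda>(i,j). A' $$ (Suc i, Suc j))"
  have "adj B = B" by (rule eq_matI) (auto simp: B_def herm[symmetric])
  then obtain V q where V: "spec n V q B" using Suc.IH[of B] by (auto simp: B_def)
  define p where "p = case_nat (Re e) q"
  have ent: "B $$ (i,j) = (\<Sum>k<n. V $$ (i,k) * of_real (q k) * cnj (V $$ (j,k)))" if "i < n" "j < n" for i j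
  proof -
    have "B $$ (i,j) = (V * rdiag n q * adj V) $$ (i,j)" using specD(2)[OF V] by simp
    also have "\<dots> = (\<Sum>k<n. V $$ (i,k) * of_real (q k) * adj V $$ (k,j))"
      by (rule mult_rdiag_index) (use specD[OF V] that in auto)
    finally show ?thesis using specD(3)[OF V] that by simp
  qed
  have E: "ext1 n V \<in> carrier_mat (Suc n) (Suc n)" by (simp add: ext1_def)
  have "A' = ext1 n V * rdiag (Suc n) p * adj (ext1 n V)"
  proof (rule eq_matI)
    fix i j assume "i < dim_row (ext1 n V * rdiag (Suc n) p * adj (ext1 n V))"
      "j < dim_col (ext1 n V * rdiag (Suc n) p * adj (ext1 n V))"
    then have ij: "i < Suc n" "j < Suc n" by (auto simp: ext1_def)
    have "(ext1 n V * rdiag (Suc n) p * adj (ext1 n V)) $$ (i,j) =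
        (\<Sum>k<Suc n. ext1 n V $$ (i,k) * of_real (p k) * adj (ext1 n V) $$ (k,j))"
      by (rule mult_rdiag_index) (use E ij in auto)
    also have "\<dots> = (\<Sum>k<Suc n. ext1 n V $$ (i,k) * of_real (p k) * cnj (ext1 n V $$ (j,k)))"
      by (intro sum.cong) (use E ij in auto)
    also have "\<dots> = A' $$ (i,j)"
      unfolding sum.lessThan_Suc_shift using ij A'0 A'0'
      by (cases i; cases j) (auto simp: ext1_def p_def e[symmetric] ent[symmetric], auto simp: B_def)
    finally show "A' $$ (i,j) = (ext1 n V * rdiag (Suc n) p * adj (ext1 n V)) $$ (i,j)" by simp
  qed (use A'car E in auto)
  then have "spec (Suc n) (ext1 n V) p A'"
    using ext1_unitary[OF specD(1)[OF V]] by (simp add: spec_def)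
  then show ?case using mat_mult_spec[OF W _ A] unfolding A'_def by blast
qed

section \<open>Positive semidefinite matrices\<close>

text \<open>Test vectors are functions on the naturals, so coordinate changes and columns of a
  matrix can be substituted without carrier conditions.\<close>

definition qform :: "nat \<Rightarrow> complex mat \<Rightarrow> (nat \<Rightarrow> complex) \<Rightarrow> complex" where
  "qform D A f = (\<Sum>i<D. \<Sum>j<D. cnj (f i) * A $$ (i,j) * f j)"

definition psd :: "nat \<Rightarrow> complex mat \<Rightarrow> bool" where
  "psd D A \<longleftrightarrow> A \<in> carrier_mat D D \<and> adj A = A \<and> (\<forall>f. 0 \<le> Re (qform D A f))"

lemma psdD: "psd D A \<Longrightarrow> A \<in> carrier_mat D D" "psd D A \<Longrightarrow> adj A = A" "psd D A \<Longrightarrow> 0 \<le> Re (qform D A f)"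
  by (auto simp: psd_def)

lemma density_op_psd:
  assumes "density_op D A"
  shows "psd D A" "mtrace A = 1"
proof -
  have A: "A \<in> carrier_mat D D" and h: "adj A = A" and tr: "mtrace A = 1"
    and q: "\<And>v. v \<in> carrier_vec D \<Longrightarrow> 0 \<le> Re (conjugate v \<bullet> (A *\<^sub>v v))"
    using assms by (auto simp: density_op_def hermitian_mat_def)
  have "0 \<le> Re (qform D A f)" for f
  proof -
    have "conjugate (vec D f) \<bullet> (A *\<^sub>v vec D f) = qform D A f"
      using A by (auto simp: qform_def scalar_prod_def atLeast0LessThan sum_distrib_left mult.assoc intro!: sum.cong)
    then show ?thesis using q[of "vec D f"] by simp
  qed
  then show "psd D A" using A h by (simp add: psd_def)
  show "mtrace A = 1" by fact
qed

lemma qform_cong: "(\<And>i. i < D \<Longrightarrow> f i = g i) \<Longrightarrow> qform D A f = qform D A g"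
  by (auto simp: qform_def intro!: sum.cong)

lemma qform_add: "A \<in> carrier_mat D D \<Longrightarrow> B \<in> carrier_mat D D \<Longrightarrow> qform D (A + B) f = qform D A f + qform D B f"
  unfolding qform_def sum.distrib[symmetric] by (intro sum.cong refl) (simp add: algebra_simps)

lemma qform_smult: "A \<in> carrier_mat D D \<Longrightarrow> qform D (c \<cdot>\<^sub>m A) f = c * qform D A f"
  by (auto simp: qform_def sum_distrib_left algebra_simps intro!: sum.cong)

lemma qform_msum:
  "qform D (msum D S F) f = (\<Sum>x\<in>S. qform D (F x) f)"
proof -
  have "qform D (msum D S F) f = (\<Sum>i<D. \<Sum>j<D. \<Sum>x\<in>S. cnj (f i) * F x $$ (i,j) * f j)"
    by (auto simp: qform_def msum_def sum_distrib_left sum_distrib_right intro!: sum.cong)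
  also have "\<dots> = (\<Sum>i<D. \<Sum>x\<in>S. \<Sum>j<D. cnj (f i) * F x $$ (i,j) * f j)"
    by (intro sum.cong refl sum.swap)
  also have "\<dots> = (\<Sum>x\<in>S. qform D (F x) f)"
    unfolding qform_def by (rule sum.swap)
  finally show ?thesis .
qed

lemma psd_add: "psd D A \<Longrightarrow> psd D B \<Longrightarrow> psd D (A + B)"
  by (auto simp: psd_def qform_add adj_add[of A D D B])

lemma psd_smult: "psd D A \<Longrightarrow> 0 \<le> c \<Longrightarrow> psd D (of_real c \<cdot>\<^sub>m A)"
  by (auto simp: psd_def qform_smult adj_smult)

lemma psd_msum:
  assumes "\<And>x. x \<in> S \<Longrightarrow> psd D (F x)"
  shows "psd D (msum D S F)"
proof -
  have h: "cnj (F x $$ (j,i)) = F x $$ (i,j)" if "x \<in> S" "i < D" "j < D" for x i j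
    using psdD(1)[OF assms[OF that(1)]] psdD(2)[OF assms[OF that(1)]] adj_index[of i "F x" j] that by auto
  have "adj (msum D S F) = msum D S F"
    by (intro eq_matI) (auto simp: msum_def h intro!: sum.cong)
  moreover have "0 \<le> Re (qform D (msum D S F) f)" for f
    unfolding qform_msum using assms by (auto intro!: sum_nonneg simp: psdD)
  ultimately show ?thesis by (auto simp: psd_def msum_def)
qed

lemma mtrace_add: "A \<in> carrier_mat D D \<Longrightarrow> B \<in> carrier_mat D D \<Longrightarrow> mtrace (A + B) = mtrace A + mtrace B"
  by (auto simp: mtrace_def sum.distrib)

lemma mtrace_minus: "A \<in> carrier_mat D D \<Longrightarrow> B \<in> carrier_mat D D \<Longrightarrow> mtrace (A - B) = mtrace A - mtrace B"
  by (auto simp: mtrace_def sum_subtractf)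

lemma mtrace_smult: "mtrace (c \<cdot>\<^sub>m A) = c * mtrace A" if "A \<in> carrier_mat D D"
  using that by (auto simp: mtrace_def sum_distrib_left)

lemma mtrace_msum:
  assumes "\<And>x. x \<in> S \<Longrightarrow> F x \<in> carrier_mat D D"
  shows "mtrace (msum D S F) = (\<Sum>x\<in>S. mtrace (F x))"
proof -
  have "mtrace (msum D S F) = (\<Sum>i<D. \<Sum>x\<in>S. F x $$ (i,i))"
    by (auto simp: mtrace_def msum_def)
  also have "\<dots> = (\<Sum>x\<in>S. \<Sum>i<D. F x $$ (i,i))" by (rule sum.swap)
  also have "\<dots> = (\<Sum>x\<in>S. mtrace (F x))"
    using assms by (auto simp: mtrace_def intro!: sum.cong)
  finally show ?thesis .
qed

lemma conj_index:
  assumes "U \<in> carrier_mat D D" "A \<in> carrier_mat D D" "i < D" "j < D"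
  shows "(adj U * A * U) $$ (i,j) = (\<Sum>k<D. \<Sum>l<D. cnj (U $$ (k,i)) * A $$ (k,l) * U $$ (l,j))"
proof -
  have "(adj U * A * U) $$ (i,j) = (\<Sum>l<D. (adj U * A) $$ (i,l) * U $$ (l,j))"
    by (rule mult_index) (use assms in auto)
  also have "\<dots> = (\<Sum>l<D. \<Sum>k<D. cnj (U $$ (k,i)) * A $$ (k,l) * U $$ (l,j))"
  proof (intro sum.cong refl)
    fix l assume "l \<in> {..<D}"
    then have "(adj U * A) $$ (i,l) = (\<Sum>k<D. adj U $$ (i,k) * A $$ (k,l))"
      by (intro mult_index) (use assms in auto)
    also have "\<dots> = (\<Sum>k<D. cnj (U $$ (k,i)) * A $$ (k,l))"
      using assms by (intro sum.cong) auto
    finally show "(adj U * A) $$ (i,l) * U $$ (l,j) = (\<Sum>k<D. cnj (U $$ (k,i)) * A $$ (k,l) * U $$ (l,j))"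
      by (simp add: sum_distrib_right)
  qed
  also have "\<dots> = (\<Sum>k<D. \<Sum>l<D. cnj (U $$ (k,i)) * A $$ (k,l) * U $$ (l,j))" by (rule sum.swap)
  finally show ?thesis .
qed

lemma qform_conj:
  assumes "U \<in> carrier_mat D D" "A \<in> carrier_mat D D"
  shows "qform D (adj U * A * U) f = qform D A (\<lambda>i. \<Sum>j<D. U $$ (i,j) * f j)"
proof -
  have "qform D (adj U * A * U) f =
      (\<Sum>i<D. \<Sum>j<D. \<Sum>k<D. \<Sum>l<D. cnj (f i) * (cnj (U $$ (k,i)) * A $$ (k,l) * U $$ (l,j)) * f j)"
    unfolding qform_def by (intro sum.cong refl) (simp add: conj_index[OF assms] sum_distrib_left sum_distrib_right del: index_mult_mat(1))
  also have "\<dots> = (\<Sum>k<D. \<Sum>l<D. \<Sum>i<D. \<Sum>j<D. cnj (f i) * (cnj (U $$ (k,i)) * A $$ (k,l) * U $$ (l,j)) * f j)"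
    by (subst (2) sum.swap, subst sum.swap, subst (3) sum.swap, subst (2) sum.swap) (rule refl)
  also have "\<dots> = qform D A (\<lambda>i. \<Sum>j<D. U $$ (i,j) * f j)"
    unfolding qform_def by (intro sum.cong refl) (simp add: sum_distrib_left sum_distrib_right sum_product algebra_simps)
  finally show ?thesis .
qed

lemma qform_rdiag: "qform D (rdiag D q) f = of_real (\<Sum>k<D. q k * (cmod (f k))\<^sup>2)"
proof -
  have "qform D (rdiag D q) f = (\<Sum>i<D. \<Sum>j<D. if j = i then of_real (q i) * (f i * cnj (f i)) else 0)"
    unfolding qform_def by (intro sum.cong refl) (auto simp: mat_diag_def)
  then show ?thesis by (simp add: complex_norm_square[symmetric])
qed

lemma qform_spec:
  assumes "spec D U q A"
  shows "qform D A f = of_real (\<Sum>k<D. q k * (cmod (\<Sum>i<D. cnj (U $$ (i,k)) * f i))\<^sup>2)"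
proof -
  note U = specD[OF assms]
  have "qform D A f = qform D (adj (adj U) * rdiag D q * adj U) f" using U(2) by simp
  also have "\<dots> = qform D (rdiag D q) (\<lambda>i. \<Sum>j<D. adj U $$ (i,j) * f j)"
    by (rule qform_conj) (use U in auto)
  also have "\<dots> = qform D (rdiag D q) (\<lambda>k. \<Sum>i<D. cnj (U $$ (i,k)) * f i)"
    by (rule qform_cong) (use U(3) in \<open>auto intro!: sum.cong\<close>)
  finally show ?thesis unfolding qform_rdiag .
qed

lemma spec_herm: "spec D U q A \<Longrightarrow> adj A = A"
proof -
  assume a: "spec D U q A"
  note U = specD[OF a]
  have "adj (U * rdiag D q * adj U) = U * rdiag D q * adj U"
    using U(3,5) by (simp add: adj_mult[of _ D D _ D] sq_assoc[of _ D])
  then show ?thesis using U(2) by simp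
qed

lemma spec_psd: "spec D U q A \<Longrightarrow> (\<And>i. i < D \<Longrightarrow> 0 \<le> q i) \<Longrightarrow> psd D A"
  unfolding psd_def using specD(4) spec_herm
  by (auto simp: qform_spec intro!: sum_nonneg)

lemma psd_conj:
  assumes "psd D A" "U \<in> carrier_mat D D"
  shows "psd D (adj U * A * U)"
  unfolding psd_def
proof (intro conjI allI)
  note A = psdD[OF assms(1)]
  show "adj U * A * U \<in> carrier_mat D D" using A(1) assms(2) by simp
  show "adj (adj U * A * U) = adj U * A * U"
    using A(1,2) assms(2) by (simp add: adj_mult[of _ D D _ D] sq_assoc[of _ D])
  show "0 \<le> Re (qform D (adj U * A * U) f)" for f
    using A(3) by (simp add: qform_conj[OF assms(2) A(1)])
qed

lemma qform_unit: "k < D \<Longrightarrow> qform D A (\<lambda>i. if i = k then 1 else 0) = A $$ (k,k)"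
proof -
  assume k: "k < D"
  have "qform D A (\<lambda>i. if i = k then 1 else 0) = (\<Sum>i<D. if i = k then (\<Sum>j<D. if j = k then A $$ (i,j) else 0) else 0)"
    unfolding qform_def
  proof (intro sum.cong refl)
    fix i
    have "cnj (if i = k then 1 else 0) * A $$ (i,j) * (if j = k then 1 else 0) = (if i = k then (if j = k then A $$ (i,j) else 0) else 0)" for j
      by simp
    then show "(\<Sum>j<D. cnj (if i = k then 1 else 0) * A $$ (i,j) * (if j = k then 1 else 0))
        = (if i = k then (\<Sum>j<D. if j = k then A $$ (i,j) else 0) else 0)"
      by (simp only: if_cancel sum.neutral_const split: if_split) simp
  qed
  also have "\<dots> = A $$ (k,k)" using k by simp
  finally show ?thesis .
qed

lemma psd_diag: "psd D A \<Longrightarrow> k < D \<Longrightarrow> 0 \<le> Re (A $$ (k,k))"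
  using psdD(3)[of D A "\<lambda>i. if i = k then 1 else 0"] by (simp add: qform_unit)

lemma psd_spec_nonneg:
  assumes "psd D A" "spec D U q A" "i < D"
  shows "0 \<le> q i"
proof -
  have "psd D (rdiag D q)"
    using psd_conj[OF assms(1) specD(3)[OF assms(2)]] spec_conj[OF assms(2)] by simp
  from psd_diag[OF this assms(3)] assms(3) show ?thesis by (simp add: mat_diag_def)
qed

lemma psd_specE:
  assumes "psd D A"
  obtains U q where "spec D U q A" "\<And>i. i < D \<Longrightarrow> 0 \<le> q i"
  using hermitian_spec[OF psdD(1)[OF assms] psdD(2)[OF assms]] psd_spec_nonneg[OF assms] by blast

lemma spec_mult:
  assumes "spec D U p A" "spec D U q B"
  shows "spec D U (\<lambda>i. p i * q i) (A * B)"
proof -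
  note U = specD[OF assms(1)]
  have "A * B = U * (rdiag D p * (adj U * (U * (rdiag D q * adj U))))"
    unfolding specD(2)[OF assms(1)] specD(2)[OF assms(2)] using U(3,5) by (simp add: sq_assoc[of _ D])
  also have "\<dots> = U * (rdiag D p * rdiag D q) * adj U"
    using U(3,5) by (simp add: sq_assoc[of _ D] unitary_cancel[OF U(1)] del: mat_diag_diag)
  finally show ?thesis using U(1) by (simp add: spec_def)
qed

lemma spec_eqI: "spec D U p A \<Longrightarrow> spec D U q B \<Longrightarrow> (\<And>i. i < D \<Longrightarrow> p i = q i) \<Longrightarrow> A = B"
  using spec_cong[of D U p A q] specD(2)[of D U q A] specD(2)[of D U q B] by simp

lemma spec_msqrt: "spec D U q A \<Longrightarrow> spec D U (\<lambda>i. sqrt (q i)) (msqrt A)"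
  unfolding msqrt_def by (rule spec_mfun)

lemma msqrt_psd:
  assumes "psd D A"
  shows "psd D (msqrt A)" "msqrt A * msqrt A = A"
proof -
  obtain U q where U: "spec D U q A" and q: "\<And>i. i < D \<Longrightarrow> 0 \<le> q i" using psd_specE[OF assms] by blast
  show "psd D (msqrt A)" using spec_psd[OF spec_msqrt[OF U]] q by simp
  show "msqrt A * msqrt A = A"
    using spec_eqI[OF spec_mult[OF spec_msqrt[OF U] spec_msqrt[OF U]] U] q by simp
qed

section \<open>Outcome probabilities of a measurement in the basis formed by the columns of
  \<open>U\<close>\<close>

definition mprob :: "nat \<Rightarrow> complex mat \<Rightarrow> complex mat \<Rightarrow> nat \<Rightarrow> real" where
  "mprob D U A k = Re (qform D A (\<lambda>i. U $$ (i,k)))"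

lemma mprob_entry:
  assumes "U \<in> carrier_mat D D" "A \<in> carrier_mat D D" "k < D"
  shows "mprob D U A k = Re ((adj U * A * U) $$ (k,k))"
  using conj_index[OF assms(1,2,3,3)] by (simp add: mprob_def qform_def)

lemma mprob_nonneg: "psd D A \<Longrightarrow> 0 \<le> mprob D U A k"
  by (simp add: mprob_def psdD)

lemma mprob_sum:
  assumes "unitary_mat D U" "A \<in> carrier_mat D D"
  shows "(\<Sum>k<D. mprob D U A k) = Re (mtrace A)"
proof -
  note c = unitary_carrier[OF assms(1)]
  have "(\<Sum>k<D. mprob D U A k) = (\<Sum>k<D. Re ((adj U * A * U) $$ (k,k)))"
    using mprob_entry[OF c assms(2)] by auto
  also have "\<dots> = Re (mtrace (adj U * A * U))" using c by (simp add: mtrace_def del: index_mult_mat(1))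
  finally show ?thesis using mtrace_conj[OF assms] by simp
qed

lemma mprob_add: "A \<in> carrier_mat D D \<Longrightarrow> B \<in> carrier_mat D D \<Longrightarrow> mprob D U (A + B) k = mprob D U A k + mprob D U B k"
  by (simp add: mprob_def qform_add)

lemma mprob_smult: "A \<in> carrier_mat D D \<Longrightarrow> mprob D U (of_real c \<cdot>\<^sub>m A) k = c * mprob D U A k"
  by (simp add: mprob_def qform_smult)

lemma mprob_spec:
  assumes "spec D V q A" "U \<in> carrier_mat D D" "k < D"
  shows "mprob D U A k = (\<Sum>i<D. q i * (cmod ((adj V * U) $$ (i,k)))\<^sup>2)"
proof -
  have "(adj V * U) $$ (i,k) = (\<Sum>l<D. cnj (V $$ (l,i)) * U $$ (l,k))" if "i < D" for i
  proof -
    have "(adj V * U) $$ (i,k) = (\<Sum>l<D. adj V $$ (i,l) * U $$ (l,k))"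
      by (rule mult_index) (use assms specD[OF assms(1)] that in auto)
    then show ?thesis using specD(3)[OF assms(1)] that by simp
  qed
  then show ?thesis unfolding mprob_def qform_spec[OF assms(1)] by (simp del: index_mult_mat(1))
qed

section \<open>Relative entropy and Holevo information\<close>

text \<open>Since \<open>x / 0 = 0\<close>, assumption \<open>dom\<close> only concerns the support of \<open>q\<close>;
  it is the trace of \<open>\<rho> \<le> 2 \<sigma>\<close> for states with spectra \<open>p\<close>, \<open>q\<close>.\<close>
lemma relative_entropy_scalar:
  fixes w :: "nat \<Rightarrow> nat \<Rightarrow> real" and p q :: "nat \<Rightarrow> real"
  assumes w: "\<And>i j. 0 \<le> w i j" and p: "\<And>i. i < D \<Longrightarrow> 0 \<le> p i" and q: "\<And>i. i < D \<Longrightarrow> 0 \<le> q i"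
    and row: "\<And>i. i < D \<Longrightarrow> (\<Sum>j<D. w i j) = 1" and col: "\<And>j. j < D \<Longrightarrow> (\<Sum>i<D. w i j) = 1"
    and sp: "(\<Sum>i<D. p i) = 1" and sq: "(\<Sum>j<D. q j) = 1"
    and supp: "\<And>i j. i < D \<Longrightarrow> j < D \<Longrightarrow> q j = 0 \<Longrightarrow> p i * w i j = 0"
    and dom: "\<And>i. i < D \<Longrightarrow> p i * (\<Sum>j<D. w i j / q j) \<le> 2"
  defines "S \<equiv> (\<Sum>i<D. \<Sum>j<D. w i j * p i * (ln (p i) - ln (q j)))"
  shows "S \<le> ln 2"
    and "S \<le> 2 * sqrt (2 - 2 * (\<Sum>i<D. \<Sum>j<D. w i j * (sqrt (p i) * sqrt (q j)))) * sqrt 2"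
proof -
  have cases: "p i * w i j = 0 \<or> (0 < p i \<and> 0 < q j)" if "i < D" "j < D" for i j
    using supp[OF that] p[OF that(1)] q[OF that(2)] by (cases "q j = 0") (auto simp: less_le)
  \<comment> \<open>Apply \<open>ln x \<le> x - 1\<close> at \<open>x = p i / (2 * q j)\<close>. The
    shift by 2 is the one for which the linear term, once bounded through \<open>dom\<close>,
    cancels the \<open>- 1\<close> and leaves \<open>ln 2\<close>.\<close>
  have t1: "w i j * p i * (ln (p i) - ln (q j)) \<le> w i j * p i * (ln 2 - 1) + p i * (p i * (w i j / q j)) / 2"
    if ij: "i < D" "j < D" for i j
  proof (cases "p i * w i j = 0")
    case False
    then have pq: "0 < p i" "0 < q j" using cases[OF ij] by auto
    have "ln (p i / (2 * q j)) \<le> p i / (2 * q j) - 1"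
      using pq by (intro ln_le_minus_one) auto
    then have "ln (p i) - ln (q j) \<le> (ln 2 - 1) + p i / (2 * q j)"
      using pq by (simp add: ln_div ln_mult)
    then have "w i j * p i * (ln (p i) - ln (q j)) \<le> w i j * p i * ((ln 2 - 1) + p i / (2 * q j))"
      using w pq by (intro mult_left_mono) auto
    then show ?thesis by (simp add: algebra_simps)
  qed auto
  have "S \<le> (\<Sum>i<D. \<Sum>j<D. w i j * p i * (ln 2 - 1) + p i * (p i * (w i j / q j)) / 2)"
    unfolding S_def by (intro sum_mono t1) auto
  also have "\<dots> = (\<Sum>i<D. p i * (ln 2 - 1) + p i * (p i * (\<Sum>j<D. w i j / q j)) / 2)"
  proof (intro sum.cong refl)
    fix i assume "i \<in> {..<D}"
    then have i: "i < D" by simp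
    have "(\<Sum>j<D. w i j * p i * (ln 2 - 1) + p i * (p i * (w i j / q j)) / 2) =
       (\<Sum>j<D. w i j) * (p i * (ln 2 - 1)) + p i * (p i * (\<Sum>j<D. w i j / q j)) / 2"
      unfolding sum.distrib sum_distrib_left sum_distrib_right sum_divide_distrib by (simp add: mult.assoc)
    then show "(\<Sum>j<D. w i j * p i * (ln 2 - 1) + p i * (p i * (w i j / q j)) / 2) =
        p i * (ln 2 - 1) + p i * (p i * (\<Sum>j<D. w i j / q j)) / 2" using row[OF i] by simp
  qed
  also have "\<dots> \<le> (\<Sum>i<D. p i * (ln 2 - 1) + p i * 2 / 2)"
    using p dom by (intro sum_mono add_left_mono divide_right_mono mult_left_mono) auto
  also have "\<dots> = (\<Sum>i<D. p i) * ln 2"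
    unfolding sum_distrib_right by (intro sum.cong refl) (simp add: algebra_simps)
  finally show "S \<le> ln 2" using sp by simp
  \<comment> \<open>For the second bound \<open>ln x\<close> becomes twice
    \<open>ln (sqrt x)\<close>, and the resulting product is split for Cauchy-Schwarz: the squares
    of \<open>a\<close> add up to a squared Hellinger distance, those of \<open>b\<close> to a
    chi-square type sum that \<open>dom\<close> bounds by 2.\<close>
  define a where "a = (\<lambda>(i,j). sqrt (w i j) * (sqrt (p i) - sqrt (q j)))"
  define b where "b = (\<lambda>(i,j). sqrt (w i j) * p i / sqrt (q j))"
  let ?P = "{..<D} \<times> {..<D}"
  have t2: "w i j * p i * (ln (p i) - ln (q j)) \<le> 2 * (\<bar>a (i,j)\<bar> * \<bar>b (i,j)\<bar>)"
    if ij: "i < D" "j < D" for i j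
  proof (cases "p i * w i j = 0")
    case False
    then have pq: "0 < p i" "0 < q j" using cases[OF ij] by auto
    have "ln (sqrt (p i) / sqrt (q j)) \<le> sqrt (p i) / sqrt (q j) - 1"
      using pq by (intro ln_le_minus_one) auto
    then have "ln (p i) - ln (q j) \<le> 2 * (sqrt (p i) / sqrt (q j) - 1)"
      using pq by (simp add: ln_div ln_sqrt)
    then have "w i j * p i * (ln (p i) - ln (q j)) \<le> w i j * p i * (2 * (sqrt (p i) / sqrt (q j) - 1))"
      using w pq by (intro mult_left_mono) auto
    also have "\<dots> = 2 * ((sqrt (w i j) * sqrt (w i j)) * (sqrt (p i) - sqrt (q j)) * p i / sqrt (q j))"
      using w[of i j] pq by (simp add: field_simps)
    also have "\<dots> = 2 * (a (i,j) * b (i,j))"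
      by (simp add: a_def b_def)
    also have "\<dots> \<le> 2 * (\<bar>a (i,j)\<bar> * \<bar>b (i,j)\<bar>)"
      using abs_ge_self[of "a (i,j) * b (i,j)"] by (simp add: abs_mult)
    finally show ?thesis .
  qed (auto simp: mult.commute)
  have "S = (\<Sum>(i,j)\<in>?P. w i j * p i * (ln (p i) - ln (q j)))"
    unfolding S_def by (simp add: sum.cartesian_product)
  also have "\<dots> \<le> (\<Sum>x\<in>?P. 2 * (\<bar>a x\<bar> * \<bar>b x\<bar>))"
    by (intro sum_mono) (use t2 in auto)
  also have "\<dots> = 2 * (\<Sum>x\<in>?P. \<bar>a x\<bar> * \<bar>b x\<bar>)" by (simp add: sum_distrib_left)
  also have "\<dots> \<le> 2 * (L2_set a ?P * L2_set b ?P)"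
    by (intro mult_left_mono L2_set_mult_ineq) auto
  finally have S: "S \<le> 2 * (L2_set a ?P * L2_set b ?P)" .
  have "(\<Sum>x\<in>?P. (a x)\<^sup>2) = (\<Sum>i<D. \<Sum>j<D. (a (i,j))\<^sup>2)"
    by (simp add: sum.cartesian_product)
  also have "\<dots> = (\<Sum>i<D. \<Sum>j<D. w i j * p i + w i j * q j - 2 * (w i j * (sqrt (p i) * sqrt (q j))))"
    using w p q by (intro sum.cong refl) (simp add: a_def power_mult_distrib power2_diff algebra_simps)
  also have "\<dots> = (\<Sum>i<D. \<Sum>j<D. w i j * p i) + (\<Sum>j<D. \<Sum>i<D. w i j * q j)
      - 2 * (\<Sum>i<D. \<Sum>j<D. w i j * (sqrt (p i) * sqrt (q j)))"
    unfolding sum_subtractf sum.distrib sum_distrib_left by (subst (2) sum.swap) simp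
  also have "(\<Sum>i<D. \<Sum>j<D. w i j * p i) = 1"
    using row sp by (simp flip: sum_distrib_right)
  also have "(\<Sum>j<D. \<Sum>i<D. w i j * q j) = 1"
    using col sq by (simp flip: sum_distrib_right)
  finally have A: "L2_set a ?P = sqrt (2 - 2 * (\<Sum>i<D. \<Sum>j<D. w i j * (sqrt (p i) * sqrt (q j))))"
    by (simp add: L2_set_def)
  have "(\<Sum>x\<in>?P. (b x)\<^sup>2) = (\<Sum>i<D. \<Sum>j<D. (b (i,j))\<^sup>2)"
    by (simp add: sum.cartesian_product)
  also have "\<dots> = (\<Sum>i<D. p i * (p i * (\<Sum>j<D. w i j / q j)))"
    using w q by (intro sum.cong refl)
      (auto simp: b_def power_mult_distrib power_divide sum_distrib_left power2_eq_square algebra_simps intro!: sum.cong)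
  also have "\<dots> \<le> (\<Sum>i<D. p i * 2)"
    using p dom by (intro sum_mono mult_left_mono) auto
  also have "\<dots> = 2" using sp by (simp flip: sum_distrib_right)
  finally have "L2_set b ?P \<le> sqrt 2" by (simp add: L2_set_def)
  then have "L2_set a ?P * L2_set b ?P \<le> L2_set a ?P * sqrt 2"
    by (intro mult_left_mono) auto
  with S show "S \<le> 2 * sqrt (2 - 2 * (\<Sum>i<D. \<Sum>j<D. w i j * (sqrt (p i) * sqrt (q j)))) * sqrt 2"
    unfolding A by simp
qed

lemma mtrace_spec_mult:
  assumes "spec D V q B" "A \<in> carrier_mat D D"
  shows "Re (mtrace (A * B)) = (\<Sum>j<D. q j * mprob D V A j)"
proof -
  note V = specD[OF assms(1)]
  have "mtrace (A * B) = mtrace (A * V * rdiag D q * adj V)"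
    unfolding V(2) using V(3,5) assms(2) by (simp add: sq_assoc[of _ D])
  also have "\<dots> = mtrace (adj V * (A * V * rdiag D q))"
    by (rule mtrace_comm[of _ D D]) (use V assms in auto)
  also have "adj V * (A * V * rdiag D q) = adj V * A * V * rdiag D q"
    using V(3,5) assms(2) by (simp add: sq_assoc[of _ D])
  also have "\<dots> = Matrix.mat D D (\<lambda>(i,j). (adj V * A * V) $$ (i,j) * of_real (q j))"
    by (rule mat_diag_mult_right) (use V(3,5) assms(2) in simp)
  finally show ?thesis
    using V(3) assms(2) by (simp add: mtrace_def mprob_entry mult.commute del: index_mult_mat(1))
qed

lemma spec_conj_unitary:
  assumes "spec D U p A" "unitary_mat D V"
  shows "spec D (adj V * U) p (adj V * A * V)"
proof -
  note U = specD[OF assms(1)] and V = unitary_carrier[OF assms(2)]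
  have "adj V * A * V = adj V * U * rdiag D p * adj (adj V * U)"
    unfolding U(2) using U(3,5) V by (simp add: adj_mult[of _ D D _ D] sq_assoc[of _ D])
  then show ?thesis using unitary_mult[OF unitary_adj[OF assms(2)] U(1)] by (simp add: spec_def)
qed

lemma vN_entropy_spec:
  "spec D U q A \<Longrightarrow> vN_entropy A = - (\<Sum>i<D. q i * log 2 (q i))"
  unfolding vN_entropy_def
  by (simp add: spec_trace[OF spec_mfun] sum_negf)

text \<open>The Nussbaum--Szkola weights, the squared overlaps of the two eigenbases, turn the relative
  entropy of two states into that of two classical distributions.\<close>
lemma relative_entropy_bounds:
  assumes A: "psd D A" "mtrace A = 1" and r: "psd D r" "mtrace r = 1"
    and V: "spec D V q r" and dom: "\<And>f. Re (qform D A f) \<le> 2 * Re (qform D r f)"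
  defines "S \<equiv> - vN_entropy A - (\<Sum>j<D. mprob D V A j * log 2 (q j))"
  shows "S \<le> 1" "S \<le> 2 * sqrt 2 / ln 2 * sqrt (2 - 2 * Re (mtrace (msqrt A * msqrt r)))"
proof -
  obtain U p where U: "spec D U p A" and p: "\<And>i. i < D \<Longrightarrow> 0 \<le> p i" using psd_specE[OF A(1)] by blast
  have q: "0 \<le> q j" if "j < D" for j using psd_spec_nonneg[OF r(1) V that] .
  note Uc = specD(3)[OF U] and Vc = specD(3)[OF V]
  define W where "W = adj U * V"
  have W: "unitary_mat D W" unfolding W_def by (intro unitary_mult unitary_adj specD(1)[OF U] specD(1)[OF V])
  define w where "w i j = (cmod (W $$ (i,j)))\<^sup>2" for i j
  have sp: "(\<Sum>i<D. p i) = 1" using spec_trace[OF U] A(2) by (metis of_real_eq_1_iff)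
  have sq: "(\<Sum>i<D. q i) = 1" using spec_trace[OF V] r(2) by (metis of_real_eq_1_iff)
  have dgA: "mprob D V A j = (\<Sum>i<D. p i * w i j)" if "j < D" for j
    using mprob_spec[OF U Vc that] by (simp add: w_def W_def)
  have dgr: "mprob D V r j = q j" if "j < D" for j
    using mprob_entry[OF Vc psdD(1)[OF r(1)] that] spec_conj[OF V] that by (simp add: mat_diag_def)
  have supp: "p i * w i j = 0" if "i < D" "j < D" "q j = 0" for i j
  proof -
    have "mprob D V A j \<le> 0" using dom[of "\<lambda>i. V $$ (i,j)"] dgr[OF that(2)] that(3) by (simp add: mprob_def)
    then have "(\<Sum>i<D. p i * w i j) \<le> 0" using dgA[OF that(2)] by simp
    moreover have "\<And>i. i \<in> {..<D} \<Longrightarrow> 0 \<le> p i * w i j" using p by (auto simp: w_def)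
    ultimately have "(\<Sum>i<D. p i * w i j) = 0" by (meson dual_order.antisym sum_nonneg)
    then show ?thesis using sum_nonneg_eq_0_iff[of "{..<D}" "\<lambda>i. p i * w i j"] p that(1) by (auto simp: w_def)
  qed
  have dom': "p i * (\<Sum>j<D. w i j / q j) \<le> 2" if i: "i < D" for i
  proof -
    define s where "s = (\<Sum>j<D. w i j / q j)"
    \<comment> \<open>With these coordinates in the eigenbasis of \<open>r\<close>, the test vector
      is the pseudo-inverse of \<open>r\<close> applied to the \<open>i\<close>-th eigenvector of
      \<open>A\<close>. The domination hypothesis at this vector yields
      \<open>p i * s^2 \<le> 2 * s\<close>.\<close>
    define c where "c j = cnj (W $$ (i,j)) / of_real (q j)" for j
    have s0: "0 \<le> s" unfolding s_def w_def by (intro sum_nonneg) (use q in auto)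
    have "qform D r (\<lambda>k. \<Sum>j<D. V $$ (k,j) * c j) = qform D (rdiag D q) c"
      using qform_conj[OF Vc psdD(1)[OF r(1)], of c] spec_conj[OF V] by simp
    also have "\<dots> = of_real (\<Sum>j<D. q j * (cmod (c j))\<^sup>2)" by (rule qform_rdiag)
    also have "(\<Sum>j<D. q j * (cmod (c j))\<^sup>2) = s"
      unfolding s_def by (intro sum.cong refl) (auto simp: c_def w_def norm_divide power_divide power2_eq_square)
    finally have 1: "Re (qform D r (\<lambda>k. \<Sum>j<D. V $$ (k,j) * c j)) = s" by simp
    have ent: "cnj ((adj V * U) $$ (l,k)) = W $$ (k,l)" if "k < D" "l < D" for k l
    proof -
      have "adj V * U = adj W" unfolding W_def using Uc Vc by (simp add: adj_mult[of _ D D _ D])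
      then show ?thesis using unitary_carrier[OF W] that by simp
    qed
    have "qform D A (\<lambda>k. \<Sum>j<D. V $$ (k,j) * c j) = qform D (adj V * A * V) c"
      using qform_conj[OF Vc psdD(1)[OF A(1)], of c] by simp
    also have "\<dots> = of_real (\<Sum>k<D. p k * (cmod (\<Sum>l<D. cnj ((adj V * U) $$ (l,k)) * c l))\<^sup>2)"
      by (rule qform_spec[OF spec_conj_unitary[OF U specD(1)[OF V]]])
    also have "(\<Sum>k<D. p k * (cmod (\<Sum>l<D. cnj ((adj V * U) $$ (l,k)) * c l))\<^sup>2) =
        (\<Sum>k<D. p k * (cmod (\<Sum>l<D. W $$ (k,l) * c l))\<^sup>2)"
      by (intro sum.cong refl arg_cong2[of _ _ _ _ "(*)"] arg_cong[of _ _ "\<lambda>x. (cmod x)\<^sup>2"]) (simp add: ent)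
    finally have 2: "Re (qform D A (\<lambda>k. \<Sum>j<D. V $$ (k,j) * c j)) = (\<Sum>k<D. p k * (cmod (\<Sum>l<D. W $$ (k,l) * c l))\<^sup>2)"
      by simp
    have "(\<Sum>l<D. W $$ (i,l) * c l) = of_real s"
      unfolding s_def of_real_sum
      by (intro sum.cong refl) (simp add: c_def w_def complex_norm_square[symmetric])
    then have "p i * s\<^sup>2 = p i * (cmod (\<Sum>l<D. W $$ (i,l) * c l))\<^sup>2" by simp
    also have "\<dots> \<le> (\<Sum>k<D. p k * (cmod (\<Sum>l<D. W $$ (k,l) * c l))\<^sup>2)"
      by (rule member_le_sum) (use p i in auto)
    also have "\<dots> \<le> 2 * s" using dom[of "\<lambda>k. \<Sum>j<D. V $$ (k,j) * c j"] 1 2 by simp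
    finally have "(p i * s) * s \<le> 2 * s" by (simp add: power2_eq_square)
    then show ?thesis using s0 by (cases "s = 0") (auto simp: s_def[symmetric])
  qed
  define T where "T = (\<Sum>i<D. \<Sum>j<D. w i j * p i * (ln (p i) - ln (q j)))"
  have row: "(\<Sum>j<D. w i j) = 1" if "i < D" for i using unitary_row_norm[OF W that] by (simp add: w_def)
  have col: "(\<Sum>i<D. w i j) = 1" if "j < D" for j using unitary_col_norm[OF W that] by (simp add: w_def)
  have "T = (\<Sum>i<D. \<Sum>j<D. w i j * (p i * ln (p i))) - (\<Sum>i<D. \<Sum>j<D. p i * w i j * ln (q j))"
    unfolding T_def sum_subtractf[symmetric] by (intro sum.cong refl) (simp add: algebra_simps)
  also have "(\<Sum>i<D. \<Sum>j<D. w i j * (p i * ln (p i))) = (\<Sum>i<D. p i * ln (p i))"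
    using row by (simp flip: sum_distrib_right)
  also have "(\<Sum>i<D. \<Sum>j<D. p i * w i j * ln (q j)) = (\<Sum>j<D. mprob D V A j * ln (q j))"
    by (subst sum.swap) (simp add: dgA sum_distrib_right)
  finally have ST: "S = T / ln 2"
    unfolding S_def vN_entropy_spec[OF U] by (simp add: log_def diff_divide_distrib sum_divide_distrib)
  \<comment> \<open>The overlap of the square roots is the Bhattacharyya coefficient of the two
    Nussbaum-Szkola distributions, which translates the second scalar bound into one on
    \<open>A\<close> and \<open>r\<close>.\<close>
  have "Re (mtrace (msqrt A * msqrt r)) = (\<Sum>j<D. sqrt (q j) * mprob D V (msqrt A) j)"
    by (rule mtrace_spec_mult[OF spec_msqrt[OF V] psdD(1)[OF msqrt_psd(1)[OF A(1)]]])
  also have "\<dots> = (\<Sum>j<D. \<Sum>i<D. w i j * (sqrt (p i) * sqrt (q j)))"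
    using mprob_spec[OF spec_msqrt[OF U] Vc]
    by (intro sum.cong refl) (simp add: w_def W_def sum_distrib_left ac_simps)
  also have "\<dots> = (\<Sum>i<D. \<Sum>j<D. w i j * (sqrt (p i) * sqrt (q j)))" by (rule sum.swap)
  finally have B: "Re (mtrace (msqrt A * msqrt r)) = \<dots>" .
  have w0: "0 \<le> w i j" for i j by (simp add: w_def)
  have R1: "T \<le> ln 2"
    unfolding T_def by (rule relative_entropy_scalar(1)[OF w0 p q row col sp sq supp dom'])
  have R2: "T \<le> 2 * sqrt (2 - 2 * Re (mtrace (msqrt A * msqrt r))) * sqrt 2"
    unfolding T_def B by (rule relative_entropy_scalar(2)[OF w0 p q row col sp sq supp dom'])
  show "S \<le> 1" unfolding ST using R1 by (simp add: field_simps)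
  have "T / ln 2 \<le> (2 * sqrt (2 - 2 * Re (mtrace (msqrt A * msqrt r))) * sqrt 2) / ln 2"
    using R2 by (rule divide_right_mono) simp
  then show "S \<le> 2 * sqrt 2 / ln 2 * sqrt (2 - 2 * Re (mtrace (msqrt A * msqrt r)))"
    unfolding ST by (simp add: ac_simps)
qed

text \<open>Relative to the eigenbasis of \<open>sqrt A - sqrt B\<close> each diagonal entry of \<open>sqrt A sqrt B\<close> dominates
  that of \<open>B\<close> or of \<open>A\<close>, according to the sign of the eigenvalue.\<close>
lemma sqrt_test_error:
  assumes A: "psd D A" and B: "psd D B" and U: "spec D U l (msqrt A - msqrt B)"
  shows "(\<Sum>k<D. if 0 \<le> l k then mprob D U B k else mprob D U A k) \<le> Re (mtrace (msqrt A * msqrt B))"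
proof -
  note Uc = specD(3)[OF U]
  define a where "a = adj U * msqrt A * U"
  define b where "b = adj U * msqrt B * U"
  note sA = msqrt_psd[OF A] and sB = msqrt_psd[OF B]
  note cA = psdD(1)[OF sA(1)] and cB = psdD(1)[OF sB(1)]
  have ca: "a \<in> carrier_mat D D" and cb: "b \<in> carrier_mat D D" using Uc cA cB by (simp_all add: a_def b_def)
  have prod: "adj U * X * U * (adj U * Y * U) = adj U * (X * Y) * U"
    if "X \<in> carrier_mat D D" "Y \<in> carrier_mat D D" for X Y
    using that Uc by (simp add: sq_assoc[of _ D] unitary_cancel[OF specD(1)[OF U]])
  have aa: "a * a = adj U * A * U" and bb: "b * b = adj U * B * U" and ab: "a * b = adj U * (msqrt A * msqrt B) * U"
    unfolding a_def b_def by (simp_all only: prod cA cB sA(2) sB(2))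
  have "adj U * (msqrt A - msqrt B) * U = a - b"
    unfolding a_def b_def using Uc cA cB
    by (simp add: mult_minus_distrib_mat[of _ D D _ D] minus_mult_distrib_mat[of _ D D _ _ D])
  then have diff: "a - b = rdiag D l" using spec_conj[OF U] by simp
  have ent: "a $$ (i,j) = b $$ (i,j) + (if i = j then of_real (l j) else 0)" if "i < D" "j < D" for i j
  proof -
    have "(a - b) $$ (i,j) = rdiag D l $$ (i,j)" using diff by simp
    then show ?thesis using that ca cb by (auto simp: mat_diag_def algebra_simps split: if_splits)
  qed
  have pa: "0 \<le> Re (a $$ (k,k))" and pb: "0 \<le> Re (b $$ (k,k))" if "k < D" for k
    unfolding a_def b_def using psd_diag[OF psd_conj[OF sA(1) Uc] that] psd_diag[OF psd_conj[OF sB(1) Uc] that] by auto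
  \<comment> \<open>From \<open>a = b + diag l\<close> the product \<open>a b\<close> equals both
    \<open>b b + diag l b\<close> and \<open>a a - a diag l\<close>. The first form serves the
    outcomes with \<open>l k \<ge> 0\<close>, the second the others; in each the correction term has
    a nonnegative diagonal entry there.\<close>
  have key: "(if 0 \<le> l k then mprob D U B k else mprob D U A k) \<le> Re ((a * b) $$ (k,k))" if k: "k < D" for k
  proof (cases "0 \<le> l k")
    case True
    have "(a * b) $$ (k,k) = (\<Sum>j<D. a $$ (k,j) * b $$ (j,k))" by (rule mult_index[OF ca cb k k])
    also have "\<dots> = (\<Sum>j<D. b $$ (k,j) * b $$ (j,k) + (if j = k then of_real (l k) * b $$ (k,k) else 0))"
      by (intro sum.cong refl) (auto simp: ent[OF k] algebra_simps)
    also have "\<dots> = (b * b) $$ (k,k) + of_real (l k) * b $$ (k,k)"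
      using k unfolding mult_index[OF cb cb k k] sum.distrib by simp
    finally have "Re ((a * b) $$ (k,k)) = mprob D U B k + l k * Re (b $$ (k,k))"
      using mprob_entry[OF Uc psdD(1)[OF B] k] bb by simp
    then show ?thesis using True pb[OF k] by simp
  next
    case False
    have "(a * b) $$ (k,k) = (\<Sum>j<D. a $$ (k,j) * b $$ (j,k))" by (rule mult_index[OF ca cb k k])
    also have "\<dots> = (\<Sum>j<D. a $$ (k,j) * a $$ (j,k) - (if j = k then of_real (l k) * a $$ (k,k) else 0))"
    proof (intro sum.cong refl)
      fix j assume "j \<in> {..<D}"
      then have "b $$ (j,k) = a $$ (j,k) - (if j = k then of_real (l k) else 0)" using ent[of j k] k by simp
      then show "a $$ (k,j) * b $$ (j,k) = a $$ (k,j) * a $$ (j,k) - (if j = k then of_real (l k) * a $$ (k,k) else 0)"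
        by (simp only:) (simp add: right_diff_distrib mult.commute)
    qed
    also have "\<dots> = (a * a) $$ (k,k) - of_real (l k) * a $$ (k,k)"
      using k unfolding mult_index[OF ca ca k k] sum_subtractf by simp
    finally have "Re ((a * b) $$ (k,k)) = mprob D U A k - l k * Re (a $$ (k,k))"
      using mprob_entry[OF Uc psdD(1)[OF A] k] aa by simp
    moreover have "l k * Re (a $$ (k,k)) \<le> 0" using False pa[OF k] by (simp add: mult_nonpos_nonneg)
    ultimately show ?thesis using False by simp
  qed
  have "(\<Sum>k<D. if 0 \<le> l k then mprob D U B k else mprob D U A k) \<le> (\<Sum>k<D. Re ((a * b) $$ (k,k)))"
    by (intro sum_mono key) auto
  also have "\<dots> = Re (mtrace (a * b))" using ca cb by (simp add: mtrace_def del: index_mult_mat(1))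
  also have "\<dots> = Re (mtrace (msqrt A * msqrt B))"
    unfolding ab using mtrace_conj(1)[OF specD(1)[OF U]] cA cB by simp
  finally show ?thesis .
qed

lemma mprob_minus: "A \<in> carrier_mat D D \<Longrightarrow> B \<in> carrier_mat D D \<Longrightarrow> mprob D U (A - B) k = mprob D U A k - mprob D U B k"
proof -
  assume c: "A \<in> carrier_mat D D" "B \<in> carrier_mat D D"
  have "qform D (A - B) f = qform D A f - qform D B f" for f
    unfolding qform_def sum_subtractf[symmetric] by (intro sum.cong refl) (use c in \<open>simp add: algebra_simps\<close>)
  then show ?thesis by (simp add: mprob_def)
qed

text \<open>A Powers-Stormer inequality, with the full trace norm of \<open>A - B\<close> in place
  of half of it. The error of the square-root test is 1 minus the excess of \<open>A\<close> over
  \<open>B\<close> on the outcomes with \<open>l k \<ge> 0\<close>. Expanded in the eigenbasis of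
  \<open>A - B\<close>, with weights that sum to 1 over the outcomes, this excess is at most the sum
  of the \<open>\<bar>m i\<bar>\<close>.\<close>

lemma powers_stormer:
  assumes A: "psd D A" "mtrace A = 1" and B: "psd D B" "mtrace B = 1" and V: "spec D V m (A - B)"
  shows "1 - (\<Sum>i<D. \<bar>m i\<bar>) \<le> Re (mtrace (msqrt A * msqrt B))"
proof -
  note cA = psdD(1)[OF A(1)] and cB = psdD(1)[OF B(1)]
  have "msqrt A - msqrt B \<in> carrier_mat D D" "adj (msqrt A - msqrt B) = msqrt A - msqrt B"
    using psdD(1,2)[OF msqrt_psd(1)[OF A(1)]] psdD(1,2)[OF msqrt_psd(1)[OF B(1)]]
    by (auto simp: adj_minus[of _ D D])
  then obtain U l where U: "spec D U l (msqrt A - msqrt B)" using hermitian_spec by blast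
  note Uc = specD(3)[OF U]
  have W: "unitary_mat D (adj V * U)" by (intro unitary_mult unitary_adj specD(1)[OF U] specD(1)[OF V])
  have "(\<Sum>k<D. if 0 \<le> l k then mprob D U B k else mprob D U A k)
      = (\<Sum>k<D. mprob D U A k) - (\<Sum>k<D. if 0 \<le> l k then mprob D U (A - B) k else 0)"
    unfolding sum_subtractf[symmetric] by (intro sum.cong refl) (simp add: mprob_minus[OF cA cB])
  moreover have "(\<Sum>k<D. if 0 \<le> l k then mprob D U (A - B) k else 0)
      \<le> (\<Sum>k<D. \<Sum>i<D. \<bar>m i\<bar> * (cmod ((adj V * U) $$ (i,k)))\<^sup>2)"
  proof (intro sum_mono)
    fix k assume "k \<in> {..<D}"
    then have k: "k < D" by simp
    have "mprob D U (A - B) k \<le> (\<Sum>i<D. \<bar>m i\<bar> * (cmod ((adj V * U) $$ (i,k)))\<^sup>2)"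
      unfolding mprob_spec[OF V Uc k] by (intro sum_mono mult_right_mono) auto
    moreover have "0 \<le> (\<Sum>i<D. \<bar>m i\<bar> * (cmod ((adj V * U) $$ (i,k)))\<^sup>2)" by (intro sum_nonneg) auto
    ultimately show "(if 0 \<le> l k then mprob D U (A - B) k else 0) \<le> (\<Sum>i<D. \<bar>m i\<bar> * (cmod ((adj V * U) $$ (i,k)))\<^sup>2)"
      by simp
  qed
  moreover have "(\<Sum>k<D. \<Sum>i<D. \<bar>m i\<bar> * (cmod ((adj V * U) $$ (i,k)))\<^sup>2) = (\<Sum>i<D. \<bar>m i\<bar>)"
    by (subst sum.swap) (use unitary_row_norm[OF W] in \<open>simp flip: sum_distrib_left\<close>)
  moreover have "(\<Sum>k<D. mprob D U A k) = 1" using mprob_sum[OF specD(1)[OF U] cA] A(2) by simp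
  ultimately show ?thesis using sqrt_test_error[OF A(1) B(1) U] by linarith
qed

section \<open>Bhattacharyya coefficients of measured states\<close>

definition bhatt :: "nat \<Rightarrow> complex mat \<Rightarrow> complex mat \<Rightarrow> complex mat \<Rightarrow> real" where
  "bhatt D U A B = (\<Sum>k<D. sqrt (mprob D U A k * mprob D U B k))"

text \<open>Taken as an infimum, so that no optimal basis has to be exhibited: any single basis
  gives an upper bound, and lower bounds come from \<open>min_bhatt_greatest\<close>.\<close>

definition min_bhatt :: "nat \<Rightarrow> complex mat \<Rightarrow> complex mat \<Rightarrow> real" where
  "min_bhatt D A B = Inf {bhatt D U A B |U. unitary_mat D U}"

lemma bhatt_nonneg: "psd D A \<Longrightarrow> psd D B \<Longrightarrow> 0 \<le> bhatt D U A B"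
  by (auto simp: bhatt_def mprob_nonneg intro!: sum_nonneg)

lemma bhatt_le_1:
  assumes "psd D A" "psd D B" "mtrace A = 1" "mtrace B = 1" "unitary_mat D U"
  shows "bhatt D U A B \<le> 1"
proof -
  have "bhatt D U A B \<le> (\<Sum>k<D. (mprob D U A k + mprob D U B k) / 2)"
    unfolding bhatt_def using arith_geo_mean_sqrt mprob_nonneg[OF assms(1)] mprob_nonneg[OF assms(2)]
    by (intro sum_mono) auto
  also have "\<dots> = 1"
    using mprob_sum[OF assms(5) psdD(1)[OF assms(1)]] mprob_sum[OF assms(5) psdD(1)[OF assms(2)]] assms
    by (simp add: sum.distrib flip: sum_divide_distrib)
  finally show ?thesis .
qed

lemma min_bhatt_le: "psd D A \<Longrightarrow> psd D B \<Longrightarrow> unitary_mat D U \<Longrightarrow> min_bhatt D A B \<le> bhatt D U A B"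
  unfolding min_bhatt_def by (rule cInf_lower) (auto intro!: bdd_belowI[of _ 0] bhatt_nonneg)

lemma min_bhatt_greatest: "(\<And>U. unitary_mat D U \<Longrightarrow> x \<le> bhatt D U A B) \<Longrightarrow> x \<le> min_bhatt D A B"
  unfolding min_bhatt_def by (rule cInf_greatest) (auto intro: unitary_one)

lemma min_bhatt_nonneg: "psd D A \<Longrightarrow> psd D B \<Longrightarrow> 0 \<le> min_bhatt D A B"
  by (rule min_bhatt_greatest) (rule bhatt_nonneg)

lemma min_bhatt_le_1: "psd D A \<Longrightarrow> psd D B \<Longrightarrow> mtrace A = 1 \<Longrightarrow> mtrace B = 1 \<Longrightarrow> min_bhatt D A B \<le> 1"
  using min_bhatt_le[of D A B "1\<^sub>m D"] bhatt_le_1[of D A B "1\<^sub>m D"] by simp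

lemma min_bhatt_sym: "min_bhatt D A B = min_bhatt D B A"
  by (simp add: min_bhatt_def bhatt_def mult.commute)

text \<open>Factor \<open>p^2 - q^2 = (p - q) (p + q)\<close> and apply Cauchy-Schwarz. For a
  coefficient \<open>z\<close> the two norms are \<open>sqrt (2 - 2 z)\<close> and
  \<open>sqrt (2 + 2 z)\<close>, the latter at most 2.\<close>

lemma l1_le_bhatt:
  assumes "psd D A" "psd D B" "mtrace A = 1" "mtrace B = 1" "unitary_mat D U"
  shows "(\<Sum>k<D. \<bar>mprob D U A k - mprob D U B k\<bar>) \<le> 2 * sqrt (2 - 2 * bhatt D U A B)"
proof -
  define p q where "p k = sqrt (mprob D U A k)" and "q k = sqrt (mprob D U B k)" for k
  note nA = mprob_nonneg[OF assms(1), of U] and nB = mprob_nonneg[OF assms(2), of U]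
  have s: "(\<Sum>k<D. mprob D U A k) = 1" "(\<Sum>k<D. mprob D U B k) = 1"
    using mprob_sum[OF assms(5) psdD(1)[OF assms(1)]] mprob_sum[OF assms(5) psdD(1)[OF assms(2)]] assms by auto
  have sq: "p k * p k = mprob D U A k" "q k * q k = mprob D U B k" for k using nA nB by (auto simp: p_def q_def)
  have bhatt: "bhatt D U A B = (\<Sum>k<D. p k * q k)" by (simp add: bhatt_def p_def q_def real_sqrt_mult)
  have "(\<Sum>k<D. \<bar>mprob D U A k - mprob D U B k\<bar>) = (\<Sum>k<D. \<bar>p k - q k\<bar> * \<bar>p k + q k\<bar>)"
    by (intro sum.cong refl) (simp add: sq[symmetric] algebra_simps flip: abs_mult)
  also have "\<dots> \<le> L2_set (\<lambda>k. p k - q k) {..<D} * L2_set (\<lambda>k. p k + q k) {..<D}"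
    by (rule L2_set_mult_ineq)
  also have "L2_set (\<lambda>k. p k - q k) {..<D} = sqrt (2 - 2 * bhatt D U A B)"
  proof -
    have "(\<Sum>k<D. (p k - q k)\<^sup>2) = (\<Sum>k<D. mprob D U A k) + (\<Sum>k<D. mprob D U B k) - 2 * (\<Sum>k<D. p k * q k)"
      unfolding sum_distrib_left sum.distrib[symmetric] sum_subtractf[symmetric]
      by (intro sum.cong refl) (simp add: sq[symmetric] power2_eq_square algebra_simps)
    then show ?thesis by (simp add: L2_set_def s bhatt)
  qed
  also have "L2_set (\<lambda>k. p k + q k) {..<D} = sqrt (2 + 2 * bhatt D U A B)"
  proof -
    have "(\<Sum>k<D. (p k + q k)\<^sup>2) = (\<Sum>k<D. mprob D U A k) + (\<Sum>k<D. mprob D U B k) + 2 * (\<Sum>k<D. p k * q k)"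
      unfolding sum_distrib_left sum.distrib[symmetric]
      by (intro sum.cong refl) (simp add: sq[symmetric] power2_eq_square algebra_simps)
    then show ?thesis by (simp add: L2_set_def s bhatt)
  qed
  also have "sqrt (2 + 2 * bhatt D U A B) \<le> 2"
    using bhatt_le_1[OF assms] by (intro real_le_lsqrt) auto
  finally show ?thesis using bhatt_le_1[OF assms] by (simp add: mult.commute mult_right_mono)
qed

lemma half_state:
  assumes "psd D A" "psd D B" "mtrace A = 1" "mtrace B = 1"
  shows "psd D ((1/2) \<cdot>\<^sub>m (A + B))" "mtrace ((1/2) \<cdot>\<^sub>m (A + B)) = 1"
proof -
  show "psd D ((1/2) \<cdot>\<^sub>m (A + B))" using psd_smult[OF psd_add[OF assms(1,2)], of "1/2"] by simp
  show "mtrace ((1/2) \<cdot>\<^sub>m (A + B)) = 1"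
    using psdD(1)[OF assms(1)] psdD(1)[OF assms(2)] assms by (simp add: mtrace_smult[of _ D] mtrace_add[of _ D])
qed

text \<open>Measuring \<open>A - B\<close> in its own eigenbasis \<open>V\<close> loses nothing: the
  differences of the outcome probabilities are the eigenvalues. Hence the coefficient controls the
  trace norm of \<open>A - B\<close>, and with it that of \<open>A - r\<close>, which is half as
  large.\<close>

lemma sqrt_overlap_half:
  assumes "psd D A" "psd D B" "mtrace A = 1" "mtrace B = 1"
  defines "r \<equiv> (1/2) \<cdot>\<^sub>m (A + B)"
  shows "1 - sqrt (2 - 2 * min_bhatt D A B) \<le> Re (mtrace (msqrt A * msqrt r))"
proof -
  note cA = psdD(1)[OF assms(1)] and cB = psdD(1)[OF assms(2)]
  have "A - B \<in> carrier_mat D D" "adj (A - B) = A - B"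
    using cA cB psdD(2)[OF assms(1)] psdD(2)[OF assms(2)] by (auto simp: adj_minus[of _ D D])
  then obtain V m where V: "spec D V m (A - B)" using hermitian_spec by blast
  note Vu = specD(1)[OF V] and Vc = specD(3)[OF V]
  have "A - r = (1/2) \<cdot>\<^sub>m (A - B)" unfolding r_def using cA cB by (intro eq_matI) (auto simp: field_simps)
  also have "\<dots> = V * rdiag D (\<lambda>i. m i / 2) * adj V"
  proof -
    have "(1/2) \<cdot>\<^sub>m (V * rdiag D m * adj V) = V * ((1/2) \<cdot>\<^sub>m rdiag D m) * adj V"
      using Vc by (simp add: mult_smult_assoc_mat[of _ D D _ D] mult_smult_distrib[of _ D D _ D])
    also have "(1/2) \<cdot>\<^sub>m rdiag D m = rdiag D (\<lambda>i. m i / 2)"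
      by (rule eq_matI) (auto simp: mat_diag_def)
    finally show ?thesis using specD(2)[OF V] by simp
  qed
  finally have V': "spec D V (\<lambda>i. m i / 2) (A - r)" using Vu by (simp add: spec_def)
  have "m k = mprob D V A k - mprob D V B k" if "k < D" for k
    using mprob_entry[OF Vc _ that, of "A - B"] cA cB spec_conj[OF V] that
    by (simp add: mprob_minus[OF cA cB] mat_diag_def del: minus_carrier_mat) (simp add: minus_carrier_mat[OF cB])
  then have "(\<Sum>k<D. \<bar>m k\<bar>) \<le> 2 * sqrt (2 - 2 * bhatt D V A B)"
    using l1_le_bhatt[OF assms(1-4) Vu] by simp
  also have "\<dots> \<le> 2 * sqrt (2 - 2 * min_bhatt D A B)"
    using min_bhatt_le[OF assms(1,2) Vu] by simp
  finally have "(\<Sum>k<D. \<bar>m k / 2\<bar>) \<le> sqrt (2 - 2 * min_bhatt D A B)"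
    by (simp flip: sum_divide_distrib)
  then show ?thesis
    using powers_stormer[OF assms(1,3) half_state[OF assms(1-4), folded r_def] V'] by linarith
qed

section \<open>Holevo information of two equally likely states\<close>

definition holevo :: "complex mat \<Rightarrow> complex mat \<Rightarrow> real" where
  "holevo A B = vN_entropy ((1/2) \<cdot>\<^sub>m (A + B)) - vN_entropy A / 2 - vN_entropy B / 2"

text \<open>In the eigenbasis of the average state \<open>r\<close> the Holevo information is the
  mean of the two relative entropies with respect to \<open>r\<close>. Positivity of the other state
  gives \<open>A \<le> 2 r\<close> and \<open>B \<le> 2 r\<close>, the domination that
  \<open>relative_entropy_bounds\<close> asks for.\<close>

lemma holevo_bounds:
  assumes "psd D A" "psd D B" "mtrace A = 1" "mtrace B = 1"
  shows "holevo A B \<le> 1"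
    and "holevo A B \<le> 2 * sqrt 2 / ln 2 * sqrt (2 * sqrt (2 - 2 * min_bhatt D A B))"
proof -
  define r where "r = (1/2) \<cdot>\<^sub>m (A + B)"
  note r = half_state[OF assms, folded r_def]
  note cA = psdD(1)[OF assms(1)] and cB = psdD(1)[OF assms(2)]
  obtain V q where V: "spec D V q r" using psd_specE[OF r(1)] by blast
  have qr: "2 * Re (qform D r f) = Re (qform D A f) + Re (qform D B f)" for f
    unfolding r_def using cA cB by (simp add: qform_smult qform_add)
  have dA: "Re (qform D A f) \<le> 2 * Re (qform D r f)" and dB: "Re (qform D B f) \<le> 2 * Re (qform D r f)" for f
    using qr[of f] psdD(3)[OF assms(1), of f] psdD(3)[OF assms(2), of f] by auto
  define SA where "SA = - vN_entropy A - (\<Sum>j<D. mprob D V A j * log 2 (q j))"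
  define SB where "SB = - vN_entropy B - (\<Sum>j<D. mprob D V B j * log 2 (q j))"
  have "q j = (mprob D V A j + mprob D V B j) / 2" if "j < D" for j
  proof -
    have "mprob D V r j = q j"
      using mprob_entry[OF specD(3)[OF V] psdD(1)[OF r(1)] that] spec_conj[OF V] that by (simp add: mat_diag_def)
    then show ?thesis using qr[of "\<lambda>i. V $$ (i,j)"] by (simp add: mprob_def)
  qed
  then have "vN_entropy r = - (\<Sum>j<D. (mprob D V A j + mprob D V B j) / 2 * log 2 (q j))"
    unfolding vN_entropy_spec[OF V] by (intro arg_cong[of _ _ uminus] sum.cong refl) (simp add: mult.commute)
  also have "\<dots> = - (\<Sum>j<D. mprob D V A j * log 2 (q j)) / 2 - (\<Sum>j<D. mprob D V B j * log 2 (q j)) / 2"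
    by (simp add: add_divide_distrib distrib_right sum.distrib sum_divide_distrib)
  finally have I: "holevo A B = (SA + SB) / 2" unfolding holevo_def r_def[symmetric] SA_def SB_def by (simp add: field_simps)
  note RA = relative_entropy_bounds[OF assms(1,3) r V dA, folded SA_def]
  note RB = relative_entropy_bounds[OF assms(2,4) r V dB, folded SB_def]
  show "holevo A B \<le> 1" using I RA(1) RB(1) by simp
  have rB: "r = (1/2) \<cdot>\<^sub>m (B + A)" unfolding r_def using cA cB by (simp add: comm_add_mat[of A D D])
  have c: "0 \<le> 2 * sqrt 2 / ln (2::real)" by simp
  have "SA \<le> 2 * sqrt 2 / ln 2 * sqrt (2 * sqrt (2 - 2 * min_bhatt D A B))"
    using sqrt_overlap_half[OF assms, folded r_def]
    by (intro order_trans[OF RA(2)] mult_left_mono[OF _ c]) simp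
  moreover have "SB \<le> 2 * sqrt 2 / ln 2 * sqrt (2 * sqrt (2 - 2 * min_bhatt D A B))"
    using sqrt_overlap_half[OF assms(2,1,4,3), folded rB] min_bhatt_sym[of D A B]
    by (intro order_trans[OF RB(2)] mult_left_mono[OF _ c]) simp
  ultimately show "holevo A B \<le> 2 * sqrt 2 / ln 2 * sqrt (2 * sqrt (2 - 2 * min_bhatt D A B))"
    using I by simp
qed

text \<open>An affine bound survives averaging over prefix bits, so it transfers from pairs of
  states to split channels with the same \<open>K\<close>. Continuity of the explicit bound at 0
  gives a threshold \<open>e\<close>: where \<open>1 - min_bhatt D A B < e\<close> the information
  is at most \<delta>, and elsewhere the trivial bound 1 is at most the linear term with slope
  \<open>1 / e\<close>. The slope does not depend on \<open>D\<close>.\<close>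

lemma holevo_affine_bound:
  assumes "0 < \<delta>"
  shows "\<exists>K\<ge>0. \<forall>D A B. psd D A \<longrightarrow> psd D B \<longrightarrow> mtrace A = 1 \<longrightarrow> mtrace B = 1 \<longrightarrow>
    holevo A B \<le> \<delta> + K * (1 - min_bhatt D A B)"
proof -
  define g where "g x = 2 * sqrt 2 / ln 2 * sqrt (2 * sqrt (2 * x))" for x :: real
  have "isCont g 0" unfolding g_def by (intro continuous_intros) auto
  then have "(g \<longlongrightarrow> 0) (at 0)" by (simp add: isCont_def g_def)
  then obtain e where e: "0 < e" "\<And>x. x \<noteq> 0 \<Longrightarrow> \<bar>x\<bar> < e \<Longrightarrow> \<bar>g x\<bar> < \<delta>"
    using assms by (auto simp: LIM_eq)
  have "holevo A B \<le> \<delta> + 1 / e * (1 - min_bhatt D A B)"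
    if h: "psd D A" "psd D B" "mtrace A = 1" "mtrace B = 1" for D A B
  proof (cases "1 - min_bhatt D A B < e")
    case True
    have m: "min_bhatt D A B \<le> 1" by (rule min_bhatt_le_1[OF h])
    have "holevo A B \<le> g (1 - min_bhatt D A B)" using holevo_bounds(2)[OF h] by (simp add: g_def)
    also have "\<dots> \<le> \<delta>"
      using e(2)[of "1 - min_bhatt D A B"] True m assms by (cases "min_bhatt D A B = 1") (auto simp: g_def)
    also have "\<dots> \<le> \<delta> + 1 / e * (1 - min_bhatt D A B)" using e m by simp
    finally show ?thesis .
  next
    case False
    have "holevo A B \<le> 1" by (rule holevo_bounds[OF h])
    also have "1 \<le> 1 / e * (1 - min_bhatt D A B)" using False e by (simp add: field_simps)
    finally show ?thesis using assms by simp
  qed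
  then show ?thesis using e by (intro exI[of _ "1 / e"]) auto
qed

section \<open>Tensor products\<close>

lemma sum_div_mod:
  fixes f :: "nat \<Rightarrow> nat \<Rightarrow> 'a::comm_monoid_add"
  shows "(\<Sum>i<m * n. f (i div n) (i mod n)) = (\<Sum>a<m. \<Sum>b<n. f a b)"
proof -
  have "(\<Sum>a<m. \<Sum>b<n. f a b) = (\<Sum>x\<in>{..<m} \<times> {..<n}. f (fst x) (snd x))"
    by (simp add: sum.cartesian_product split_def)
  also have "\<dots> = (\<Sum>i<m * n. f (i div n) (i mod n))"
  proof (rule sum.reindex_bij_witness[of _ "\<lambda>i. (i div n, i mod n)" "\<lambda>x. fst x * n + snd x"])
    fix x assume x: "x \<in> {..<m} \<times> {..<n}"
    then have *: "fst x < m" "snd x < n" by auto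
    then have "fst x * n + snd x < fst x * n + n" by simp
    also have "fst x * n + n = Suc (fst x) * n" by simp
    also have "Suc (fst x) * n \<le> m * n" using * by (intro mult_right_mono) auto
    finally show "fst x * n + snd x \<in> {..<m * n}" by simp
    show "((fst x * n + snd x) div n, (fst x * n + snd x) mod n) = x" using * by (cases x) auto
    show "f ((fst x * n + snd x) div n) ((fst x * n + snd x) mod n) = f (fst x) (snd x)" using * by simp
  next
    fix i assume i: "i \<in> {..<m * n}"
    then have "0 < n" by (cases n) auto
    then show "(i div n, i mod n) \<in> {..<m} \<times> {..<n}" using i by (simp add: less_mult_imp_div_less)
    show "fst (i div n, i mod n) * n + snd (i div n, i mod n) = i" by simp
  qed
  finally show ?thesis by simp
qed

lemma divmod_less: "i < m * n \<Longrightarrow> i div n < (m::nat)" "i < m * n \<Longrightarrow> i mod n < n"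
  by (simp add: less_mult_imp_div_less) (cases n; simp)

lemma kron_carrier [simp]: "A \<in> carrier_mat m m \<Longrightarrow> B \<in> carrier_mat n n \<Longrightarrow> kron A B \<in> carrier_mat (m * n) (m * n)"
  by (simp add: kron_def)

lemma kron_index:
  assumes "A \<in> carrier_mat m m" "B \<in> carrier_mat n n" "i < m * n" "j < m * n"
  shows "kron A B $$ (i,j) = A $$ (i div n, j div n) * B $$ (i mod n, j mod n)"
  using assms by (simp add: kron_def)

lemma kron_mult:
  assumes "A \<in> carrier_mat m m" "B \<in> carrier_mat n n" "C \<in> carrier_mat m m" "E \<in> carrier_mat n n"
  shows "kron A B * kron C E = kron (A * C) (B * E)"
proof (rule eq_matI)
  have c: "A * C \<in> carrier_mat m m" "B * E \<in> carrier_mat n n" using assms by auto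
  fix i j assume "i < dim_row (kron (A * C) (B * E))" "j < dim_col (kron (A * C) (B * E))"
  then have ij: "i < m * n" "j < m * n" using kron_carrier[OF c] by auto
  have "(kron A B * kron C E) $$ (i,j) = (\<Sum>k<m * n. kron A B $$ (i,k) * kron C E $$ (k,j))"
    by (rule mult_index) (use assms ij in auto)
  also have "\<dots> = (\<Sum>k<m * n. A $$ (i div n, k div n) * B $$ (i mod n, k mod n) * (C $$ (k div n, j div n) * E $$ (k mod n, j mod n)))"
    by (intro sum.cong refl) (simp add: kron_index[OF assms(1,2)] kron_index[OF assms(3,4)] ij)
  also have "\<dots> = (\<Sum>a<m. \<Sum>b<n. A $$ (i div n, a) * B $$ (i mod n, b) * (C $$ (a, j div n) * E $$ (b, j mod n)))"
    by (rule sum_div_mod)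
  also have "\<dots> = (\<Sum>a<m. A $$ (i div n, a) * C $$ (a, j div n)) * (\<Sum>b<n. B $$ (i mod n, b) * E $$ (b, j mod n))"
    by (simp add: sum_product ac_simps)
  also have "\<dots> = (A * C) $$ (i div n, j div n) * (B * E) $$ (i mod n, j mod n)"
    using ij by (simp add: mult_index[OF assms(1,3)] mult_index[OF assms(2,4)] divmod_less del: index_mult_mat(1))
  finally show "(kron A B * kron C E) $$ (i,j) = kron (A * C) (B * E) $$ (i,j)"
    using kron_index[OF c ij] by simp
qed (use assms in \<open>simp_all add: kron_def\<close>)

lemma kron_adj:
  assumes "A \<in> carrier_mat m m" "B \<in> carrier_mat n n"
  shows "adj (kron A B) = kron (adj A) (adj B)"
proof (rule eq_matI)
  fix i j assume "i < dim_row (kron (adj A) (adj B))" "j < dim_col (kron (adj A) (adj B))"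
  then have ij: "i < m * n" "j < m * n" using assms by (auto simp: kron_def)
  have "adj (kron A B) $$ (i,j) = cnj (kron A B $$ (j,i))"
    using kron_carrier[OF assms] ij by simp
  then show "adj (kron A B) $$ (i,j) = kron (adj A) (adj B) $$ (i,j)"
    using assms ij by (simp add: kron_index[OF assms] kron_index[OF adj_carrier[OF assms(1)] adj_carrier[OF assms(2)]] divmod_less)
qed (use assms in \<open>simp_all add: kron_def\<close>)

lemma divmod_eq: "(i = j) = (i div n = j div n \<and> i mod n = j mod (n::nat))"
  by (metis div_mod_decomp)

lemma kron_rdiag: "kron (rdiag m p) (rdiag n q) = rdiag (m * n) (\<lambda>i. p (i div n) * q (i mod n))"
proof (rule eq_matI)
  fix i j assume "i < dim_row (rdiag (m * n) (\<lambda>i. p (i div n) * q (i mod n)))" "j < dim_col (rdiag (m * n) (\<lambda>i. p (i div n) * q (i mod n)))"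
  then have ij: "i < m * n" "j < m * n" by (auto simp: mat_diag_def)
  show "kron (rdiag m p) (rdiag n q) $$ (i,j) = rdiag (m * n) (\<lambda>i. p (i div n) * q (i mod n)) $$ (i,j)"
    unfolding kron_index[OF mat_diag_dim mat_diag_dim ij]
    using ij divmod_less[OF ij(1)] divmod_less[OF ij(2)] divmod_eq[of i j n]
    by (auto simp: mat_diag_def)
qed (simp_all add: kron_def mat_diag_def)

lemma kron_one: "kron (1\<^sub>m m) (1\<^sub>m n) = 1\<^sub>m (m * n)"
  using kron_rdiag[of m "\<lambda>_. 1" n "\<lambda>_. 1"] by simp

lemma kron_unitary: "unitary_mat m U \<Longrightarrow> unitary_mat n V \<Longrightarrow> unitary_mat (m * n) (kron U V)"
proof -
  assume a: "unitary_mat m U" "unitary_mat n V"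
  note c = unitary_carrier[OF a(1)] unitary_carrier[OF a(2)]
  have "kron U V * adj (kron U V) = 1\<^sub>m (m * n)"
    unfolding kron_adj[OF c] kron_mult[OF c adj_carrier[OF c(1)] adj_carrier[OF c(2)]]
    by (simp add: unitary_right[OF a(1)] unitary_right[OF a(2)] kron_one)
  then show ?thesis using kron_carrier[OF c] by (simp add: unitary_mat_def)
qed

lemma kron_spec:
  assumes "spec m U p A" "spec n V q B"
  shows "spec (m * n) (kron U V) (\<lambda>i. p (i div n) * q (i mod n)) (kron A B)"
proof -
  note U = specD[OF assms(1)] and V = specD[OF assms(2)]
  have "kron A B = kron U V * kron (rdiag m p) (rdiag n q) * adj (kron U V)"
    unfolding kron_adj[OF U(3) V(3)] kron_mult[OF U(3) V(3) mat_diag_dim mat_diag_dim]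
    using U(3,5) V(3,5)
    by (subst kron_mult[of _ m _ n]) (simp_all add: U(2)[symmetric] V(2)[symmetric])
  then show ?thesis using kron_unitary[OF U(1) V(1)] by (simp add: spec_def kron_rdiag)
qed

lemma kron_psd: "psd m A \<Longrightarrow> psd n B \<Longrightarrow> psd (m * n) (kron A B)"
proof -
  assume a: "psd m A" "psd n B"
  obtain U p where U: "spec m U p A" "\<And>i. i < m \<Longrightarrow> 0 \<le> p i" using psd_specE[OF a(1)] by blast
  obtain V q where V: "spec n V q B" "\<And>i. i < n \<Longrightarrow> 0 \<le> q i" using psd_specE[OF a(2)] by blast
  show ?thesis by (rule spec_psd[OF kron_spec[OF U(1) V(1)]]) (simp add: U(2) V(2) divmod_less)
qed

lemma mtrace_kron:
  assumes "A \<in> carrier_mat m m" "B \<in> carrier_mat n n"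
  shows "mtrace (kron A B) = mtrace A * mtrace B"
proof -
  have "mtrace (kron A B) = (\<Sum>i<m * n. A $$ (i div n, i div n) * B $$ (i mod n, i mod n))"
    using kron_carrier[OF assms] by (auto simp: mtrace_def kron_index[OF assms] intro!: sum.cong)
  also have "\<dots> = (\<Sum>a<m. \<Sum>b<n. A $$ (a, a) * B $$ (b, b))" by (rule sum_div_mod)
  finally show ?thesis using assms by (simp add: mtrace_def sum_product)
qed

lemma mprob_kron:
  assumes "psd m A" "psd n B" "U \<in> carrier_mat m m" "V \<in> carrier_mat n n" "k < m * n"
  shows "mprob (m * n) (kron U V) (kron A B) k = mprob m U A (k div n) * mprob n V B (k mod n)"
proof -
  note c = psdD(1)[OF assms(1)] psdD(1)[OF assms(2)]
  let ?X = "adj U * A * U" and ?Y = "adj V * B * V"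
  have X: "psd m ?X" and Y: "psd n ?Y" using psd_conj assms by auto
  \<comment> \<open>The real part of a product of two diagonal entries is the product of their real
    parts as soon as one of them is real.\<close>
  have im: "Im (?X $$ (a,a)) = 0" if "a < m" for a
  proof -
    have "adj ?X $$ (a,a) = cnj (?X $$ (a,a))" using psdD(1)[OF X] that by (intro adj_index) auto
    then show ?thesis unfolding psdD(2)[OF X] by (simp add: complex_eq_iff del: index_mult_mat(1))
  qed
  have "adj (kron U V) * kron A B * kron U V = kron ?X ?Y"
    unfolding kron_adj[OF assms(3,4)]
    using kron_mult[OF adj_carrier[OF assms(3)] adj_carrier[OF assms(4)] c] assms(3,4) c
    by (simp add: kron_mult[of _ m _ n])
  then have "mprob (m * n) (kron U V) (kron A B) k = Re (kron ?X ?Y $$ (k,k))"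
    using mprob_entry[OF kron_carrier[OF assms(3,4)] kron_carrier[OF c] assms(5)] by simp
  also have "\<dots> = Re (?X $$ (k div n, k div n)) * Re (?Y $$ (k mod n, k mod n))"
    using im[OF divmod_less(1)[OF assms(5)]]
    by (simp add: kron_index[OF psdD(1)[OF X] psdD(1)[OF Y] assms(5,5)] del: index_mult_mat(1))
  finally show ?thesis using mprob_entry[OF assms(3) c(1)] mprob_entry[OF assms(4) c(2)] divmod_less[OF assms(5)] by simp
qed

lemma vN_entropy_kron:
  assumes "psd m A" "psd n B" "mtrace A = 1" "mtrace B = 1"
  shows "vN_entropy (kron A B) = vN_entropy A + vN_entropy B"
proof -
  obtain U p where U: "spec m U p A" "\<And>i. i < m \<Longrightarrow> 0 \<le> p i" using psd_specE[OF assms(1)] by blast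
  obtain V q where V: "spec n V q B" "\<And>i. i < n \<Longrightarrow> 0 \<le> q i" using psd_specE[OF assms(2)] by blast
  have s: "(\<Sum>i<m. p i) = 1" "(\<Sum>i<n. q i) = 1"
    using spec_trace[OF U(1)] spec_trace[OF V(1)] assms by (metis of_real_eq_1_iff)+
  \<comment> \<open>If \<open>x\<close> or \<open>y\<close> is 0, both sides vanish whatever value
    \<open>log\<close> takes there.\<close>
  have lg: "x * y * log 2 (x * y) = (x * log 2 x) * y + x * (y * log 2 y)" if "0 \<le> x" "0 \<le> y" for x y :: real
    using that by (cases "x = 0 \<or> y = 0") (auto simp: log_mult algebra_simps)
  have "vN_entropy (kron A B) = - (\<Sum>i<m * n. p (i div n) * q (i mod n) * log 2 (p (i div n) * q (i mod n)))"
    by (rule vN_entropy_spec[OF kron_spec[OF U(1) V(1)]])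
  also have "(\<Sum>i<m * n. p (i div n) * q (i mod n) * log 2 (p (i div n) * q (i mod n)))
      = (\<Sum>a<m. \<Sum>b<n. p a * q b * log 2 (p a * q b))" by (rule sum_div_mod)
  also have "\<dots> = (\<Sum>a<m. \<Sum>b<n. (p a * log 2 (p a)) * q b) + (\<Sum>a<m. \<Sum>b<n. p a * (q b * log 2 (q b)))"
    unfolding sum.distrib[symmetric] using U(2) V(2) by (intro sum.cong refl lg) auto
  also have "\<dots> = (\<Sum>a<m. p a * log 2 (p a)) * (\<Sum>b<n. q b) + (\<Sum>a<m. p a) * (\<Sum>b<n. q b * log 2 (q b))"
    by (simp only: sum_product)
  finally show ?thesis using s by (simp add: vN_entropy_spec[OF U(1)] vN_entropy_spec[OF V(1)])
qed

lemma bhatt_kron: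
  assumes "psd m A" "psd m A'" "psd n B" "psd n B'" "U \<in> carrier_mat m m" "V \<in> carrier_mat n n"
  shows "bhatt (m * n) (kron U V) (kron A B) (kron A' B') = bhatt m U A A' * bhatt n V B B'"
proof -
  have "bhatt (m * n) (kron U V) (kron A B) (kron A' B') =
     (\<Sum>k<m * n. sqrt (mprob m U A (k div n) * mprob m U A' (k div n)) * sqrt (mprob n V B (k mod n) * mprob n V B' (k mod n)))"
    unfolding bhatt_def
    by (intro sum.cong refl) (simp add: mprob_kron assms ac_simps flip: real_sqrt_mult)
  also have "\<dots> = (\<Sum>a<m. \<Sum>b<n. sqrt (mprob m U A a * mprob m U A' a) * sqrt (mprob n V B b * mprob n V B' b))"
    by (rule sum_div_mod)
  finally show ?thesis by (simp add: bhatt_def sum_product)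
qed

text \<open>Lets a bound that is affine in one coefficient, with nonnegative slope, pass to the
  infimum. A bilinear bound over product bases is treated by two applications, one basis being kept
  fixed in the first.\<close>

lemma le_affine_min_bhatt:
  assumes "\<And>U. unitary_mat D U \<Longrightarrow> x \<le> c + k * bhatt D U A B" "0 \<le> k"
  shows "x \<le> c + k * min_bhatt D A B"
proof (cases "k = 0")
  case True
  then show ?thesis using assms(1)[of "1\<^sub>m D"] by simp
next
  case False
  then have "0 < k" using assms(2) by simp
  then have "(x - c) / k \<le> min_bhatt D A B"
    using assms(1) by (intro min_bhatt_greatest) (simp add: field_simps)
  then show ?thesis using \<open>0 < k\<close> by (simp add: field_simps)
qed

lemma min_bhatt_kron:
  assumes "psd m A" "psd m A'" "psd n B" "psd n B'"
  shows "min_bhatt (m * n) (kron A B) (kron A' B') \<le> min_bhatt m A A' * min_bhatt n B B'"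
proof -
  let ?x = "min_bhatt (m * n) (kron A B) (kron A' B')"
  have 1: "?x \<le> bhatt m U A A' * bhatt n V B B'" if "unitary_mat m U" "unitary_mat n V" for U V
    using min_bhatt_le[OF kron_psd[OF assms(1,3)] kron_psd[OF assms(2,4)] kron_unitary[OF that]]
      bhatt_kron[OF assms unitary_carrier[OF that(1)] unitary_carrier[OF that(2)]] by simp
  have 2: "?x \<le> 0 + bhatt m U A A' * min_bhatt n B B'" if "unitary_mat m U" for U
    using 1[OF that] bhatt_nonneg[OF assms(1,2)] by (intro le_affine_min_bhatt) auto
  have "?x \<le> 0 + min_bhatt n B B' * min_bhatt m A A'"
    using 2 min_bhatt_nonneg[OF assms(3,4)] by (intro le_affine_min_bhatt) (auto simp: mult.commute)
  then show ?thesis by (simp add: mult.commute)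
qed

text \<open>In terms of the square roots \<open>a\<close>, \<open>b\<close>, \<open>c\<close>,
  \<open>e\<close>, the square of the right-hand side exceeds that of the left-hand side by
  \<open>2 a b c e (a - b)^2 (c - e)^2\<close>.\<close>

lemma minus_pointwise:
  fixes \<alpha> \<beta> \<gamma> \<delta> :: real
  assumes "0 \<le> \<alpha>" "0 \<le> \<beta>" "0 \<le> \<gamma>" "0 \<le> \<delta>"
  shows "sqrt ((\<alpha> * \<gamma> + \<beta> * \<delta>) * (\<beta> * \<gamma> + \<alpha> * \<delta>))
    \<le> (\<gamma> + \<delta>) * sqrt (\<alpha> * \<beta>) + (\<alpha> + \<beta>) * sqrt (\<gamma> * \<delta>) - 2 * (sqrt (\<alpha> * \<beta>) * sqrt (\<gamma> * \<delta>))"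
proof -
  define a b c e where "a = sqrt \<alpha>" and "b = sqrt \<beta>" and "c = sqrt \<gamma>" and "e = sqrt \<delta>"
  then have s: "\<alpha> = a * a" "\<beta> = b * b" "\<gamma> = c * c" "\<delta> = e * e"
    and n: "0 \<le> a" "0 \<le> b" "0 \<le> c" "0 \<le> e"
    using assms by auto
  define R where "R = (c*c + e*e) * (a * b) + (a*a + b*b) * (c * e) - 2 * (a * b * (c * e))"
  have "R = (a * b) * (c - e)\<^sup>2 + (a*a + b*b) * (c * e)" by (simp add: R_def power2_eq_square algebra_simps)
  then have R0: "0 \<le> R" using n by simp
  have "R\<^sup>2 = (a*a*(c*c) + b*b*(e*e)) * (b*b*(c*c) + a*a*(e*e)) + 2 * (a * b * c * e) * ((a - b)\<^sup>2 * (c - e)\<^sup>2)"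
    unfolding R_def by (simp add: power2_eq_square algebra_simps)
  then have "(a*a*(c*c) + b*b*(e*e)) * (b*b*(c*c) + a*a*(e*e)) \<le> R\<^sup>2" using n by simp
  then have "sqrt ((a*a*(c*c) + b*b*(e*e)) * (b*b*(c*c) + a*a*(e*e))) \<le> R"
    using R0 by (rule real_le_lsqrt[rotated]) 
  moreover have "sqrt (a * a * (b * b)) = a * b" "sqrt (c * c * (e * e)) = c * e"
    using n by (simp_all add: real_sqrt_mult)
  ultimately show ?thesis unfolding s by (simp add: R_def)
qed

text \<open>In a product basis the minus transform acts on outcome distributions as in the classical
  case, and the sum of the pointwise inequality over all outcomes factorizes. Coefficients are at
  most 1, so \<open>x + y - x y\<close> has nonnegative slope in each variable and the two infima
  can be taken in turn.\<close>

lemma min_bhatt_minus: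
  assumes A: "psd m A0" "psd m A1" "mtrace A0 = 1" "mtrace A1 = 1"
    and B: "psd n B0" "psd n B1" "mtrace B0 = 1" "mtrace B1 = 1"
  shows "min_bhatt (m * n) ((1/2) \<cdot>\<^sub>m (kron A0 B0 + kron A1 B1)) ((1/2) \<cdot>\<^sub>m (kron A1 B0 + kron A0 B1))
    \<le> min_bhatt m A0 A1 + min_bhatt n B0 B1 - min_bhatt m A0 A1 * min_bhatt n B0 B1"
proof -
  let ?X = "(1/2) \<cdot>\<^sub>m (kron A0 B0 + kron A1 B1)" and ?Y = "(1/2) \<cdot>\<^sub>m (kron A1 B0 + kron A0 B1)"
  note k = kron_psd[OF A(1) B(1)] kron_psd[OF A(2) B(2)] kron_psd[OF A(2) B(1)] kron_psd[OF A(1) B(2)]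
  note ck = k[THEN psdD(1)]
  have psd: "psd (m * n) ?X" "psd (m * n) ?Y"
    using psd_smult[OF psd_add[OF k(1,2)], of "1/2"] psd_smult[OF psd_add[OF k(3,4)], of "1/2"] by auto
  have 1: "min_bhatt (m * n) ?X ?Y \<le> bhatt m U A0 A1 + bhatt n V B0 B1 - bhatt m U A0 A1 * bhatt n V B0 B1"
    if U: "unitary_mat m U" and V: "unitary_mat n V" for U V
  proof -
    note Uc = unitary_carrier[OF U] and Vc = unitary_carrier[OF V]
    define a0 a1 b0 b1 where "a0 = mprob m U A0" and "a1 = mprob m U A1" and "b0 = mprob n V B0" and "b1 = mprob n V B1"
    have nn: "0 \<le> a0 k" "0 \<le> a1 k" "0 \<le> b0 k" "0 \<le> b1 k" for k
      using mprob_nonneg A B by (auto simp: a0_def a1_def b0_def b1_def)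
    have sums: "(\<Sum>k<m. a0 k) = 1" "(\<Sum>k<m. a1 k) = 1" "(\<Sum>k<n. b0 k) = 1" "(\<Sum>k<n. b1 k) = 1"
      using mprob_sum[OF U psdD(1)[OF A(1)]] mprob_sum[OF U psdD(1)[OF A(2)]] mprob_sum[OF V psdD(1)[OF B(1)]]
        mprob_sum[OF V psdD(1)[OF B(2)]] A B by (auto simp: a0_def a1_def b0_def b1_def)
    define s t where "s k = sqrt (a0 k * a1 k)" and "t k = sqrt (b0 k * b1 k)" for k
    have dX: "mprob (m * n) (kron U V) ?X k = (a0 (k div n) * b0 (k mod n) + a1 (k div n) * b1 (k mod n)) / 2"
      and dY: "mprob (m * n) (kron U V) ?Y k = (a1 (k div n) * b0 (k mod n) + a0 (k div n) * b1 (k mod n)) / 2"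
      if "k < m * n" for k
      using mprob_smult[of _ "m * n" _ "1/2"] ck that
      by (simp_all add: mprob_add mprob_kron A B Uc Vc a0_def a1_def b0_def b1_def)
    have "min_bhatt (m * n) ?X ?Y \<le> bhatt (m * n) (kron U V) ?X ?Y"
      by (rule min_bhatt_le[OF psd kron_unitary[OF U V]])
    also have "\<dots> \<le> (\<Sum>k<m * n. ((b0 (k mod n) + b1 (k mod n)) * s (k div n)
        + (a0 (k div n) + a1 (k div n)) * t (k mod n) - 2 * (s (k div n) * t (k mod n))) / 2)"
      unfolding bhatt_def
    proof (intro sum_mono)
      fix k assume "k \<in> {..<m * n}"
      then have kk: "k < m * n" by simp
      let ?a = "k div n" and ?b = "k mod n"
      have half: "sqrt (x / 2 * (y / 2)) = sqrt (x * y) / 2" for x y :: real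
        by (simp add: real_sqrt_divide real_sqrt_mult)
      have "sqrt (mprob (m * n) (kron U V) ?X k * mprob (m * n) (kron U V) ?Y k) =
          sqrt ((a0 ?a * b0 ?b + a1 ?a * b1 ?b) * (a1 ?a * b0 ?b + a0 ?a * b1 ?b)) / 2"
        unfolding dX[OF kk] dY[OF kk] by (rule half)
      then show "sqrt (mprob (m * n) (kron U V) ?X k * mprob (m * n) (kron U V) ?Y k) \<le>
          ((b0 ?b + b1 ?b) * s ?a + (a0 ?a + a1 ?a) * t ?b - 2 * (s ?a * t ?b)) / 2"
        using minus_pointwise[OF nn(1)[of ?a] nn(2)[of ?a] nn(3)[of ?b] nn(4)[of ?b]]
        by (simp only: s_def t_def) (rule divide_right_mono, auto)
    qed
    also have "\<dots> = (\<Sum>a<m. \<Sum>b<n. ((b0 b + b1 b) * s a + (a0 a + a1 a) * t b - 2 * (s a * t b)) / 2)"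
      by (rule sum_div_mod)
    also have "\<dots> = ((\<Sum>a<m. s a) * (\<Sum>b<n. b0 b + b1 b) + (\<Sum>a<m. a0 a + a1 a) * (\<Sum>b<n. t b)
        - 2 * ((\<Sum>a<m. s a) * (\<Sum>b<n. t b))) / 2"
    proof -
      have "(\<Sum>a<m. \<Sum>b<n. ((b0 b + b1 b) * s a + (a0 a + a1 a) * t b - 2 * (s a * t b)) / 2) =
          ((\<Sum>a<m. \<Sum>b<n. s a * (b0 b + b1 b)) + (\<Sum>a<m. \<Sum>b<n. (a0 a + a1 a) * t b)
            - 2 * (\<Sum>a<m. \<Sum>b<n. s a * t b)) / 2"
        unfolding sum_distrib_left sum.distrib[symmetric] sum_subtractf[symmetric] sum_divide_distrib
        by (intro sum.cong refl) (simp add: ac_simps)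
      then show ?thesis by (simp only: sum_product)
    qed
    also have "\<dots> = (\<Sum>a<m. s a) + (\<Sum>b<n. t b) - (\<Sum>a<m. s a) * (\<Sum>b<n. t b)"
      by (simp add: sum.distrib sums)
    finally show ?thesis by (simp add: bhatt_def s_def t_def a0_def a1_def b0_def b1_def)
  qed
  have 2: "min_bhatt (m * n) ?X ?Y \<le> bhatt m U A0 A1 + (1 - bhatt m U A0 A1) * min_bhatt n B0 B1" if U: "unitary_mat m U" for U
    using 1[OF U] bhatt_le_1[OF A U] by (intro le_affine_min_bhatt) (auto simp: algebra_simps)
  have "min_bhatt (m * n) ?X ?Y \<le> min_bhatt n B0 B1 + (1 - min_bhatt n B0 B1) * min_bhatt m A0 A1"
    using 2 min_bhatt_le_1[OF B] by (intro le_affine_min_bhatt) (auto simp: algebra_simps)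
  then show ?thesis by (simp add: algebra_simps)
qed

section \<open>Channel combining and splitting\<close>

lemma finite_bits [simp]: "finite (bits k)"
  using finite_lists_length_eq[of "UNIV :: bool set" k] by (simp add: bits_def)

lemma card_bits [simp]: "card (bits k) = 2 ^ k"
  using card_lists_length_eq[of "UNIV :: bool set" k] by (simp add: bits_def)

lemma bits_0 [simp]: "bits 0 = {[]}"
  by (auto simp: bits_def)

lemma sum_bits_Cons: "(\<Sum>w\<in>bits (Suc k). f w) = (\<Sum>w\<in>bits k. f (False # w) + f (True # w))"
proof -
  have "bits (Suc k) = (#) False ` bits k \<union> (#) True ` bits k"
    by (auto simp: bits_def length_Suc_conv image_iff)
  then have "(\<Sum>w\<in>bits (Suc k). f w) = (\<Sum>w\<in>(#) False ` bits k. f w) + (\<Sum>w\<in>(#) True ` bits k. f w)"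
    by (simp only:) (rule sum.union_disjoint, auto)
  then show ?thesis by (simp add: sum.reindex sum.distrib)
qed

lemma sum_bits_snoc: "(\<Sum>w\<in>bits (Suc k). f w) = (\<Sum>w\<in>bits k. f (w @ [False]) + f (w @ [True]))"
proof -
  have "(\<Sum>w\<in>bits m. f (rev w)) = (\<Sum>w\<in>bits m. f w)" for m and f :: "bool list \<Rightarrow> 'a"
    by (rule sum.reindex_bij_witness[of _ rev rev]) (auto simp: bits_def)
  note r = this
  have "(\<Sum>w\<in>bits (Suc k). f w) = (\<Sum>w\<in>bits (Suc k). f (rev w))" by (simp add: r)
  also have "\<dots> = (\<Sum>w\<in>bits k. f (rev w @ [False]) + f (rev w @ [True]))" by (simp add: sum_bits_Cons)
  also have "\<dots> = (\<Sum>w\<in>bits k. f (w @ [False]) + f (w @ [True]))"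
    by (rule r[of "\<lambda>w. f (w @ [False]) + f (w @ [True])"])
  finally show ?thesis .
qed

section \<open>The two halves of an input word under the combining step\<close>

definition oddxor :: "bool list \<Rightarrow> bool list" where
  "oddxor u = map (\<lambda>k. u ! (2*k) \<noteq> u ! (2*k+1)) [0..<length u div 2]"

text \<open>The word \<open>u_e\<close> of the one-based convention, which therefore reads the
  zero-based odd positions.\<close>

definition evens :: "bool list \<Rightarrow> bool list" where
  "evens u = map (\<lambda>k. u ! (2*k+1)) [0..<length u div 2]"

lemma length_oddxor [simp]: "length (oddxor u) = length u div 2"
  and length_evens [simp]: "length (evens u) = length u div 2"
  by (simp_all add: oddxor_def evens_def)

text \<open>A prefix of even length ends on a pair boundary, so no pair straddles \<open>v\<close>
  and \<open>w\<close>.\<close>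

lemma
  assumes "even (length v)"
  shows oddxor_append: "oddxor (v @ w) = oddxor v @ oddxor w"
    and evens_append: "evens (v @ w) = evens v @ evens w"
proof -
  obtain m where m: "length v = 2 * m" using assms by (auto elim: evenE)
  have 0: "(v @ w) ! (2 * k) = (if k < m then v ! (2 * k) else w ! (2 * (k - m)))" for k
    by (simp add: nth_append m diff_mult_distrib2)
  have 1: "(v @ w) ! (2 * k + 1) = (if k < m then v ! (2 * k + 1) else w ! (2 * (k - m) + 1))" for k
    by (auto simp: nth_append m diff_mult_distrib2 Suc_diff_le less_diff_conv2)
  show "oddxor (v @ w) = oddxor v @ oddxor w"
    by (rule nth_equalityI) (simp_all add: oddxor_def 0 1[simplified] nth_append m diff_mult_distrib2 Suc_diff_le less_diff_conv2)
  show "evens (v @ w) = evens v @ evens w"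
    by (rule nth_equalityI) (simp_all add: evens_def 1[simplified] nth_append m diff_mult_distrib2 Suc_diff_le less_diff_conv2)
qed

lemma sum_bits_double:
  fixes g :: "bool list \<Rightarrow> bool list \<Rightarrow> 'a::comm_monoid_add"
  shows "(\<Sum>w\<in>bits (2 * m). g (oddxor w) (evens w)) = (\<Sum>a\<in>bits m. \<Sum>b\<in>bits m. g a b)"
proof -
  \<comment> \<open>The inverse of the map to \<open>oddxor\<close> and \<open>evens\<close>: the
    first bit of each pair is recovered as the xor of the two given bits.\<close>
  define h where "h x = map (\<lambda>i. if even i then (fst x ! (i div 2)) \<noteq> (snd x ! (i div 2)) else snd x ! (i div 2)) [0..<2 * m]"
    for x :: "bool list \<times> bool list"
  have "(\<Sum>w\<in>bits (2 * m). g (oddxor w) (evens w)) = (\<Sum>x\<in>bits m \<times> bits m. g (fst x) (snd x))"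
  proof (rule sum.reindex_bij_witness[of _ h "\<lambda>w. (oddxor w, evens w)"])
    fix w :: "bool list" assume w: "w \<in> bits (2 * m)"
    then show "h (oddxor w, evens w) = w"
      by (auto intro!: nth_equalityI simp: bits_def h_def oddxor_def evens_def less_mult_imp_div_less elim!: evenE oddE)
    show "(oddxor w, evens w) \<in> bits m \<times> bits m" using w by (auto simp: bits_def)
    show "g (fst (oddxor w, evens w)) (snd (oddxor w, evens w)) = g (oddxor w) (evens w)" by simp
  next
    fix x :: "bool list \<times> bool list" assume x: "x \<in> bits m \<times> bits m"
    then show "h x \<in> bits (2 * m)" by (auto simp: bits_def h_def)
    show "(oddxor (h x), evens (h x)) = x"
      using x by (cases x) (auto intro!: nth_equalityI simp: bits_def h_def oddxor_def evens_def)
  qed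
  then show ?thesis by (simp add: sum.cartesian_product split_def)
qed

section \<open>Uniform averages over bit words\<close>

definition avg_bits :: "nat \<Rightarrow> (bool list \<Rightarrow> real) \<Rightarrow> real" where
  "avg_bits k f = (\<Sum>v\<in>bits k. f v) / 2 ^ k"

text \<open>Under the uniform distribution on words of length \<open>2 * k\<close> the two
  transformed halves are independent and uniform.\<close>

lemma avg_bits_double: "avg_bits (2 * k) (\<lambda>v. g (oddxor v) (evens v)) = avg_bits k (\<lambda>a. avg_bits k (g a))"
  unfolding avg_bits_def sum_bits_double by (simp add: power_add mult_2 flip: sum_divide_distrib)

lemma avg_bits_snoc: "avg_bits (Suc k) f = avg_bits k (\<lambda>v. (f (v @ [False]) + f (v @ [True])) / 2)"
  by (simp add: avg_bits_def sum_bits_snoc flip: sum_divide_distrib)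

lemma avg_bits_mono: "(\<And>v. v \<in> bits k \<Longrightarrow> f v \<le> g v) \<Longrightarrow> avg_bits k f \<le> avg_bits k g"
  by (auto simp: avg_bits_def intro!: divide_right_mono sum_mono)

lemma avg_bits_cong: "(\<And>v. v \<in> bits k \<Longrightarrow> f v = g v) \<Longrightarrow> avg_bits k f = avg_bits k g"
  by (simp add: avg_bits_def)

lemma avg_bits_const [simp]: "avg_bits k (\<lambda>_. c) = c"
  by (simp add: avg_bits_def)

lemma avg_bits_add: "avg_bits k (\<lambda>v. f v + g v) = avg_bits k f + avg_bits k g"
  by (simp add: avg_bits_def sum.distrib add_divide_distrib)

lemma avg_bits_diff: "avg_bits k (\<lambda>v. f v - g v) = avg_bits k f - avg_bits k g"
  by (simp add: avg_bits_def sum_subtractf diff_divide_distrib)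

lemma avg_bits_cmult: "avg_bits k (\<lambda>v. c * f v) = c * avg_bits k f"
  by (simp add: avg_bits_def sum_distrib_left)

lemma avg_bits_cmult_right: "avg_bits k (\<lambda>v. f v * c) = avg_bits k f * c"
  by (simp add: avg_bits_def sum_distrib_right)

lemma avg_bits_nonneg: "(\<And>v. v \<in> bits k \<Longrightarrow> 0 \<le> f v) \<Longrightarrow> 0 \<le> avg_bits k f"
  by (auto simp: avg_bits_def intro!: divide_nonneg_nonneg sum_nonneg)

section \<open>Output states averaged over the bits not yet decided\<close>

locale cq_channel =
  fixes \<rho> :: "bool \<Rightarrow> complex mat" and d :: nat
  assumes dens: "density_op d (\<rho> x)"
begin

abbreviation dm :: "nat \<Rightarrow> nat" where "dm n \<equiv> d ^ (2 ^ n)"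
abbreviation rb :: "nat \<Rightarrow> bool list \<Rightarrow> complex mat" where "rb \<equiv> rhobar \<rho> d"

lemma dm_Suc: "dm (Suc n) = dm n * dm n"
  by (simp add: power_add mult_2)

lemma comb_Suc:
  assumes "length u = 2 ^ Suc n"
  shows "comb \<rho> (Suc n) u = kron (comb \<rho> n (oddxor u)) (comb \<rho> n (evens u))"
  using assms by (simp add: oddxor_def evens_def)

lemma comb_state: "psd (dm n) (comb \<rho> n u) \<and> mtrace (comb \<rho> n u) = 1"
proof (induction n arbitrary: u)
  case 0
  then show ?case using density_op_psd[OF dens] by simp
next
  case (Suc n)
  have "mtrace (comb \<rho> (Suc n) u) = 1" unfolding comb.simps
    by (subst mtrace_kron[of _ "dm n" _ "dm n"]) (use Suc psdD(1) in auto)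
  moreover have "psd (dm (Suc n)) (comb \<rho> (Suc n) u)" unfolding comb.simps dm_Suc
    using Suc by (intro kron_psd) auto
  ultimately show ?case by simp
qed

lemma comb_carrier [simp]: "comb \<rho> n u \<in> carrier_mat (dm n) (dm n)"
  using comb_state psdD(1) by blast

lemma rb_carrier [simp]: "rb n v \<in> carrier_mat (dm n) (dm n)"
  by (simp add: rhobar_def msum_def)

lemma rb_index:
  assumes "length v + k = 2 ^ n" "i < dm n" "j < dm n"
  shows "rb n v $$ (i,j) = (\<Sum>w\<in>bits k. comb \<rho> n (v @ w) $$ (i,j)) / 2 ^ k"
proof -
  have k: "2 ^ n - length v = k" using assms by simp
  show ?thesis using assms(2,3) carrier_matD[OF comb_carrier]
    by (simp add: rhobar_def msum_def k sum_divide_distrib)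
qed

lemma rb_state: "length v \<le> 2 ^ n \<Longrightarrow> psd (dm n) (rb n v)" "length v \<le> 2 ^ n \<Longrightarrow> mtrace (rb n v) = 1"
proof -
  show "psd (dm n) (rb n v)"
    unfolding rhobar_def by (intro psd_msum psd_smult) (use comb_state in auto)
  show "mtrace (rb n v) = 1"
    unfolding rhobar_def
    by (subst mtrace_msum) (use comb_state in \<open>auto simp: mtrace_smult[of _ "dm n"]\<close>)
qed

lemma rb_full: "length v = 2 ^ n \<Longrightarrow> rb n v = comb \<rho> n v"
proof (rule eq_matI)
  assume v: "length v = 2 ^ n"
  fix i j assume "i < dim_row (comb \<rho> n v)" "j < dim_col (comb \<rho> n v)"
  then have ij: "i < dm n" "j < dm n" using carrier_matD[OF comb_carrier] by auto
  show "rb n v $$ (i,j) = comb \<rho> n v $$ (i,j)"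
    using rb_index[of v 0 n, OF _ ij] v by simp
qed (use carrier_matD[OF comb_carrier] carrier_matD[OF rb_carrier] in simp_all)

lemma rb_split:
  assumes "length v < 2 ^ n"
  shows "rb n v = (1/2) \<cdot>\<^sub>m (rb n (v @ [False]) + rb n (v @ [True]))"
proof (rule eq_matI)
  obtain k where k: "length v + Suc k = 2 ^ n" using assms less_iff_Suc_add by auto
  fix i j assume "i < dim_row ((1/2) \<cdot>\<^sub>m (rb n (v @ [False]) + rb n (v @ [True])))"
    "j < dim_col ((1/2) \<cdot>\<^sub>m (rb n (v @ [False]) + rb n (v @ [True])))"
  then have ij: "i < dm n" "j < dm n" using carrier_matD[OF rb_carrier] by auto
  have "rb n v $$ (i,j) = (\<Sum>w\<in>bits (Suc k). comb \<rho> n (v @ w) $$ (i,j)) / 2 ^ Suc k"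
    by (rule rb_index[OF k ij])
  also have "\<dots> = ((\<Sum>w\<in>bits k. comb \<rho> n ((v @ [False]) @ w) $$ (i,j)) / 2 ^ k
       + (\<Sum>w\<in>bits k. comb \<rho> n ((v @ [True]) @ w) $$ (i,j)) / 2 ^ k) / 2"
    by (simp add: sum_bits_Cons sum.distrib add_divide_distrib mult.commute[of 2])
  also have "\<dots> = (rb n (v @ [False]) $$ (i,j) + rb n (v @ [True]) $$ (i,j)) / 2"
    using k by (subst (1 2) rb_index[OF _ ij, of _ k]) auto
  finally show "rb n v $$ (i,j) = ((1/2) \<cdot>\<^sub>m (rb n (v @ [False]) + rb n (v @ [True]))) $$ (i,j)"
    using ij carrier_matD[OF rb_carrier] by simp
qed (use carrier_matD[OF rb_carrier] in auto)

text \<open>After a prefix of even length the suffix consists of whole pairs, and its two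
  transformed halves range independently over all words; the average of the products is therefore
  the product of the averages.\<close>

lemma rb_kron:
  assumes "length v = 2 * k" "k \<le> 2 ^ n"
  shows "rb (Suc n) v = kron (rb n (oddxor v)) (rb n (evens v))"
proof (rule eq_matI)
  obtain m where m: "k + m = 2 ^ n" using le_Suc_ex[OF assms(2)] by auto
  let ?R = "kron (rb n (oddxor v)) (rb n (evens v))"
  have R: "?R \<in> carrier_mat (dm n * dm n) (dm n * dm n)" by simp
  fix i j assume "i < dim_row ?R" "j < dim_col ?R"
  then have ij: "i < dm n * dm n" "j < dm n * dm n" using R by auto
  then have ij': "i < dm (Suc n)" "j < dm (Suc n)" by (simp_all only: dm_Suc)
  have ev: "even (length v)" using assms by simp
  have "rb (Suc n) v $$ (i,j) = (\<Sum>w\<in>bits (2 * m). comb \<rho> (Suc n) (v @ w) $$ (i,j)) / 2 ^ (2 * m)"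
    by (rule rb_index[OF _ ij']) (use assms m in auto)
  also have "(\<Sum>w\<in>bits (2 * m). comb \<rho> (Suc n) (v @ w) $$ (i,j)) =
      (\<Sum>w\<in>bits (2 * m). comb \<rho> n (oddxor v @ oddxor w) $$ (i div dm n, j div dm n)
         * comb \<rho> n (evens v @ evens w) $$ (i mod dm n, j mod dm n))"
  proof (intro sum.cong refl)
    fix w :: "bool list" assume "w \<in> bits (2 * m)"
    then have "length (v @ w) = 2 ^ Suc n" using m assms by (simp add: bits_def)
    from comb_Suc[OF this] show "comb \<rho> (Suc n) (v @ w) $$ (i,j) = comb \<rho> n (oddxor v @ oddxor w) $$ (i div dm n, j div dm n)
         * comb \<rho> n (evens v @ evens w) $$ (i mod dm n, j mod dm n)"
      by (simp only: oddxor_append[OF ev] evens_append[OF ev] kron_index[OF comb_carrier comb_carrier ij])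
  qed
  also have "\<dots> = (\<Sum>a\<in>bits m. \<Sum>b\<in>bits m. comb \<rho> n (oddxor v @ a) $$ (i div dm n, j div dm n)
         * comb \<rho> n (evens v @ b) $$ (i mod dm n, j mod dm n))"
    by (rule sum_bits_double)
  also have "\<dots> / 2 ^ (2 * m) = ((\<Sum>a\<in>bits m. comb \<rho> n (oddxor v @ a) $$ (i div dm n, j div dm n)) / 2 ^ m)
      * ((\<Sum>b\<in>bits m. comb \<rho> n (evens v @ b) $$ (i mod dm n, j mod dm n)) / 2 ^ m)"
    by (simp add: sum_product power_add mult_2)
  also have "\<dots> = rb n (oddxor v) $$ (i div dm n, j div dm n) * rb n (evens v) $$ (i mod dm n, j mod dm n)"
    using m assms divmod_less[OF ij(1)] divmod_less[OF ij(2)]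
    by (subst (1 2) rb_index[of _ m]) auto
  also have "\<dots> = ?R $$ (i,j)" by (rule kron_index[OF rb_carrier rb_carrier ij, symmetric])
  finally show "rb (Suc n) v $$ (i,j) = ?R $$ (i,j)" .
qed (use carrier_matD[OF rb_carrier[of "Suc n" v], unfolded dm_Suc]
    carrier_matD[OF kron_carrier[OF rb_carrier[of n "oddxor v"] rb_carrier[of n "evens v"]]] in auto)

text \<open>Zero-based: \<open>split_bhatt n i\<close> belongs to the split channel with number
  \<open>i + 1\<close>, whose output reveals a prefix of \<open>i\<close> bits. Averaging the
  optimized coefficient over prefixes means that the measurement basis may depend on the revealed
  bits.\<close>

definition split_bhatt :: "nat \<Rightarrow> nat \<Rightarrow> real" where
  "split_bhatt n i = avg_bits i (\<lambda>v. min_bhatt (dm n) (rb n (v @ [False])) (rb n (v @ [True])))"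

definition split_holevo :: "nat \<Rightarrow> nat \<Rightarrow> real" where
  "split_holevo n i = avg_bits i (\<lambda>v. holevo (rb n (v @ [False])) (rb n (v @ [True])))"

lemma split_bhatt_range: "i < 2 ^ n \<Longrightarrow> 0 \<le> split_bhatt n i" "i < 2 ^ n \<Longrightarrow> split_bhatt n i \<le> 1"
proof -
  assume i: "i < 2 ^ n"
  have 1: "avg_bits i (\<lambda>_. 0) \<le> split_bhatt n i" unfolding split_bhatt_def
    by (intro avg_bits_mono min_bhatt_nonneg rb_state) (use i in \<open>auto simp: bits_def\<close>)
  have 2: "split_bhatt n i \<le> avg_bits i (\<lambda>_. 1)" unfolding split_bhatt_def
    by (intro avg_bits_mono min_bhatt_le_1 rb_state) (use i in \<open>auto simp: bits_def\<close>)
  from 1 2 show "0 \<le> split_bhatt n i" "split_bhatt n i \<le> 1" by simp_all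
qed

lemma rb_pair:
  assumes "v \<in> bits (2 * k)" "k < 2 ^ n"
  shows "rb (Suc n) (v @ [x, y]) = kron (rb n (oddxor v @ [x \<noteq> y])) (rb n (evens v @ [y]))"
proof -
  have "even (length v)" using assms by (auto simp: bits_def)
  note a = oddxor_append[OF this] evens_append[OF this]
  have "oddxor [x, y] = [x \<noteq> y]" "evens [x, y] = [y]" by (simp_all add: oddxor_def evens_def)
  then show ?thesis
    using rb_kron[of "v @ [x, y]" "Suc k" n] assms by (simp add: bits_def a)
qed

text \<open>The first bit of the pair is known here, so both hypotheses on the second are product
  states and their coefficients multiply. Independence of the two halves of the prefix turns the
  mean of the product into the product of the means.\<close>

lemma split_bhatt_plus:
  assumes "k < 2 ^ n"
  shows "split_bhatt (Suc n) (Suc (2 * k)) \<le> (split_bhatt n k)\<^sup>2"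
proof -
  define z where "z v = min_bhatt (dm n) (rb n (v @ [False])) (rb n (v @ [True]))" for v
  have Z: "split_bhatt n k = avg_bits k z" by (simp add: split_bhatt_def z_def[abs_def])
  have st: "psd (dm n) (rb n (v @ [x]))" if "v \<in> bits k" for v x
    by (rule rb_state) (use assms that in \<open>auto simp: bits_def\<close>)
  have "split_bhatt (Suc n) (Suc (2 * k)) \<le> avg_bits (2 * k) (\<lambda>v. z (oddxor v) * z (evens v))"
    unfolding split_bhatt_def avg_bits_snoc
  proof (rule avg_bits_mono)
    fix v assume v: "v \<in> bits (2 * k)"
    then have o: "oddxor v \<in> bits k" and e: "evens v \<in> bits k" by (auto simp: bits_def)
    \<comment> \<open>For \<open>x = True\<close> the two hypotheses on the first factor appear in
      swapped order, which the symmetry of \<open>min_bhatt\<close> repairs.\<close>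
    have "min_bhatt (dm (Suc n)) (rb (Suc n) (v @ [x, False])) (rb (Suc n) (v @ [x, True])) \<le> z (oddxor v) * z (evens v)" for x
      unfolding rb_pair[OF v assms] dm_Suc z_def
      using min_bhatt_kron[OF st[OF o, of x] st[OF o, of "\<not> x"] st[OF e, of False] st[OF e, of True]]
      by (cases x) (simp_all add: min_bhatt_sym[of _ "rb n (oddxor v @ [True])"])
    from this[of False] this[of True]
    show "(min_bhatt (dm (Suc n)) (rb (Suc n) ((v @ [False]) @ [False])) (rb (Suc n) ((v @ [False]) @ [True])) +
       min_bhatt (dm (Suc n)) (rb (Suc n) ((v @ [True]) @ [False])) (rb (Suc n) ((v @ [True]) @ [True]))) / 2
       \<le> z (oddxor v) * z (evens v)"
      by (simp del: power_Suc)
  qed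
  also have "\<dots> = avg_bits k (\<lambda>a. avg_bits k (\<lambda>b. z a * z b))" by (rule avg_bits_double)
  also have "\<dots> = (split_bhatt n k)\<^sup>2"
    unfolding avg_bits_cmult avg_bits_cmult_right Z by (simp add: power2_eq_square)
  finally show ?thesis .
qed

text \<open>The second bit of the pair is still unknown, so each hypothesis is an even mixture of
  two product states, as treated in \<open>min_bhatt_minus\<close>. The resulting bilinear bound
  averages by independence.\<close>

lemma split_bhatt_minus:
  assumes "k < 2 ^ n"
  shows "split_bhatt (Suc n) (2 * k) \<le> 2 * split_bhatt n k - (split_bhatt n k)\<^sup>2"
proof -
  define z where "z v = min_bhatt (dm n) (rb n (v @ [False])) (rb n (v @ [True]))" for v
  have Z: "split_bhatt n k = avg_bits k z" by (simp add: split_bhatt_def z_def[abs_def])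
  have "split_bhatt (Suc n) (2 * k) \<le> avg_bits (2 * k) (\<lambda>v. z (oddxor v) + z (evens v) - z (oddxor v) * z (evens v))"
    unfolding split_bhatt_def
  proof (rule avg_bits_mono)
    fix v assume v: "v \<in> bits (2 * k)"
    then have o: "oddxor v \<in> bits k" and e: "evens v \<in> bits k" by (auto simp: bits_def)
    have st: "psd (dm n) (rb n (w @ [x]))" "mtrace (rb n (w @ [x])) = 1" if "w \<in> bits k" for w x
      using rb_state[of "w @ [x]" n] assms that by (auto simp: bits_def)
    have len: "length (v @ [x]) < 2 ^ Suc n" for x using v assms by (simp add: bits_def)
    have "rb (Suc n) (v @ [x]) = (1/2) \<cdot>\<^sub>m (kron (rb n (oddxor v @ [x])) (rb n (evens v @ [False]))
        + kron (rb n (oddxor v @ [\<not> x])) (rb n (evens v @ [True])))" for x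
      using rb_split[OF len, of x] rb_pair[OF v assms, of x False] rb_pair[OF v assms, of x True] by simp
    then show "min_bhatt (dm (Suc n)) (rb (Suc n) (v @ [False])) (rb (Suc n) (v @ [True]))
        \<le> z (oddxor v) + z (evens v) - z (oddxor v) * z (evens v)"
      unfolding z_def dm_Suc using min_bhatt_minus[OF st(1)[OF o, of False] st(1)[OF o, of True] st(2)[OF o, of False] st(2)[OF o, of True]
        st(1)[OF e, of False] st(1)[OF e, of True] st(2)[OF e, of False] st(2)[OF e, of True]] by simp
  qed
  also have "\<dots> = avg_bits k (\<lambda>a. avg_bits k (\<lambda>b. z a + z b - z a * z b))" by (rule avg_bits_double)
  also have "\<dots> = 2 * split_bhatt n k - (split_bhatt n k)\<^sup>2"
    unfolding avg_bits_diff avg_bits_add avg_bits_cmult avg_bits_cmult_right avg_bits_const Z by (simp add: power2_eq_square)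
  finally show ?thesis .
qed

text \<open>The entropy of the output conditional on the first \<open>k\<close> input bits.
  Successive differences are the Holevo informations of the split channels, so that their sum
  telescopes.\<close>

definition prefix_entropy :: "nat \<Rightarrow> nat \<Rightarrow> real" where
  "prefix_entropy n k = avg_bits k (\<lambda>v. vN_entropy (rb n v))"

lemma split_holevo_prefix_entropy: "i < 2 ^ n \<Longrightarrow> split_holevo n i = prefix_entropy n i - prefix_entropy n (Suc i)"
  unfolding split_holevo_def prefix_entropy_def avg_bits_snoc avg_bits_diff[symmetric]
  by (intro avg_bits_cong) (simp add: holevo_def rb_split bits_def add_divide_distrib)

text \<open>Given \<open>2 * k\<close> bits, the output state is a tensor product governed by two
  independent prefixes of length \<open>k\<close>, and entropy is additive on tensor
  products.\<close>

lemma prefix_entropy_double: "k \<le> 2 ^ n \<Longrightarrow> prefix_entropy (Suc n) (2 * k) = 2 * prefix_entropy n k"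
proof -
  assume k: "k \<le> 2 ^ n"
  have "prefix_entropy (Suc n) (2 * k) = avg_bits (2 * k) (\<lambda>v. vN_entropy (rb n (oddxor v)) + vN_entropy (rb n (evens v)))"
    unfolding prefix_entropy_def
  proof (rule avg_bits_cong)
    fix v assume v: "v \<in> bits (2 * k)"
    then have l: "length (oddxor v) \<le> 2 ^ n" "length (evens v) \<le> 2 ^ n" using k by (auto simp: bits_def)
    show "vN_entropy (rb (Suc n) v) = vN_entropy (rb n (oddxor v)) + vN_entropy (rb n (evens v))"
      using rb_kron[of v k n] v k vN_entropy_kron[OF rb_state(1)[OF l(1)] rb_state(1)[OF l(2)] rb_state(2)[OF l(1)] rb_state(2)[OF l(2)]]
      by (simp add: bits_def)
  qed
  also have "\<dots> = avg_bits k (\<lambda>a. avg_bits k (\<lambda>b. vN_entropy (rb n a) + vN_entropy (rb n b)))"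
    by (rule avg_bits_double)
  finally show ?thesis by (simp add: avg_bits_add prefix_entropy_def)
qed

text \<open>After telescoping only the entropies with no bit and with all bits known remain, and
  both double from one level to the next.\<close>

lemma sum_split_holevo: "(\<Sum>i<2 ^ n. split_holevo n i) = 2 ^ n * symm_info \<rho>"
proof -
  have 1: "prefix_entropy n 0 = 2 ^ n * prefix_entropy 0 0" for n
    using prefix_entropy_double[of 0] by (induction n) auto
  have 2: "prefix_entropy n (2 ^ n) = 2 ^ n * prefix_entropy 0 1" for n
    by (induction n) (simp_all add: prefix_entropy_double)
  have "(\<Sum>i<2 ^ n. split_holevo n i) = (\<Sum>i<2 ^ n. prefix_entropy n i - prefix_entropy n (Suc i))"
    by (intro sum.cong refl split_holevo_prefix_entropy) auto
  also have "\<dots> = prefix_entropy n 0 - prefix_entropy n (2 ^ n)" by (rule sum_lessThan_telescope')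
  also have "\<dots> = 2 ^ n * split_holevo 0 0" unfolding 1[of n] 2[of n] using split_holevo_prefix_entropy[of 0 0] by (simp add: right_diff_distrib)
  also have "split_holevo 0 0 = symm_info \<rho>"
    using rb_full[of "[False]" 0] rb_full[of "[True]" 0]
    by (simp add: split_holevo_def avg_bits_def holevo_def symm_info_def)
  finally show ?thesis .
qed

lemma split_holevo_le_1: "i < 2 ^ n \<Longrightarrow> split_holevo n i \<le> 1"
proof -
  assume i: "i < 2 ^ n"
  have "split_holevo n i \<le> avg_bits i (\<lambda>_. 1)" unfolding split_holevo_def
    by (intro avg_bits_mono holevo_bounds(1)[where D = "dm n"] rb_state) (use i in \<open>auto simp: bits_def\<close>)
  then show ?thesis by simp
qed

lemma split_holevo_affine_bound:
  assumes "0 < \<delta>"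
  shows "\<exists>K\<ge>0. \<forall>n. \<forall>i<2 ^ n. split_holevo n i \<le> \<delta> + K * (1 - split_bhatt n i)"
proof -
  obtain K where K: "0 \<le> K" "\<And>D A B. psd D A \<Longrightarrow> psd D B \<Longrightarrow> mtrace A = 1 \<Longrightarrow> mtrace B = 1 \<Longrightarrow>
    holevo A B \<le> \<delta> + K * (1 - min_bhatt D A B)"
    using holevo_affine_bound[OF assms] by blast
  have "split_holevo n i \<le> \<delta> + K * (1 - split_bhatt n i)" if i: "i < 2 ^ n" for n i
  proof -
    have "split_holevo n i \<le> avg_bits i (\<lambda>v. \<delta> + K * (1 - min_bhatt (dm n) (rb n (v @ [False])) (rb n (v @ [True]))))"
      unfolding split_holevo_def by (intro avg_bits_mono K(2) rb_state) (use i in \<open>auto simp: bits_def\<close>)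
    then show ?thesis by (simp add: avg_bits_add avg_bits_cmult avg_bits_diff split_bhatt_def)
  qed
  then show ?thesis using K(1) by blast
qed

end

section \<open>Fidelity of the split channels\<close>

lemma smult_smult_times: "a \<cdot>\<^sub>m (b \<cdot>\<^sub>m A) = (a * b) \<cdot>\<^sub>m (A :: complex mat)"
  by (rule eq_matI) auto

lemma spec_smult: "spec D U q A \<Longrightarrow> spec D U (\<lambda>i. c * q i) (of_real c \<cdot>\<^sub>m A)"
proof -
  assume a: "spec D U q A"
  note U = specD[OF a]
  have r: "of_real c \<cdot>\<^sub>m rdiag D q = rdiag D (\<lambda>i. c * q i)"
    by (rule eq_matI) (auto simp: mat_diag_def)
  have "of_real c \<cdot>\<^sub>m (U * rdiag D q * adj U) = U * (of_real c \<cdot>\<^sub>m rdiag D q) * adj U"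
    using U(3,5) by (simp add: mult_smult_assoc_mat[of _ D D _ D] mult_smult_distrib[of _ D D _ D])
  then show ?thesis using U(1,2) by (simp add: spec_def r)
qed

lemma msqrt_smult:
  assumes "psd D A" "0 \<le> c"
  shows "msqrt (of_real c \<cdot>\<^sub>m A) = of_real (sqrt c) \<cdot>\<^sub>m msqrt A"
proof -
  obtain U q where U: "spec D U q A" using psd_specE[OF assms(1)] by blast
  show ?thesis
    by (rule spec_eqI[OF spec_msqrt[OF spec_smult[OF U]] spec_smult[OF spec_msqrt[OF U]]])
       (simp add: real_sqrt_mult)
qed

lemma spec_one_minus:
  assumes "spec D V q A"
  shows "spec D V (\<lambda>j. 1 - q j) (1\<^sub>m D - A)"
proof -
  note V = specD[OF assms]
  have r: "rdiag D (\<lambda>j. 1 - q j) = 1\<^sub>m D - rdiag D q" by (rule eq_matI) (auto simp: mat_diag_def)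
  have "V * (1\<^sub>m D - rdiag D q) * adj V = 1\<^sub>m D - A"
    using V(3,5) by (simp add: mult_minus_distrib_mat[of _ D D _ D] minus_mult_distrib_mat[of _ D D _ _ D]
      unitary_right[OF V(1)] V(2)[symmetric])
  then show ?thesis unfolding spec_def r using V(1) by simp
qed

lemma psd_one: "psd D (1\<^sub>m D)"
proof -
  have "spec D (1\<^sub>m D) (\<lambda>_. 1) (1\<^sub>m D)" by (simp add: spec_def)
  then show ?thesis by (rule spec_psd) simp
qed

lemma psd_gram: "X \<in> carrier_mat D D \<Longrightarrow> psd D (adj X * X)"
  using psd_conj[OF psd_one, of X D] by simp

lemma gram_diag:
  assumes "X \<in> carrier_mat D D" "k < D"
  shows "(adj X * X) $$ (k,k) = of_real (\<Sum>l<D. (cmod (X $$ (l,k)))\<^sup>2)"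
proof -
  have "(adj X * X) $$ (k,k) = (\<Sum>l<D. adj X $$ (k,l) * X $$ (l,k))"
    by (rule mult_index) (use assms in auto)
  also have "\<dots> = (\<Sum>l<D. of_real ((cmod (X $$ (l,k)))\<^sup>2))"
    using assms by (intro sum.cong) (auto simp: complex_norm_square[symmetric] mult.commute[of "cnj _"])
  finally show ?thesis by (simp del: of_real_power)
qed

lemma trace_norm_spec:
  "spec D V l (adj X * X) \<Longrightarrow> trace_norm X = (\<Sum>j<D. sqrt (l j))"
  unfolding trace_norm_def by (simp add: spec_trace[OF spec_msqrt])

lemma trace_norm_nonneg: "X \<in> carrier_mat D D \<Longrightarrow> 0 \<le> trace_norm X"
proof -
  assume X: "X \<in> carrier_mat D D"
  obtain V l where "spec D V l (adj X * X)" "\<And>i. i < D \<Longrightarrow> 0 \<le> l i" using psd_specE[OF psd_gram[OF X]] by blast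
  then show ?thesis by (auto simp: trace_norm_spec intro!: sum_nonneg)
qed

lemma cauchy_schwarz_sum:
  "Re (\<Sum>l<D. f l * g l) \<le> sqrt (\<Sum>l<D. (cmod (f l))\<^sup>2) * sqrt (\<Sum>l<D. (cmod (g l))\<^sup>2)"
proof -
  have "Re (\<Sum>l<D. f l * g l) \<le> cmod (\<Sum>l<D. f l * g l)" by (rule complex_Re_le_cmod)
  also have "\<dots> \<le> (\<Sum>l<D. cmod (f l * g l))" by (rule norm_sum)
  also have "\<dots> = (\<Sum>l<D. \<bar>cmod (f l)\<bar> * \<bar>cmod (g l)\<bar>)" by (simp add: norm_mult)
  also have "\<dots> \<le> L2_set (\<lambda>l. cmod (f l)) {..<D} * L2_set (\<lambda>l. cmod (g l)) {..<D}"
    by (rule L2_set_mult_ineq)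
  finally show ?thesis by (simp add: L2_set_def)
qed

text \<open>Evaluate the trace in an eigenbasis \<open>V\<close> of \<open>adj X * X\<close>: column
  \<open>j\<close> of \<open>X * V\<close> has norm \<open>sqrt (l j)\<close> and column
  \<open>j\<close> of \<open>V\<close> has norm 1, so Cauchy-Schwarz bounds each diagonal
  entry.\<close>

lemma trace_le_trace_norm:
  assumes X: "X \<in> carrier_mat D D"
  shows "Re (mtrace X) \<le> trace_norm X"
proof -
  obtain V l where V: "spec D V l (adj X * X)" using psd_specE[OF psd_gram[OF X]] by blast
  note Vc = specD(3)[OF V]
  have Y: "X * V \<in> carrier_mat D D" using X Vc by simp
  have YY: "adj (X * V) * (X * V) = rdiag D l"
    using spec_conj[OF V] X Vc by (simp add: adj_mult[OF X Vc] sq_assoc[of _ D])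
  have norm: "(\<Sum>k<D. (cmod ((X * V) $$ (k,j)))\<^sup>2) = l j" if "j < D" for j
  proof -
    have "complex_of_real (\<Sum>k<D. (cmod ((X * V) $$ (k,j)))\<^sup>2) = rdiag D l $$ (j,j)"
      using gram_diag[OF Y that] unfolding YY by simp
    also have "\<dots> = of_real (l j)" using that by (simp add: mat_diag_def)
    finally show ?thesis by (simp only: of_real_eq_iff)
  qed
  have "mtrace X = mtrace (adj V * X * V)" using mtrace_conj(1)[OF specD(1)[OF V] X] by simp
  also have "adj V * X * V = adj V * (X * V)" using X Vc by (simp add: sq_assoc[of _ D])
  also have "Re (mtrace (adj V * (X * V))) = (\<Sum>j<D. Re ((adj V * (X * V)) $$ (j,j)))"
    using Vc by (simp add: mtrace_def del: index_mult_mat(1))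
  also have "\<dots> \<le> (\<Sum>j<D. sqrt (l j))"
  proof (intro sum_mono)
    fix j assume "j \<in> {..<D}"
    then have j: "j < D" by simp
    have "(adj V * (X * V)) $$ (j,j) = (\<Sum>k<D. adj V $$ (j,k) * (X * V) $$ (k,j))"
      by (rule mult_index) (use Y Vc j in auto)
    also have "Re \<dots> \<le> sqrt (\<Sum>k<D. (cmod (adj V $$ (j,k)))\<^sup>2) * sqrt (\<Sum>k<D. (cmod ((X * V) $$ (k,j)))\<^sup>2)"
      by (rule cauchy_schwarz_sum)
    also have "\<dots> = sqrt (l j)"
      unfolding norm[OF j] unitary_row_norm[OF unitary_adj[OF specD(1)[OF V]] j] by simp
    finally show "Re ((adj V * (X * V)) $$ (j,j)) \<le> sqrt (l j)" .
  qed
  finally show ?thesis by (simp add: trace_norm_spec[OF V])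
qed

text \<open>The easy half of the Fuchs--Caves theorem: no measurement beats the fidelity. Here \<open>W\<close> is the adjoint of
  the polar part of \<open>X\<close>; the convention \<open>1 / sqrt 0 = 0\<close> makes it vanish on the kernel.\<close>
lemma trace_norm_le_bhatt:
  assumes A: "psd D A" and B: "psd D B" and U: "unitary_mat D U"
  shows "trace_norm (msqrt A * msqrt B) \<le> bhatt D U A B"
proof -
  define a b where "a = msqrt A" and "b = msqrt B"
  note sA = msqrt_psd[OF A, folded a_def] and sB = msqrt_psd[OF B, folded b_def]
  note ca = psdD(1)[OF sA(1)] and cb = psdD(1)[OF sB(1)] and Uc = unitary_carrier[OF U]
  define X where "X = a * b"
  have X: "X \<in> carrier_mat D D" using ca cb by (simp add: X_def)
  obtain V l where V: "spec D V l (adj X * X)" and l: "\<And>i. i < D \<Longrightarrow> 0 \<le> l i"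
    using psd_specE[OF psd_gram[OF X]] by blast
  note Vc = specD(3)[OF V] and Vu = specD(1)[OF V]
  define G where "G = V * rdiag D (\<lambda>j. 1 / sqrt (l j)) * adj V"
  have Gs: "spec D V (\<lambda>j. 1 / sqrt (l j)) G" using Vu by (simp add: spec_def G_def)
  note Gc = specD(4)[OF Gs] and Gh = spec_herm[OF Gs]
  define W where "W = G * adj X"
  have W: "W \<in> carrier_mat D D" using Gc X by (simp add: W_def)
  have "W * X = G * (adj X * X)" using Gc X by (simp add: W_def sq_assoc[of _ D])
  then have "spec D V (\<lambda>j. 1 / sqrt (l j) * l j) (W * X)" using spec_mult[OF Gs V] by simp
  then have "mtrace (W * X) = of_real (\<Sum>j<D. 1 / sqrt (l j) * l j)" by (rule spec_trace)
  also have "(\<Sum>j<D. 1 / sqrt (l j) * l j) = (\<Sum>j<D. sqrt (l j))"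
    using l by (intro sum.cong) (auto simp: real_div_sqrt)
  finally have tn: "trace_norm X = Re (mtrace (W * X))" by (simp add: trace_norm_spec[OF V])
  \<comment> \<open>\<open>W * adj W\<close> projects onto the range of \<open>adj X * X\<close>:
    its eigenvalue is 1 where \<open>l j > 0\<close> and, by the convention for division by 0, it is
    0 where \<open>l j = 0\<close>. So \<open>W\<close> is a contraction.\<close>
  have WW: "spec D V (\<lambda>j. 1 - 1 / sqrt (l j) * (l j * (1 / sqrt (l j)))) (1\<^sub>m D - W * adj W)"
  proof -
    have "W * adj W = G * ((adj X * X) * G)"
      using Gc X by (simp add: W_def adj_mult[of _ D D _ D] Gh sq_assoc[of _ D])
    then have s: "spec D V (\<lambda>j. 1 / sqrt (l j) * (l j * (1 / sqrt (l j)))) (W * adj W)"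
      using spec_mult[OF Gs spec_mult[OF V Gs]] by simp
    then show ?thesis by (rule spec_one_minus)
  qed
  have "psd D (1\<^sub>m D - W * adj W)"
    by (rule spec_psd[OF WW]) (use l in \<open>auto simp: real_div_sqrt field_simps\<close>)
  note WP = this
  \<comment> \<open>Without \<open>W\<close> the squared row norms would be the outcome
    probabilities of \<open>B\<close>; multiplying by the contraction can only shrink them.\<close>
  have row: "(\<Sum>j<D. (cmod ((adj U * b * W) $$ (k,j)))\<^sup>2) \<le> mprob D U B k" if k: "k < D" for k
  proof -
    define M where "M = adj U * b * W"
    have M: "M \<in> carrier_mat D D" using Uc cb W by (simp add: M_def)
    have "(\<Sum>j<D. (cmod (adj M $$ (j,k)))\<^sup>2) = Re ((adj (adj M) * adj M) $$ (k,k))"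
      using gram_diag[OF adj_carrier[OF M] k] by simp
    also have "adj (adj M) * adj M = adj (b * U) * (W * adj W) * (b * U)"
      using Uc cb W by (simp add: M_def adj_mult[of _ D D _ D] psdD(2)[OF sB(1)] sq_assoc[of _ D])
    also have "\<dots> = adj U * B * U - adj (b * U) * (1\<^sub>m D - W * adj W) * (b * U)"
    proof -
      have "adj (b * U) * (1\<^sub>m D - W * adj W) * (b * U) = adj (b * U) * (b * U) - adj (b * U) * (W * adj W) * (b * U)"
        using Uc cb W by (simp add: mult_minus_distrib_mat[of _ D D _ D] minus_mult_distrib_mat[of _ D D _ _ D])
      also have "adj (b * U) * (b * U) = adj U * B * U"
        using Uc cb by (simp add: adj_mult[of _ D D _ D] psdD(2)[OF sB(1)] sq_assoc[of _ D] flip: sB(2))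
      finally show ?thesis using Uc cb W psdD(1)[OF B]
        by (intro eq_matI) (auto simp del: index_mult_mat(1))
    qed
    also have "Re ((adj U * B * U - adj (b * U) * (1\<^sub>m D - W * adj W) * (b * U)) $$ (k,k))
      = mprob D U B k - Re ((adj (b * U) * (1\<^sub>m D - W * adj W) * (b * U)) $$ (k,k))"
      using Uc cb W k mprob_entry[OF Uc psdD(1)[OF B] k] by (simp del: index_mult_mat(1))
    also have "\<dots> \<le> mprob D U B k"
      using psd_diag[OF psd_conj[OF WP, of "b * U"] k] Uc cb by simp
    finally show ?thesis using M k by (simp add: M_def[symmetric] del: index_mult_mat(1))
  qed
  have col: "(\<Sum>j<D. (cmod ((a * U) $$ (j,k)))\<^sup>2) = mprob D U A k" if k: "k < D" for k
  proof -
    have "adj (a * U) * (a * U) = adj U * A * U"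
      using Uc ca by (simp add: adj_mult[of _ D D _ D] psdD(2)[OF sA(1)] sq_assoc[of _ D] flip: sA(2))
    then show ?thesis
      using gram_diag[of "a * U" D k] Uc ca k mprob_entry[OF Uc psdD(1)[OF A] k] by (simp del: index_mult_mat(1))
  qed
  \<comment> \<open>Cyclicity moves \<open>b\<close> to the front, and conjugation by
    \<open>U\<close> makes the trace a sum over outcomes \<open>k\<close> of a row times a column,
    to which Cauchy-Schwarz applies.\<close>
  have "mtrace (W * X) = mtrace ((W * a) * b)" using W ca cb by (simp add: X_def sq_assoc[of _ D])
  also have "\<dots> = mtrace (b * (W * a))" by (rule mtrace_comm[of _ D D]) (use W ca cb in auto)
  also have "\<dots> = mtrace (adj U * (b * (W * a)) * U)" using mtrace_conj(1)[OF U, of "b * (W * a)"] W ca cb by simp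
  also have "adj U * (b * (W * a)) * U = (adj U * b * W) * (a * U)" using W ca cb Uc by (simp add: sq_assoc[of _ D])
  also have "Re (mtrace ((adj U * b * W) * (a * U))) = (\<Sum>k<D. Re (((adj U * b * W) * (a * U)) $$ (k,k)))"
    using Uc by (simp add: mtrace_def del: index_mult_mat(1))
  also have "\<dots> \<le> (\<Sum>k<D. sqrt (mprob D U A k * mprob D U B k))"
  proof (intro sum_mono)
    fix k assume "k \<in> {..<D}"
    then have k: "k < D" by simp
    have "((adj U * b * W) * (a * U)) $$ (k,k) = (\<Sum>j<D. (adj U * b * W) $$ (k,j) * (a * U) $$ (j,k))"
      by (rule mult_index) (use W ca cb Uc k in auto)
    also have "Re \<dots> \<le> sqrt (\<Sum>j<D. (cmod ((adj U * b * W) $$ (k,j)))\<^sup>2) * sqrt (\<Sum>j<D. (cmod ((a * U) $$ (j,k)))\<^sup>2)"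
      by (rule cauchy_schwarz_sum)
    also have "\<dots> \<le> sqrt (mprob D U B k) * sqrt (mprob D U A k)"
      unfolding col[OF k] using row[OF k] mprob_nonneg[OF A] by (intro mult_right_mono) auto
    finally show "Re (((adj U * b * W) * (a * U)) $$ (k,k)) \<le> sqrt (mprob D U A k * mprob D U B k)"
      by (simp add: real_sqrt_mult mult.commute)
  qed
  finally show ?thesis using tn by (simp add: bhatt_def X_def a_def b_def)
qed

lemma trace_norm_le_min_bhatt: "psd D A \<Longrightarrow> psd D B \<Longrightarrow> trace_norm (msqrt A * msqrt B) \<le> min_bhatt D A B"
  by (intro min_bhatt_greatest trace_norm_le_bhatt)

section \<open>Block-diagonal matrices, one block per value of a classical register\<close>

definition bmat :: "nat \<Rightarrow> nat \<Rightarrow> (nat \<Rightarrow> complex mat) \<Rightarrow> complex mat" where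
  "bmat m D M = Matrix.mat (m * D) (m * D)
     (\<lambda>(i,j). if i div D = j div D then M (i div D) $$ (i mod D, j mod D) else 0)"

lemma bmat_carrier [simp]: "bmat m D M \<in> carrier_mat (m * D) (m * D)"
  by (simp add: bmat_def)

lemma bmat_index: "i < m * D \<Longrightarrow> j < m * D \<Longrightarrow>
  bmat m D M $$ (i,j) = (if i div D = j div D then M (i div D) $$ (i mod D, j mod D) else 0)"
  by (simp add: bmat_def)

lemma bmat_cong: "(\<And>a. a < m \<Longrightarrow> M a = N a) \<Longrightarrow> bmat m D M = bmat m D N"
  by (rule eq_matI) (auto simp: bmat_def divmod_less)

lemma bmat_mult:
  assumes "\<And>a. a < m \<Longrightarrow> M a \<in> carrier_mat D D" "\<And>a. a < m \<Longrightarrow> N a \<in> carrier_mat D D"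
  shows "bmat m D M * bmat m D N = bmat m D (\<lambda>a. M a * N a)"
proof (rule eq_matI)
  fix i j assume "i < dim_row (bmat m D (\<lambda>a. M a * N a))" "j < dim_col (bmat m D (\<lambda>a. M a * N a))"
  then have ij: "i < m * D" "j < m * D" by (auto simp: bmat_def)
  note di = divmod_less[OF ij(1)] and dj = divmod_less[OF ij(2)]
  let ?g = "\<lambda>a b. (if i div D = a then M a $$ (i mod D, b) else 0) * (if a = j div D then N a $$ (b, j mod D) else 0)"
  have "(bmat m D M * bmat m D N) $$ (i,j) = (\<Sum>k<m * D. bmat m D M $$ (i,k) * bmat m D N $$ (k,j))"
    by (rule mult_index) (use ij in auto)
  also have "\<dots> = (\<Sum>k<m * D. ?g (k div D) (k mod D))"
    by (intro sum.cong refl) (auto simp: bmat_index ij)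
  also have "\<dots> = (\<Sum>a<m. \<Sum>b<D. ?g a b)" by (rule sum_div_mod)
  also have "\<dots> = (\<Sum>a<m. if a = i div D then (\<Sum>b<D. ?g (i div D) b) else 0)"
    by (intro sum.cong refl) auto
  also have "\<dots> = (\<Sum>b<D. ?g (i div D) b)" using di by simp
  also have "\<dots> = bmat m D (\<lambda>a. M a * N a) $$ (i,j)"
    using di dj assms[OF di(1)]
    by (auto simp: bmat_index ij mult_index[of _ D D _ D] simp del: index_mult_mat(1) intro!: sum.cong)
  finally show "(bmat m D M * bmat m D N) $$ (i,j) = bmat m D (\<lambda>a. M a * N a) $$ (i,j)" .
qed (auto simp: bmat_def)

lemma bmat_adj:
  assumes "\<And>a. a < m \<Longrightarrow> M a \<in> carrier_mat D D"
  shows "adj (bmat m D M) = bmat m D (\<lambda>a. adj (M a))"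
proof (rule eq_matI)
  fix i j assume "i < dim_row (bmat m D (\<lambda>a. adj (M a)))" "j < dim_col (bmat m D (\<lambda>a. adj (M a)))"
  then have ij: "i < m * D" "j < m * D" by (auto simp: bmat_def)
  note di = divmod_less[OF ij(1)] and dj = divmod_less[OF ij(2)]
  have "adj (bmat m D M) $$ (i,j) = cnj (bmat m D M $$ (j,i))"
    using carrier_matD[OF bmat_carrier] ij by (intro adj_index) auto
  then show "adj (bmat m D M) $$ (i,j) = bmat m D (\<lambda>a. adj (M a)) $$ (i,j)"
    using di dj assms[OF di(1)] by (auto simp: bmat_index ij)
qed (auto simp: bmat_def)

lemma bmat_rdiag: "bmat m D (\<lambda>a. rdiag D (q a)) = rdiag (m * D) (\<lambda>i. q (i div D) (i mod D))"
proof (rule eq_matI)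
  fix i j assume "i < dim_row (rdiag (m * D) (\<lambda>i. q (i div D) (i mod D)))" "j < dim_col (rdiag (m * D) (\<lambda>i. q (i div D) (i mod D)))"
  then have ij: "i < m * D" "j < m * D" by (auto simp: mat_diag_def)
  then show "bmat m D (\<lambda>a. rdiag D (q a)) $$ (i,j) = rdiag (m * D) (\<lambda>i. q (i div D) (i mod D)) $$ (i,j)"
    using divmod_less[OF ij(1)] divmod_less[OF ij(2)] divmod_eq[of i j D]
    by (auto simp: bmat_index mat_diag_def)
qed (auto simp: bmat_def mat_diag_def)

lemma bmat_spec:
  assumes "\<And>a. a < m \<Longrightarrow> spec D (U a) (q a) (M a)"
  shows "spec (m * D) (bmat m D U) (\<lambda>i. q (i div D) (i mod D)) (bmat m D M)"
proof -
  note U = specD[OF assms]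
  have Uu: "bmat m D U * adj (bmat m D U) = 1\<^sub>m (m * D)"
  proof -
    have "bmat m D U * adj (bmat m D U) = bmat m D (\<lambda>a. U a * adj (U a))"
      by (subst bmat_adj, use U in simp, subst bmat_mult) (use U in auto)
    also have "\<dots> = bmat m D (\<lambda>a. rdiag D (\<lambda>_. 1))"
      by (rule bmat_cong) (use unitary_right[OF U(1)] in simp)
    finally show ?thesis unfolding bmat_rdiag by simp
  qed
  have "bmat m D U * rdiag (m * D) (\<lambda>i. q (i div D) (i mod D)) * adj (bmat m D U)
      = bmat m D U * bmat m D (\<lambda>a. rdiag D (q a)) * bmat m D (\<lambda>a. adj (U a))"
    unfolding bmat_rdiag by (subst bmat_adj) (use U in auto)
  also have "\<dots> = bmat m D (\<lambda>a. U a * rdiag D (q a)) * bmat m D (\<lambda>a. adj (U a))"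
    by (subst bmat_mult) (use U in auto)
  also have "\<dots> = bmat m D (\<lambda>a. U a * rdiag D (q a) * adj (U a))"
    by (subst bmat_mult) (use U in auto)
  also have "\<dots> = bmat m D M" by (rule bmat_cong) (rule U(2)[symmetric])
  finally show ?thesis using Uu by (simp add: spec_def unitary_mat_def)
qed

lemma bmat_msqrt:
  assumes "\<And>a. a < m \<Longrightarrow> psd D (M a)"
  shows "msqrt (bmat m D M) = bmat m D (\<lambda>a. msqrt (M a))"
proof -
  have "\<forall>a. \<exists>U q. a < m \<longrightarrow> spec D U q (M a)" using psd_specE[OF assms] by metis
  then obtain U q where U: "\<And>a. a < m \<Longrightarrow> spec D (U a) (q a) (M a)" by metis
  show ?thesis
    using spec_eqI[OF spec_msqrt[OF bmat_spec[of m D U q M]] bmat_spec[of m D U "\<lambda>a i. sqrt (q a i)" "\<lambda>a. msqrt (M a)"]]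
      U spec_msqrt by blast
qed

lemma bmat_mtrace: "mtrace (bmat m D M) = (\<Sum>a<m. mtrace (M a))" if "\<And>a. a < m \<Longrightarrow> M a \<in> carrier_mat D D"
proof -
  have "mtrace (bmat m D M) = (\<Sum>i<m * D. M (i div D) $$ (i mod D, i mod D))"
    by (simp add: mtrace_def bmat_index carrier_matD[OF bmat_carrier])
  also have "\<dots> = (\<Sum>a<m. \<Sum>b<D. M a $$ (b,b))" by (rule sum_div_mod)
  also have "\<dots> = (\<Sum>a<m. mtrace (M a))" using that by (auto simp: mtrace_def intro!: sum.cong)
  finally show ?thesis .
qed

lemma bmat_trace_norm:
  assumes "\<And>a. a < m \<Longrightarrow> M a \<in> carrier_mat D D"
  shows "trace_norm (bmat m D M) = (\<Sum>a<m. trace_norm (M a))"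
proof -
  have "adj (bmat m D M) * bmat m D M = bmat m D (\<lambda>a. adj (M a) * M a)"
    by (subst bmat_adj, use assms in simp, subst bmat_mult) (use assms in auto)
  moreover have g: "psd D (adj (M a) * M a)" if "a < m" for a by (rule psd_gram[OF assms[OF that]])
  ultimately show ?thesis
    unfolding trace_norm_def
    by (simp add: bmat_msqrt[OF g] bmat_mtrace[OF psdD(1)[OF msqrt_psd(1)[OF g]]])
qed

section \<open>Binary encoding of the register\<close>

lemma bidx_snoc: "bidx (v @ [b]) = bidx v + (if b then 2 ^ length v else 0)"
proof -
  have "(\<Sum>k<length v. if (v @ [b]) ! k then 2 ^ k else 0) = (\<Sum>k<length v. if v ! k then 2 ^ k else (0::nat))"
    by (intro sum.cong) (auto simp: nth_append)
  then show ?thesis by (simp add: bidx_def)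
qed

lemma bidx_less: "bidx v < 2 ^ length v"
  by (induction v rule: rev_induct) (auto simp: bidx_snoc, simp add: bidx_def)

lemma bidx_inj: "length v = length w \<Longrightarrow> bidx v = bidx w \<Longrightarrow> v = w"
proof (induction v arbitrary: w rule: rev_induct)
  case (snoc b v)
  then obtain w' c where w: "w = w' @ [c]" "length w' = length v" by (cases w rule: rev_cases) auto
  have "bidx v < 2 ^ length v" "bidx w' < 2 ^ length v" using bidx_less[of v] bidx_less[of w'] w by auto
  then have "b = c \<and> bidx v = bidx w'" using snoc.prems(2) w by (cases b; cases c) (auto simp: bidx_snoc)
  then show ?case using snoc.IH[of w'] w by simp
qed simp

lemma bidx_bij: "bij_betw bidx (bits k) {..<2 ^ k}"
proof -
  have inj: "inj_on bidx (bits k)" by (rule inj_onI) (auto simp: bits_def intro: bidx_inj)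
  moreover have "bidx ` bits k = {..<2 ^ k}"
  proof (rule card_subset_eq)
    show "bidx ` bits k \<subseteq> {..<2 ^ k}" using bidx_less by (auto simp: bits_def)
    show "card (bidx ` bits k) = card {..<2 ^ k::nat}" using card_image[OF inj] by simp
  qed simp
  ultimately show ?thesis by (simp add: bij_betw_def)
qed

section \<open>Split channels in block form\<close>

context cq_channel
begin

definition unidx :: "nat \<Rightarrow> nat \<Rightarrow> bool list" where
  "unidx k = inv_into (bits k) bidx"

lemma unidx_bidx: "v \<in> bits k \<Longrightarrow> unidx k (bidx v) = v"
  unfolding unidx_def using bidx_bij[of k] by (auto simp: bij_betw_def)

lemma unidx_in: "a < 2 ^ k \<Longrightarrow> unidx k a \<in> bits k" "a < 2 ^ k \<Longrightarrow> bidx (unidx k a) = a"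
  unfolding unidx_def using bidx_bij[of k] by (auto simp: bij_betw_def inv_into_into f_inv_into_f)

lemma sum_unidx: "(\<Sum>a<2 ^ k. f (unidx k a)) = (\<Sum>v\<in>bits k. f v)"
  by (rule sum.reindex_bij_witness[of _ bidx "unidx k"])
     (use unidx_in unidx_bidx bidx_less in \<open>auto simp: bits_def\<close>)

text \<open>\<open>ketbra\<close> has a single nonzero entry, on the diagonal. Of the sum over
  \<open>v\<close> only the word encoded by the block index of \<open>i\<close> survives, and only
  inside a diagonal block.\<close>

lemma split_out_bmat:
  "split_out \<rho> d n (Suc k) b
    = bmat (2 ^ k) (dm n) (\<lambda>a. of_real (1 / 2 ^ k) \<cdot>\<^sub>m rb n (unidx k a @ [b]))"
proof (rule eq_matI)
  let ?B = "bmat (2 ^ k) (dm n) (\<lambda>a. of_real (1 / 2 ^ k) \<cdot>\<^sub>m rb n (unidx k a @ [b]))"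
  fix i j assume "i < dim_row ?B" "j < dim_col ?B"
  then have ij: "i < 2 ^ k * dm n" "j < 2 ^ k * dm n" by (auto simp: bmat_def)
  note di = divmod_less[OF ij(1)] and dj = divmod_less[OF ij(2)]
  have kc: "ketbra (2 ^ k) c \<in> carrier_mat (2 ^ k) (2 ^ k)" for c by (simp add: ketbra_def)
  have "split_out \<rho> d n (Suc k) b $$ (i,j) =
     (\<Sum>v\<in>bits k. if v = unidx k (i div dm n) then (if i div dm n = j div dm n
        then of_real (1 / 2 ^ k) * rb n (unidx k (i div dm n) @ [b]) $$ (i mod dm n, j mod dm n) else 0) else 0)"
    unfolding split_out_def msum_def
  proof (subst index_mat(1), simp_all only: ij diff_Suc_1, intro sum.cong refl)
    fix v assume v: "v \<in> bits k"
    have eq: "i div dm n = bidx v \<longleftrightarrow> v = unidx k (i div dm n)"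
      using v unidx_bidx[OF v] unidx_in[OF di(1)] by auto
    have "(complex_of_real (1 / 2 ^ k) \<cdot>\<^sub>m kron (ketbra (2 ^ k) (bidx v)) (rb n (v @ [b]))) $$ (i,j)
       = complex_of_real (1 / 2 ^ k) * kron (ketbra (2 ^ k) (bidx v)) (rb n (v @ [b])) $$ (i,j)"
      using carrier_matD[OF kron_carrier[OF kc rb_carrier]] ij by (intro index_smult_mat) auto
    also have "\<dots> = complex_of_real (1 / 2 ^ k) * (ketbra (2 ^ k) (bidx v) $$ (i div dm n, j div dm n)
         * rb n (v @ [b]) $$ (i mod dm n, j mod dm n))"
      by (simp only: kron_index[OF kc rb_carrier ij])
    also have "ketbra (2 ^ k) (bidx v) $$ (i div dm n, j div dm n) =
        (if i div dm n = bidx v \<and> j div dm n = bidx v then 1 else 0)"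
      using di dj by (simp add: ketbra_def)
    finally show "(complex_of_real (1 / 2 ^ k) \<cdot>\<^sub>m kron (ketbra (2 ^ k) (bidx v)) (rb n (v @ [b]))) $$ (i,j)
       = (if v = unidx k (i div dm n) then (if i div dm n = j div dm n
        then of_real (1 / 2 ^ k) * rb n (unidx k (i div dm n) @ [b]) $$ (i mod dm n, j mod dm n) else 0) else 0)"
      using eq by auto
  qed
  also have "\<dots> = ?B $$ (i,j)"
    using unidx_in(1)[OF di(1)] di dj carrier_matD[OF rb_carrier] by (simp add: bmat_index ij)
  finally show "split_out \<rho> d n (Suc k) b $$ (i,j) = ?B $$ (i,j)" .
qed (auto simp: bmat_def split_out_def msum_def)

text \<open>The square root of the fidelity, on the same scale as the Bhattacharyya coefficient. The
  index is one-based, so \<open>sqfid n (Suc k)\<close> pairs with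
  \<open>split_bhatt n k\<close>.\<close>

definition sqfid :: "nat \<Rightarrow> nat \<Rightarrow> real" where
  "sqfid n i = trace_norm (msqrt (split_out \<rho> d n i False) * msqrt (split_out \<rho> d n i True))"

lemma split_fid_sqfid: "split_fid \<rho> d n i = (sqfid n i)\<^sup>2"
  by (simp add: split_fid_def fid_def sqfid_def)

text \<open>Square roots, products and the trace norm all act blockwise. Each of the two square
  roots contributes a factor \<open>sqrt c\<close> with \<open>c = 1 / 2 ^ k\<close>, and their
  product is exactly the weight of one prefix in the average.\<close>

lemma sqfid_blocks:
  assumes "k < 2 ^ n"
  shows "sqfid n (Suc k) = avg_bits k (\<lambda>v. trace_norm (msqrt (rb n (v @ [False])) * msqrt (rb n (v @ [True]))))"
    and "0 \<le> sqfid n (Suc k)"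
proof -
  let ?M = "\<lambda>b a. of_real (1 / 2 ^ k) \<cdot>\<^sub>m rb n (unidx k a @ [b])"
  define c :: real where "c = 1 / 2 ^ k"
  have c0: "0 \<le> c" by (simp add: c_def)
  have st: "psd (dm n) (rb n (unidx k a @ [b]))" if "a < 2 ^ k" for a b
    by (rule rb_state) (use assms unidx_in(1)[OF that] in \<open>auto simp: bits_def\<close>)
  have sc: "psd (dm n) (of_real c \<cdot>\<^sub>m rb n (unidx k a @ [b]))" if "a < 2 ^ k" for a b
    by (rule psd_smult[OF st[OF that] c0])
  have pc: "msqrt (rb n (unidx k a @ [b])) \<in> carrier_mat (dm n) (dm n)" if "a < 2 ^ k" for a b
    using psdD(1)[OF msqrt_psd(1)[OF st[OF that]]] .
  have ms: "msqrt (split_out \<rho> d n (Suc k) b) = bmat (2 ^ k) (dm n) (\<lambda>a. of_real (sqrt c) \<cdot>\<^sub>m msqrt (rb n (unidx k a @ [b])))" for b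
    unfolding split_out_bmat c_def[symmetric]
    by (subst bmat_msqrt[of _ _ "\<lambda>a. of_real c \<cdot>\<^sub>m rb n (unidx k a @ [b])", OF sc])
       (auto intro!: bmat_cong msqrt_smult[OF st c0])
  let ?T = "\<lambda>a. msqrt (rb n (unidx k a @ [False])) * msqrt (rb n (unidx k a @ [True]))"
  have "msqrt (split_out \<rho> d n (Suc k) False) * msqrt (split_out \<rho> d n (Suc k) True)
     = bmat (2 ^ k) (dm n) (\<lambda>a. of_real c \<cdot>\<^sub>m ?T a)"
    unfolding ms
  proof (subst bmat_mult)
    show "bmat (2 ^ k) (dm n) (\<lambda>a. of_real (sqrt c) \<cdot>\<^sub>m msqrt (rb n (unidx k a @ [False])) * (of_real (sqrt c) \<cdot>\<^sub>m msqrt (rb n (unidx k a @ [True]))))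
       = bmat (2 ^ k) (dm n) (\<lambda>a. of_real c \<cdot>\<^sub>m ?T a)"
    proof (rule bmat_cong)
      fix a assume "a < (2::nat) ^ k"
      note p = pc[OF this]
      have "complex_of_real (sqrt c) * of_real (sqrt c) = of_real c" using c0 by (simp flip: of_real_mult)
      then show "of_real (sqrt c) \<cdot>\<^sub>m msqrt (rb n (unidx k a @ [False])) * (of_real (sqrt c) \<cdot>\<^sub>m msqrt (rb n (unidx k a @ [True]))) = of_real c \<cdot>\<^sub>m ?T a"
        using p[of True] p[of False]
        by (simp add: mult_smult_assoc_mat[of _ "dm n" "dm n" _ "dm n"] mult_smult_distrib[of _ "dm n" "dm n" _ "dm n"] smult_smult_times)
    qed
  qed (use pc in auto)
  then have 1: "sqfid n (Suc k) = (\<Sum>a<2 ^ k. trace_norm (of_real c \<cdot>\<^sub>m ?T a))"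
    unfolding sqfid_def by (simp only:) (rule bmat_trace_norm, use pc in auto)
  have tn: "trace_norm (of_real c \<cdot>\<^sub>m X) = c * trace_norm X" if X: "X \<in> carrier_mat (dm n) (dm n)" for X
  proof -
    have "adj (of_real c \<cdot>\<^sub>m X) * (of_real c \<cdot>\<^sub>m X) = of_real (c * c) \<cdot>\<^sub>m (adj X * X)"
      using X by (simp add: adj_smult mult_smult_assoc_mat[of _ "dm n" "dm n" _ "dm n"] mult_smult_distrib[of _ "dm n" "dm n" _ "dm n"] smult_smult_times)
    then have "msqrt (adj (of_real c \<cdot>\<^sub>m X) * (of_real c \<cdot>\<^sub>m X)) = of_real c \<cdot>\<^sub>m msqrt (adj X * X)"
      using msqrt_smult[OF psd_gram[OF X], of "c * c"] c0 by simp
    then show ?thesis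
      unfolding trace_norm_def using mtrace_smult[OF psdD(1)[OF msqrt_psd(1)[OF psd_gram[OF X]]], of "of_real c"] by simp
  qed
  have "sqfid n (Suc k) = (\<Sum>a<2 ^ k. c * trace_norm (?T a))"
    unfolding 1 by (intro sum.cong refl tn) (use pc in auto)
  also have "\<dots> = (\<Sum>v\<in>bits k. c * trace_norm (msqrt (rb n (v @ [False])) * msqrt (rb n (v @ [True]))))"
    by (rule sum_unidx)
  finally show "sqfid n (Suc k) = avg_bits k (\<lambda>v. trace_norm (msqrt (rb n (v @ [False])) * msqrt (rb n (v @ [True]))))"
    by (simp add: avg_bits_def c_def sum_divide_distrib)
  show "0 \<le> sqfid n (Suc k)"
    unfolding 1 by (intro sum_nonneg trace_norm_nonneg[of _ "dm n"]) (use pc in auto)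
qed

lemma sqfid_le_split_bhatt: "k < 2 ^ n \<Longrightarrow> sqfid n (Suc k) \<le> split_bhatt n k"
  unfolding sqfid_blocks(1) split_bhatt_def
  by (intro avg_bits_mono trace_norm_le_min_bhatt rb_state) (auto simp: bits_def)

abbreviation sqrt_overlap :: "nat \<Rightarrow> bool list \<Rightarrow> real" where
  "sqrt_overlap n v \<equiv> Re (mtrace (msqrt (rb n (v @ [False])) * msqrt (rb n (v @ [True]))))"

lemma sqfid_ge: "k < 2 ^ n \<Longrightarrow>
  avg_bits k (\<lambda>v. sqrt_overlap n v) \<le> sqfid n (Suc k)"
  unfolding sqfid_blocks(1)
  by (intro avg_bits_mono trace_le_trace_norm[of _ "dm n"] sq_mult psdD(1) msqrt_psd(1) rb_state) (auto simp: bits_def)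

end

section \<open>Successive cancellation decoding\<close>

text \<open>Phrased through \<open>L2_set\<close>, from which the triangle inequality is inherited.
  Pairs list the column first, which matches the diagonal sum in \<open>hs_norm_sq\<close>.\<close>

definition hs_norm :: "nat \<Rightarrow> complex mat \<Rightarrow> real" where
  "hs_norm D X = L2_set (\<lambda>(j,l). cmod (X $$ (l,j))) ({..<D} \<times> {..<D})"

lemma hs_norm_nonneg [simp]: "0 \<le> hs_norm D X"
  by (simp add: hs_norm_def)

lemma hs_norm_sq: "X \<in> carrier_mat D D \<Longrightarrow> (hs_norm D X)\<^sup>2 = Re (mtrace (adj X * X))"
proof -
  assume X: "X \<in> carrier_mat D D"
  have "(hs_norm D X)\<^sup>2 = (\<Sum>j<D. \<Sum>l<D. (cmod (X $$ (l,j)))\<^sup>2)"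
    by (simp add: hs_norm_def L2_set_def sum_nonneg sum.cartesian_product split_def)
  also have "\<dots> = Re (mtrace (adj X * X))"
    using X by (simp add: mtrace_def gram_diag[OF X] del: index_mult_mat(1))
  finally show ?thesis .
qed

lemma hs_norm_triangle:
  assumes "X \<in> carrier_mat D D" "Y \<in> carrier_mat D D"
  shows "hs_norm D (X + Y) \<le> hs_norm D X + hs_norm D Y"
proof -
  have "hs_norm D (X + Y) \<le> L2_set (\<lambda>x. (case x of (j,l) \<Rightarrow> cmod (X $$ (l,j))) + (case x of (j,l) \<Rightarrow> cmod (Y $$ (l,j)))) ({..<D} \<times> {..<D})"
    unfolding hs_norm_def by (rule L2_set_mono) (use assms in \<open>auto intro: norm_triangle_ineq\<close>)
  also have "\<dots> \<le> hs_norm D X + hs_norm D Y" unfolding hs_norm_def by (rule L2_set_triangle_ineq)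
  finally show ?thesis .
qed

definition projector :: "nat \<Rightarrow> complex mat \<Rightarrow> bool" where
  "projector D P \<longleftrightarrow> P \<in> carrier_mat D D \<and> adj P = P \<and> P * P = P"

lemma projectorD: "projector D P \<Longrightarrow> P \<in> carrier_mat D D" "projector D P \<Longrightarrow> adj P = P" "projector D P \<Longrightarrow> P * P = P"
  by (auto simp: projector_def)

lemma spec_projector:
  assumes "spec D U q P" "\<And>i. i < D \<Longrightarrow> q i = 0 \<or> q i = 1"
  shows "projector D P"
  unfolding projector_def
  using specD(4)[OF assms(1)] spec_herm[OF assms(1)] spec_eqI[OF spec_mult[OF assms(1,1)] assms(1)] assms(2)
  by force

lemma projector_one: "projector D (1\<^sub>m D)"
  by (simp add: projector_def)

lemma projector_compl: "projector D P \<Longrightarrow> projector D (1\<^sub>m D - P)"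
proof -
  assume P: "projector D P"
  note c = projectorD(1)[OF P]
  have c': "1\<^sub>m D - P \<in> carrier_mat D D" using c by (simp add: minus_carrier_mat)
  have "(1\<^sub>m D - P) * (1\<^sub>m D - P) = (1\<^sub>m D - P) * 1\<^sub>m D - (1\<^sub>m D - P) * P"
    by (rule mult_minus_distrib_mat[OF c' _ c]) simp
  also have "(1\<^sub>m D - P) * P = 1\<^sub>m D * P - P * P"
    by (rule minus_mult_distrib_mat[OF _ c c]) simp
  also have "(1\<^sub>m D - P) * 1\<^sub>m D - (1\<^sub>m D * P - P * P) = 1\<^sub>m D - P"
    using c c' projectorD(3)[OF P] by (intro eq_matI) auto
  finally show ?thesis using c c' projectorD(2)[OF P] by (simp add: projector_def adj_minus[of _ D D])
qed

lemma projector_hs_norm_sq: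
  assumes "projector D P" "X \<in> carrier_mat D D"
  shows "(hs_norm D (P * X))\<^sup>2 = Re (mtrace (adj X * (P * X)))"
proof -
  note P = projectorD[OF assms(1)]
  have "adj (P * X) * (P * X) = adj X * ((P * P) * X)"
    using P(1,2) assms(2) by (simp add: adj_mult[of _ D D _ D] sq_assoc[of _ D])
  then show ?thesis using hs_norm_sq[of "P * X" D] P assms(2) by simp
qed

text \<open>Pythagoras: the squared norms of \<open>P X\<close> and \<open>(1 - P) X\<close> add up
  to that of \<open>X\<close>.\<close>

lemma projector_contraction:
  assumes "projector D P" "X \<in> carrier_mat D D"
  shows "hs_norm D (P * X) \<le> hs_norm D X"
proof -
  note P = projectorD[OF assms(1)]
  have "adj X * ((1\<^sub>m D - P) * X) = adj X * X - adj X * (P * X)"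
    using P assms(2) by (simp add: mult_minus_distrib_mat[of _ D D _ D] minus_mult_distrib_mat[of _ D D _ _ D])
  then have "(hs_norm D ((1\<^sub>m D - P) * X))\<^sup>2 = (hs_norm D X)\<^sup>2 - (hs_norm D (P * X))\<^sup>2"
    unfolding projector_hs_norm_sq[OF assms] projector_hs_norm_sq[OF projector_compl[OF assms(1)] assms(2)] hs_norm_sq[OF assms(2)]
    using P assms(2) by (simp add: mtrace_minus[of _ D])
  then have "(hs_norm D (P * X))\<^sup>2 \<le> (hs_norm D X)\<^sup>2" using zero_le_power2[of "hs_norm D ((1\<^sub>m D - P) * X)"] by linarith
  then show ?thesis by (rule power2_le_imp_le) simp
qed

text \<open>Telescoping replaces the noncommutative union bound: since projectors are contractions, each
  factor displaces \<open>s\<close> by at most the norm of \<open>(1 - P i) s\<close>.\<close>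
lemma sequential_projections:
  assumes "\<And>i. i \<in> set ns \<Longrightarrow> projector D (P i)" "s \<in> carrier_mat D D"
  shows "foldl (\<lambda>M i. P i * M) (1\<^sub>m D) ns \<in> carrier_mat D D \<and>
    adj (foldl (\<lambda>M i. P i * M) (1\<^sub>m D) ns) = foldl (\<lambda>M i. M * P i) (1\<^sub>m D) ns \<and>
    hs_norm D (foldl (\<lambda>M i. P i * M) (1\<^sub>m D) ns * s) \<le> hs_norm D s \<and>
    hs_norm D (s - foldl (\<lambda>M i. P i * M) (1\<^sub>m D) ns * s) \<le> (\<Sum>i\<leftarrow>ns. hs_norm D ((1\<^sub>m D - P i) * s))"
  using assms(1)
proof (induction "ns" rule: rev_induct)
  case Nil
  have "s - 1\<^sub>m D * s = 0\<^sub>m D D" using assms(2) by simp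
  moreover have "hs_norm D (0\<^sub>m D D) = 0"
    unfolding hs_norm_def L2_set_def by (simp add: sum.neutral split_def)
  ultimately show ?case using assms(2) by simp
next
  case (snoc i js)
  define M where "M = foldl (\<lambda>M i. P i * M) (1\<^sub>m D) js"
  have IH: "M \<in> carrier_mat D D" "adj M = foldl (\<lambda>M i. M * P i) (1\<^sub>m D) js"
    "hs_norm D (M * s) \<le> hs_norm D s" "hs_norm D (s - M * s) \<le> (\<Sum>i\<leftarrow>js. hs_norm D ((1\<^sub>m D - P i) * s))"
    using snoc by (auto simp: M_def)
  have Pi: "projector D (P i)" using snoc.prems by simp
  note P = projectorD[OF Pi]
  note cs = IH(1) P(1) assms(2)
  have "hs_norm D (P i * M * s) \<le> hs_norm D s"
    using projector_contraction[OF Pi, of "M * s"] IH(3) cs by (simp add: sq_assoc[of _ D])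
  \<comment> \<open>The new factor displaces \<open>s\<close> itself by \<open>(1 - P i) s\<close>
    and transports the earlier displacement without enlarging it.\<close>
  moreover have "s - P i * M * s = (1\<^sub>m D - P i) * s + P i * (s - M * s)"
  proof -
    have "P i * (s - M * s) = P i * s - P i * M * s" using cs
      by (simp add: mult_minus_distrib_mat[of _ D D _ D] sq_assoc[of _ D])
    moreover have "(1\<^sub>m D - P i) * s = s - P i * s" using cs by (simp add: minus_mult_distrib_mat[of _ D D _ _ D])
    moreover have "s - P i * M * s = (s - P i * s) + (P i * s - P i * M * s)" if "P i * M * s \<in> carrier_mat D D" "P i * s \<in> carrier_mat D D"
      using that cs by (intro eq_matI) (auto simp del: index_mult_mat(1))
    ultimately show ?thesis using cs by simp
  qed
  then have "hs_norm D (s - P i * M * s) \<le> hs_norm D ((1\<^sub>m D - P i) * s) + hs_norm D (s - M * s)"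
    using hs_norm_triangle[of "(1\<^sub>m D - P i) * s" D "P i * (s - M * s)"]
      projector_contraction[OF Pi, of "s - M * s"] cs by (simp add: minus_carrier_mat)
  ultimately show ?case using IH cs
    by (simp add: M_def[symmetric] adj_mult[of _ D D _ D] P(2))
qed

lemma add_minus_cancel_mat: "X \<in> carrier_mat n m \<Longrightarrow> Y \<in> carrier_mat n m \<Longrightarrow> X + (Y - X) = (Y :: complex mat)"
  by (rule eq_matI) auto

text \<open>With the unit vector \<open>s = msqrt A\<close>, the success probability
  \<open>p\<close> is \<open>x^2\<close> for the norm \<open>x\<close> of \<open>L s\<close>. The
  triangle inequality bounds \<open>1 - x\<close> by the norm of \<open>s - L s\<close>, and
  \<open>1 - x^2 \<le> 2 (1 - x)\<close> is the origin of the factor 2.\<close>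

lemma sequential_projections_error:
  assumes P: "\<And>i. i \<in> set ns \<Longrightarrow> projector D (P i)" and A: "psd D A" "mtrace A = 1"
  defines "p \<equiv> Re (mtrace (foldl (\<lambda>M i. P i * M) (1\<^sub>m D) ns * A * foldl (\<lambda>M i. M * P i) (1\<^sub>m D) ns))"
  shows "p \<le> 1" and "1 - p \<le> 2 * (\<Sum>i\<leftarrow>ns. sqrt (Re (mtrace ((1\<^sub>m D - P i) * A))))"
proof -
  define s where "s = msqrt A"
  note s = msqrt_psd[OF A(1), folded s_def]
  note cs = psdD(1)[OF s(1)] and sh = psdD(2)[OF s(1)]
  define L where "L = foldl (\<lambda>M i. P i * M) (1\<^sub>m D) ns"
  have L: "L \<in> carrier_mat D D" "adj L = foldl (\<lambda>M i. M * P i) (1\<^sub>m D) ns" "hs_norm D (L * s) \<le> hs_norm D s"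
    "hs_norm D (s - L * s) \<le> (\<Sum>i\<leftarrow>ns. hs_norm D ((1\<^sub>m D - P i) * s))"
    using sequential_projections[of ns D P s] P cs unfolding L_def by blast+
  have Ls: "L * s \<in> carrier_mat D D" using L(1) cs by simp
  have n1: "hs_norm D s = 1"
  proof -
    have "(hs_norm D s)\<^sup>2 = 1" using hs_norm_sq[OF cs] by (simp add: sh s(2) A(2))
    then show ?thesis by (simp add: power2_eq_1_iff) (use hs_norm_nonneg[of D s] in linarith)
  qed
  have "L * A * adj L = (L * s) * adj (L * s)"
    using L(1) cs by (simp add: adj_mult[of _ D D _ D] sh sq_assoc[of _ D] flip: s(2))
  then have "p = Re (mtrace ((L * s) * adj (L * s)))" unfolding p_def L(2)[symmetric] L_def[symmetric] by simp
  also have "\<dots> = Re (mtrace (adj (L * s) * (L * s)))"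
    using mtrace_comm[of "L * s" D D "adj (L * s)"] Ls by simp
  finally have p: "p = (hs_norm D (L * s))\<^sup>2" using hs_norm_sq[OF Ls] by simp
  define x where "x = hs_norm D (L * s)"
  have x: "0 \<le> x" "x \<le> 1" using L(3) n1 by (simp_all add: x_def)
  show "p \<le> 1" using x unfolding p x_def[symmetric] by (simp add: power_le_one)
  have eq: "L * s + (s - L * s) = s" by (rule add_minus_cancel_mat[OF Ls cs])
  have "1 \<le> x + hs_norm D (s - L * s)"
    using hs_norm_triangle[of "L * s" D "s - L * s"] Ls cs n1 unfolding eq by (simp add: x_def minus_carrier_mat)
  moreover have "1 - p \<le> 2 * (1 - x)"
    using x zero_le_power2[of "1 - x"] unfolding p x_def[symmetric] by (simp add: power2_eq_square algebra_simps)
  ultimately have "1 - p \<le> 2 * hs_norm D (s - L * s)" by argo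
  also have "\<dots> \<le> 2 * (\<Sum>i\<leftarrow>ns. hs_norm D ((1\<^sub>m D - P i) * s))" using L(4) by (rule mult_left_mono) simp
  also have "(\<Sum>i\<leftarrow>ns. hs_norm D ((1\<^sub>m D - P i) * s)) = (\<Sum>i\<leftarrow>ns. sqrt (Re (mtrace ((1\<^sub>m D - P i) * A))))"
  proof (rule arg_cong[of _ _ sum_list], rule map_cong[OF refl])
    fix i assume "i \<in> set ns"
    then have Q: "projector D (1\<^sub>m D - P i)" using projector_compl P by blast
    note cQ = projectorD(1)[OF Q]
    have "(hs_norm D ((1\<^sub>m D - P i) * s))\<^sup>2 = Re (mtrace (s * ((1\<^sub>m D - P i) * s)))"
      using projector_hs_norm_sq[OF Q cs] by (simp add: sh)
    also have "mtrace (s * ((1\<^sub>m D - P i) * s)) = mtrace ((1\<^sub>m D - P i) * s * s)"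
      by (rule mtrace_comm[of _ D D]) (use cs cQ in auto)
    also have "(1\<^sub>m D - P i) * s * s = (1\<^sub>m D - P i) * A" using cs cQ s(2) by (simp add: sq_assoc[of _ D])
    finally show "hs_norm D ((1\<^sub>m D - P i) * s) = sqrt (Re (mtrace ((1\<^sub>m D - P i) * A)))"
      by (metis hs_norm_nonneg real_sqrt_abs abs_of_nonneg)
  qed
  finally show "1 - p \<le> 2 * (\<Sum>i\<leftarrow>ns. sqrt (Re (mtrace ((1\<^sub>m D - P i) * A))))" .
qed

lemma projector_trace_nonneg:
  assumes "projector D Q" "psd D A"
  shows "0 \<le> Re (mtrace (Q * A))"
proof -
  note s = msqrt_psd[OF assms(2)] and cQ = projectorD(1)[OF assms(1)]
  note cs = psdD(1)[OF s(1)]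
  have "Q * A = Q * msqrt A * msqrt A" using s(2) cs cQ by (simp add: sq_assoc[of _ D])
  then have "mtrace (Q * A) = mtrace (msqrt A * (Q * msqrt A))"
    using mtrace_comm[of "Q * msqrt A" D D "msqrt A"] cs cQ by simp
  then have "Re (mtrace (Q * A)) = (hs_norm D (Q * msqrt A))\<^sup>2"
    using projector_hs_norm_sq[OF assms(1) cs] psdD(2)[OF s(1)] by simp
  then show ?thesis by simp
qed

lemma sum_bits_append: "(\<Sum>u\<in>bits (a + b). f u) = (\<Sum>v\<in>bits a. \<Sum>w\<in>bits b. f (v @ w))"
proof -
  have "(\<Sum>x\<in>bits a \<times> bits b. f (fst x @ snd x)) = (\<Sum>u\<in>bits (a + b). f u)"
    by (rule sum.reindex_bij_witness[of _ "\<lambda>u. (take a u, drop a u)" "\<lambda>x. fst x @ snd x"])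
       (auto simp: bits_def)
  then show ?thesis by (simp add: sum.cartesian_product split_def)
qed

text \<open>Jensen for the concave square root, obtained from Cauchy-Schwarz against the constant
  1.\<close>

lemma avg_bits_sqrt_le:
  assumes "\<And>v. v \<in> bits k \<Longrightarrow> 0 \<le> f v"
  shows "avg_bits k (\<lambda>v. sqrt (f v)) \<le> sqrt (avg_bits k f)"
proof -
  have "(\<Sum>v\<in>bits k. \<bar>sqrt (f v)\<bar> * \<bar>1\<bar>) \<le> L2_set (\<lambda>v. sqrt (f v)) (bits k) * L2_set (\<lambda>_. 1) (bits k)"
    by (rule L2_set_mult_ineq)
  then have "(\<Sum>v\<in>bits k. sqrt (f v)) \<le> sqrt (\<Sum>v\<in>bits k. f v) * sqrt (2 ^ k)"
    using assms by (simp add: L2_set_def cong: sum.cong)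
  then have "avg_bits k (\<lambda>v. sqrt (f v)) \<le> sqrt (\<Sum>v\<in>bits k. f v) * sqrt (2 ^ k) / 2 ^ k"
    unfolding avg_bits_def by (intro divide_right_mono) auto
  also have "\<dots> = sqrt (avg_bits k f)"
  proof -
    have "(2::real) ^ k = sqrt (2 ^ k) * sqrt (2 ^ k)" by simp
    then show ?thesis by (simp add: avg_bits_def real_sqrt_divide field_simps)
  qed
  finally show ?thesis .
qed

lemma avg_bits_sum: "avg_bits k (\<lambda>v. \<Sum>i\<in>S. f i v) = (\<Sum>i\<in>S. avg_bits k (f i))"
  unfolding avg_bits_def by (subst sum.swap) (simp add: sum_divide_distrib)

section \<open>Error probability of the decoder\<close>

context cq_channel
begin

abbreviation sqrt_diff :: "nat \<Rightarrow> bool list \<Rightarrow> complex mat" where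
  "sqrt_diff n v \<equiv> msqrt (rb n (v @ [False])) - msqrt (rb n (v @ [True]))"

text \<open>\<open>Q\<close> reads only the first \<open>i\<close> bits, so by linearity of the
  trace the average over the remaining bits falls on the state alone, where it produces
  \<open>rb n v\<close>.\<close>

lemma avg_bits_comb:
  assumes "i \<le> 2 ^ n" "\<And>v. v \<in> bits i \<Longrightarrow> Q v \<in> carrier_mat (dm n) (dm n)"
  shows "avg_bits (2 ^ n) (\<lambda>u. Re (mtrace (Q (take i u) * comb \<rho> n u))) = avg_bits i (\<lambda>v. Re (mtrace (Q v * rb n v)))"
proof -
  obtain m where m: "i + m = 2 ^ n" using le_Suc_ex[OF assms(1)] by auto
  have tr: "(\<Sum>w\<in>bits m. Re (mtrace (Q v * comb \<rho> n (v @ w)))) = 2 ^ m * Re (mtrace (Q v * rb n v))"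
    if v: "v \<in> bits i" for v
  proof -
    have e: "mtrace (Q v * X) = (\<Sum>a<dm n. \<Sum>b<dm n. Q v $$ (a,b) * X $$ (b,a))" if "X \<in> carrier_mat (dm n) (dm n)" for X
      using assms(2)[OF v] that
      by (auto simp: mtrace_def mult_index[of _ "dm n" "dm n" _ "dm n"] simp del: index_mult_mat(1) intro!: sum.cong)
    have l: "length v + m = 2 ^ n" using v m by (simp add: bits_def)
    have "mtrace (Q v * rb n v) = (\<Sum>a<dm n. \<Sum>b<dm n. \<Sum>w\<in>bits m. Q v $$ (a,b) * comb \<rho> n (v @ w) $$ (b,a) / 2 ^ m)"
      unfolding e[OF rb_carrier] by (intro sum.cong refl) (simp add: rb_index[OF l] sum_distrib_left sum_divide_distrib)
    also have "\<dots> = (\<Sum>a<dm n. \<Sum>w\<in>bits m. \<Sum>b<dm n. Q v $$ (a,b) * comb \<rho> n (v @ w) $$ (b,a) / 2 ^ m)"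
      by (intro sum.cong refl sum.swap)
    also have "\<dots> = (\<Sum>w\<in>bits m. \<Sum>a<dm n. \<Sum>b<dm n. Q v $$ (a,b) * comb \<rho> n (v @ w) $$ (b,a) / 2 ^ m)"
      by (rule sum.swap)
    also have "\<dots> = (\<Sum>w\<in>bits m. mtrace (Q v * comb \<rho> n (v @ w))) / 2 ^ m"
      by (simp only: e[OF comb_carrier] sum_divide_distrib)
    finally have "of_real (2 ^ m) * mtrace (Q v * rb n v) = (\<Sum>w\<in>bits m. mtrace (Q v * comb \<rho> n (v @ w)))" by simp
    then have "Re (of_real (2 ^ m) * mtrace (Q v * rb n v)) = (\<Sum>w\<in>bits m. Re (mtrace (Q v * comb \<rho> n (v @ w))))" by simp
    then show ?thesis by (simp only: Re_complex_of_real times_complex.sel Im_complex_of_real mult_zero_left diff_zero)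
  qed
  have "(\<Sum>u\<in>bits (2 ^ n). Re (mtrace (Q (take i u) * comb \<rho> n u))) =
    (\<Sum>v\<in>bits i. \<Sum>w\<in>bits m. Re (mtrace (Q (take i (v @ w)) * comb \<rho> n (v @ w))))"
    unfolding m[symmetric] by (rule sum_bits_append)
  also have "\<dots> = (\<Sum>v\<in>bits i. \<Sum>w\<in>bits m. Re (mtrace (Q v * comb \<rho> n (v @ w))))"
    by (intro sum.cong refl) (simp add: bits_def)
  also have "\<dots> = (\<Sum>v\<in>bits i. 2 ^ m * Re (mtrace (Q v * rb n v)))" by (intro sum.cong refl tr)
  finally show ?thesis by (simp add: avg_bits_def m[symmetric] power_add sum_distrib_left[symmetric])
qed

lemma sqrt_diff_spec:
  assumes "length v < 2 ^ n"
  obtains U l where "spec (dm n) U l (sqrt_diff n v)"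
proof -
  have s: "psd (dm n) (msqrt (rb n (v @ [b])))" for b
    by (rule msqrt_psd(1)[OF rb_state(1)]) (use assms in simp)
  have "sqrt_diff n v \<in> carrier_mat (dm n) (dm n)"
    "adj (sqrt_diff n v) = sqrt_diff n v"
    using psdD(1)[OF s] psdD(2)[OF s] by (auto simp: adj_minus[of _ "dm n" "dm n"] minus_carrier_mat)
  then show ?thesis using hermitian_spec that by blast
qed

lemma nonneg_proj_spec:
  "spec D U l H \<Longrightarrow> spec D U (\<lambda>i. if 0 \<le> l i then 1 else 0) (nonneg_proj H)"
  unfolding nonneg_proj_def by (rule spec_mfun)

lemma dec_projector:
  assumes "i \<in> {1..2 ^ n}"
  shows "projector (dm n) (dec_proj \<rho> d n A u i)"
proof (cases "i \<in> A")
  case True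
  define v where "v = take (i - 1) u"
  have "length v < 2 ^ n" using assms by (auto simp: v_def)
  then obtain U l where U: "spec (dm n) U l (sqrt_diff n v)"
    by (rule sqrt_diff_spec)
  have "projector (dm n) (nonneg_proj (sqrt_diff n v))"
    by (rule spec_projector[OF nonneg_proj_spec[OF U]]) auto
  then show ?thesis using True projector_compl by (simp add: dec_proj_def v_def Let_def)
qed (simp add: dec_proj_def projector_one)

text \<open>The projectors condition on the true bits up to position \<open>i\<close>, so
  \<open>avg_bits_comb\<close> can average out the later ones.\<close>

lemma dec_proj_take: "1 \<le> i \<Longrightarrow> dec_proj \<rho> d n A (take i u) i = dec_proj \<rho> d n A u i"
  by (simp add: dec_proj_def min_def)

text \<open>Averaging over the two values of bit \<open>Suc k\<close> yields half the total error of
  the square-root test between the two averaged states. This is at most half their overlap, and the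
  overlap averages to at most the root fidelity.\<close>

lemma decoder_error:
  assumes "Suc k \<in> A" "k < 2 ^ n"
  shows "avg_bits (2 ^ n) (\<lambda>u. Re (mtrace ((1\<^sub>m (dm n) - dec_proj \<rho> d n A u (Suc k)) * comb \<rho> n u))) \<le> sqfid n (Suc k) / 2"
proof -
  have i: "Suc k \<in> {1..2 ^ n}" using assms by auto
  let ?Q = "\<lambda>v. 1\<^sub>m (dm n) - dec_proj \<rho> d n A v (Suc k)"
  have cQ: "?Q v \<in> carrier_mat (dm n) (dm n)" for v
    using projectorD(1)[OF projector_compl[OF dec_projector[OF i]]] .
  have "avg_bits (2 ^ n) (\<lambda>u. Re (mtrace (?Q u * comb \<rho> n u))) = avg_bits (2 ^ n) (\<lambda>u. Re (mtrace (?Q (take (Suc k) u) * comb \<rho> n u)))"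
    by (simp add: dec_proj_take)
  also have "\<dots> = avg_bits (Suc k) (\<lambda>v. Re (mtrace (?Q v * rb n v)))"
    by (rule avg_bits_comb) (use assms cQ in auto)
  also have "\<dots> = avg_bits k (\<lambda>v. (Re (mtrace (?Q (v @ [False]) * rb n (v @ [False]))) + Re (mtrace (?Q (v @ [True]) * rb n (v @ [True])))) / 2)"
    by (rule avg_bits_snoc)
  also have "\<dots> \<le> avg_bits k (\<lambda>v. sqrt_overlap n v / 2)"
  proof (intro avg_bits_mono divide_right_mono)
    fix v assume v: "v \<in> bits k"
    then have lv: "length v = k" by (simp add: bits_def)
    have st: "psd (dm n) (rb n (v @ [b]))" for b by (rule rb_state) (use lv assms in simp)
    obtain U l where U: "spec (dm n) U l (sqrt_diff n v)"
      using sqrt_diff_spec[of v n] lv assms by auto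
    define P where "P = nonneg_proj (sqrt_diff n v)"
    note SP = nonneg_proj_spec[OF U, folded P_def]
    note cP = specD(4)[OF SP]
    \<comment> \<open>Outcome \<open>P\<close> decides for bit 0, so the erroneous projector is
      \<open>1 - P\<close> when 0 was sent and \<open>P\<close> when 1 was sent.\<close>
    have Q0: "?Q (v @ [False]) = 1\<^sub>m (dm n) - P" and Q1: "?Q (v @ [True]) = P"
      using assms lv cP by (simp_all add: dec_proj_def Let_def P_def[symmetric] nth_append) (intro eq_matI, auto)
    have "Re (mtrace ((1\<^sub>m (dm n) - P) * rb n (v @ [False]))) = (\<Sum>j<dm n. (1 - (if 0 \<le> l j then 1 else 0)) * mprob (dm n) U (rb n (v @ [False])) j)"
      using mtrace_spec_mult[OF spec_one_minus[OF SP] rb_carrier]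
        mtrace_comm[of "1\<^sub>m (dm n) - P" "dm n" "dm n" "rb n (v @ [False])"] cP by (simp add: minus_carrier_mat)
    moreover have "Re (mtrace (P * rb n (v @ [True]))) = (\<Sum>j<dm n. (if 0 \<le> l j then 1 else 0) * mprob (dm n) U (rb n (v @ [True])) j)"
      using mtrace_spec_mult[OF SP rb_carrier] mtrace_comm[OF cP rb_carrier] by simp
    ultimately have "Re (mtrace (?Q (v @ [False]) * rb n (v @ [False]))) + Re (mtrace (?Q (v @ [True]) * rb n (v @ [True])))
       = (\<Sum>j<dm n. if 0 \<le> l j then mprob (dm n) U (rb n (v @ [True])) j else mprob (dm n) U (rb n (v @ [False])) j)"
      unfolding Q0 Q1 by (simp only: sum.distrib[symmetric]) (intro sum.cong, auto)
    then show "Re (mtrace (?Q (v @ [False]) * rb n (v @ [False]))) + Re (mtrace (?Q (v @ [True]) * rb n (v @ [True])))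
      \<le> sqrt_overlap n v"
      using sqrt_test_error[OF st st U] by simp
  qed simp
  also have "\<dots> = avg_bits k (\<lambda>v. sqrt_overlap n v) / 2"
    using avg_bits_cmult_right[of k _ "1/2"] by simp
  also have "\<dots> \<le> sqfid n (Suc k) / 2" using sqfid_ge[OF assms(2)] by simp
  finally show ?thesis .
qed

text \<open>The telescoped error is averaged over the input words, and Jensen moves the average
  under each square root. Frozen positions carry the identity projector and contribute 0.\<close>

lemma Pe_bounds:
  assumes "A \<subseteq> {1..2 ^ n}"
  shows "0 \<le> Pe \<rho> d n A" "Pe \<rho> d n A \<le> 2 * (\<Sum>i\<in>A. sqrt (sqfid n i / 2))"
proof -
  let ?P = "\<lambda>u. dec_proj \<rho> d n A u"
  let ?e = "\<lambda>u i. Re (mtrace ((1\<^sub>m (dm n) - ?P u i) * comb \<rho> n u))"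
  define p where "p u = Re (mtrace (foldl (\<lambda>M i. ?P u i * M) (1\<^sub>m (dm n)) [1..<2^n+1] * comb \<rho> n u
     * foldl (\<lambda>M i. M * ?P u i) (1\<^sub>m (dm n)) [1..<2^n+1]))" for u
  have Pe: "Pe \<rho> d n A = avg_bits (2 ^ n) (\<lambda>u. 1 - p u)"
    unfolding avg_bits_diff by (simp add: Pe_def p_def avg_bits_def)
  have pr: "projector (dm n) (?P u i)" if "i \<in> set [1..<2^n+1]" for u i
    by (rule dec_projector) (use that in auto)
  have p1: "p u \<le> 1" and p2: "1 - p u \<le> 2 * (\<Sum>i\<leftarrow>[1..<2^n+1]. sqrt (?e u i))" for u
    unfolding p_def using sequential_projections_error[of "[1..<2^n+1]" "dm n" "?P u" "comb \<rho> n u"] pr comb_state[of n u] by blast+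
  show "0 \<le> Pe \<rho> d n A" unfolding Pe by (rule avg_bits_nonneg) (use p1 in simp)
  have e0: "?e u i = 0" if "i \<notin> A" for u i
  proof -
    have "(1\<^sub>m (dm n) - 1\<^sub>m (dm n)) * comb \<rho> n u = 0\<^sub>m (dm n) (dm n)"
      by (subst minus_r_inv_mat[of _ "dm n" "dm n"]) (auto intro: left_mult_zero_mat[OF comb_carrier])
    then show ?thesis using that by (simp add: dec_proj_def mtrace_def)
  qed
  have fin: "finite A" using assms finite_subset by blast
  have p3: "1 - p u \<le> 2 * (\<Sum>i\<in>A. sqrt (?e u i))" for u
  proof -
    have "(\<Sum>i\<leftarrow>[1..<2^n+1]. sqrt (?e u i)) = (\<Sum>i\<in>{1..<2^n+1}. sqrt (?e u i))"
      by (simp only: interv_sum_list_conv_sum_set_nat set_upt)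
    also have "\<dots> = (\<Sum>i\<in>A. sqrt (?e u i))"
      by (rule sum.mono_neutral_right) (use assms e0 in auto)
    finally show ?thesis using p2[of u] by simp
  qed
  have "Pe \<rho> d n A \<le> avg_bits (2 ^ n) (\<lambda>u. 2 * (\<Sum>i\<in>A. sqrt (?e u i)))"
    unfolding Pe by (rule avg_bits_mono) (rule p3)
  also have "\<dots> = 2 * (\<Sum>i\<in>A. avg_bits (2 ^ n) (\<lambda>u. sqrt (?e u i)))"
    unfolding avg_bits_cmult avg_bits_sum ..
  also have "\<dots> \<le> 2 * (\<Sum>i\<in>A. sqrt (sqfid n i / 2))"
  proof (intro mult_left_mono sum_mono)
    fix i assume i: "i \<in> A"
    then obtain k where k: "i = Suc k" "k < 2 ^ n" using assms by (cases i) auto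
    have "avg_bits (2 ^ n) (\<lambda>u. sqrt (?e u i)) \<le> sqrt (avg_bits (2 ^ n) (\<lambda>u. ?e u i))"
    proof (rule avg_bits_sqrt_le)
      fix u
      have "projector (dm n) (?P u i)" by (rule dec_projector) (use i assms in auto)
      then show "0 \<le> ?e u i" using projector_trace_nonneg projector_compl comb_state by blast
    qed
    also have "\<dots> \<le> sqrt (sqfid n i / 2)" using decoder_error[of k A n] i k by simp
    finally show "avg_bits (2 ^ n) (\<lambda>u. sqrt (?e u i)) \<le> sqrt (sqfid n i / 2)" .
  qed simp
  finally show "Pe \<rho> d n A \<le> 2 * (\<Sum>i\<in>A. sqrt (sqfid n i / 2))" .
qed

end

section \<open>Polarization and its rate\<close>

lemma sum_double_index: "(\<Sum>i<2 ^ Suc n. f i) = (\<Sum>k<(2::nat) ^ n. f (2 * k) + f (Suc (2 * k)))"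
proof -
  have "(\<Sum>k<N. f (2 * k) + f (Suc (2 * k))) = (\<Sum>i<2 * N. f i)" for N :: nat
    by (induction N) (simp_all add: add.assoc)
  then show ?thesis by simp
qed

text \<open>As \<open>y\<close> grows the expression tends to \<open>f s\<close>, where
  \<open>f 0 = 1\<close> and \<open>f\<close> has slope \<open>ln 2 * (2 * \<beta> - 1) / 2\<close>
  at 0, negative exactly when \<open>\<beta> < 1 / 2\<close>. A small \<open>s\<close> thus brings
  the limit below 1, and a large finite \<open>y\<close> keeps the expression there.\<close>

lemma exists_exponent:
  assumes "\<beta> < 1 / 2"
  shows "\<exists>s>0. \<exists>y>1. 2 powr (\<beta> * s) * ((2 powr (-s) + (1 - 1 / y) powr (-s)) / 2) < (1::real)"
proof -
  define f where "f s = (2 powr (\<beta> * s) * 2 powr (- s) + 2 powr (\<beta> * s)) / 2" for s :: real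
  have "(f has_real_derivative (ln 2 * (2 * \<beta> - 1) / 2)) (at 0)"
    unfolding f_def by (auto intro!: derivative_eq_intros simp: field_simps)
  moreover have "ln 2 * (2 * \<beta> - 1) / 2 < 0" using assms by (simp add: mult_pos_neg)
  ultimately obtain e where e: "0 < e" "\<And>h. 0 < h \<Longrightarrow> h < e \<Longrightarrow> f (0 + h) < f 0"
    using DERIV_neg_dec_right by blast
  define s where "s = e / 2"
  have s: "0 < s" "f s < 1" using e(1) e(2)[of s] by (simp_all add: s_def f_def)
  have "((\<lambda>y::real. 1 - 1 / y) \<longlongrightarrow> 1) at_top" by real_asymp
  then have L: "((\<lambda>y::real. (1 - 1 / y) powr (-s)) \<longlongrightarrow> 1 powr (-s)) at_top"
    by (intro tendsto_powr tendsto_const) auto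
  have "((\<lambda>y::real. 2 powr (\<beta> * s) * ((2 powr (-s) + (1 - 1 / y) powr (-s)) / 2))
      \<longlongrightarrow> 2 powr (\<beta> * s) * ((2 powr (-s) + 1 powr (-s)) / 2)) at_top"
    by (intro tendsto_mult tendsto_divide tendsto_add tendsto_const L) simp
  moreover have "2 powr (\<beta> * s) * ((2 powr (-s) + 1 powr (-s)) / 2) = f s"
    by (simp add: f_def algebra_simps)
  ultimately have "eventually (\<lambda>y::real. 2 powr (\<beta> * s) * ((2 powr (-s) + (1 - 1 / y) powr (-s)) / 2) < 1) at_top"
    using s(2) by (auto dest: order_tendstoD(2))
  then have "eventually (\<lambda>y::real. 2 powr (\<beta> * s) * ((2 powr (-s) + (1 - 1 / y) powr (-s)) / 2) < 1 \<and> 1 < y) at_top"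
    using eventually_gt_at_top[of 1] by (rule eventually_conj)
  then obtain y :: real where "2 powr (\<beta> * s) * ((2 powr (-s) + (1 - 1 / y) powr (-s)) / 2) < 1" "1 < y"
    by (auto dest: eventually_happens)
  then show ?thesis using s(1) by blast
qed

text \<open>Isolates the one-step bounds from their quantum origin. Level \<open>n\<close> is viewed
  as the \<open>2 ^ n\<close> nodes of a binary tree in which \<open>i\<close> has the children
  \<open>2 * i\<close> and \<open>Suc (2 * i)\<close>; fractions of nodes replace
  probabilities.\<close>

locale polarization =
  fixes Z :: "nat \<Rightarrow> nat \<Rightarrow> real"
  assumes Z_nonneg: "i < 2 ^ n \<Longrightarrow> 0 \<le> Z n i"
    and Z_le_1: "i < 2 ^ n \<Longrightarrow> Z n i \<le> 1"
    and Z_plus: "i < 2 ^ n \<Longrightarrow> Z (Suc n) (Suc (2 * i)) \<le> (Z n i)\<^sup>2"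
    and Z_minus: "i < 2 ^ n \<Longrightarrow> Z (Suc n) (2 * i) \<le> 2 * Z n i - (Z n i)\<^sup>2"
begin

abbreviation mid :: "real \<Rightarrow> real \<Rightarrow> nat \<Rightarrow> nat \<Rightarrow> bool" where
  "mid \<epsilon> \<eta> n i \<equiv> \<epsilon> \<le> Z n i \<and> Z n i \<le> 1 - \<eta>"

text \<open>The descendants of node \<open>i\<close> after \<open>k\<close> further levels.\<close>

abbreviation leaves :: "nat \<Rightarrow> nat \<Rightarrow> nat set" where
  "leaves k i \<equiv> {i * 2 ^ k..<i * 2 ^ k + 2 ^ k}"

text \<open>Since \<open>2 z - z^2 = z (2 - z)\<close>, the left side is \<open>sqrt z\<close> times
  \<open>sqrt z + sqrt (2 - z)\<close>, and the second factor is below 2 unless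
  \<open>z = 1\<close>. The gap is positive on intermediate values because \<eta> keeps
  \<open>z\<close> away from 1 and \<epsilon> keeps \<open>sqrt z\<close> away from 0.\<close>

lemma gap_nonneg:
  assumes "0 \<le> z" "z \<le> (1::real)"
  shows "z + sqrt (2 * z - z\<^sup>2) \<le> 2 * sqrt z"
    and "\<lbrakk>\<epsilon> \<le> z; z \<le> 1 - \<eta>; 0 < \<epsilon>; 0 \<le> \<eta>\<rbrakk> \<Longrightarrow>
      z + sqrt (2 * z - z\<^sup>2) \<le> 2 * sqrt z - sqrt \<epsilon> * (2 - sqrt (2 + 2 * sqrt (1 - \<eta>\<^sup>2)))"
proof -
  have eq: "z + sqrt (2 * z - z\<^sup>2) = sqrt z * sqrt (2 + 2 * sqrt (1 - (1 - z)\<^sup>2))"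
  proof -
    have "2 * z - z\<^sup>2 = z * (2 - z)" by (simp add: power2_eq_square algebra_simps)
    then have 1: "z + sqrt (2 * z - z\<^sup>2) = sqrt z * (sqrt z + sqrt (2 - z))"
      using assms by (simp add: real_sqrt_mult distrib_left)
    have "(sqrt z + sqrt (2 - z))\<^sup>2 = 2 + 2 * sqrt (z * (2 - z))"
      using assms by (simp add: power2_sum real_sqrt_mult)
    also have "z * (2 - z) = 1 - (1 - z)\<^sup>2" by (simp add: power2_eq_square algebra_simps)
    finally have "sqrt z + sqrt (2 - z) = sqrt (2 + 2 * sqrt (1 - (1 - z)\<^sup>2))"
      using assms by (metis add_nonneg_nonneg diff_ge_0_iff_ge real_sqrt_ge_zero real_sqrt_unique order.trans one_le_numeral)
    then show ?thesis using 1 by simp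
  qed
  have le2: "sqrt (2 + 2 * sqrt (1 - x\<^sup>2)) \<le> 2" for x :: real
    by (intro real_le_lsqrt) auto
  show "z + sqrt (2 * z - z\<^sup>2) \<le> 2 * sqrt z"
    unfolding eq using mult_left_mono[OF le2[of "1 - z"], of "sqrt z"] assms by (simp add: mult.commute)
  assume h: "\<epsilon> \<le> z" "z \<le> 1 - \<eta>" "0 < \<epsilon>" "0 \<le> \<eta>"
  have "\<eta>\<^sup>2 \<le> (1 - z)\<^sup>2" using h by (intro power_mono) auto
  then have "sqrt z * sqrt (2 + 2 * sqrt (1 - (1 - z)\<^sup>2)) \<le> sqrt z * sqrt (2 + 2 * sqrt (1 - \<eta>\<^sup>2))"
    using assms by (intro mult_left_mono) auto
  also have "\<dots> = 2 * sqrt z - sqrt z * (2 - sqrt (2 + 2 * sqrt (1 - \<eta>\<^sup>2)))" by (simp add: algebra_simps)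
  also have "\<dots> \<le> 2 * sqrt z - sqrt \<epsilon> * (2 - sqrt (2 + 2 * sqrt (1 - \<eta>\<^sup>2)))"
    using h le2[of \<eta>] by (intro diff_left_mono mult_right_mono) auto
  finally show "z + sqrt (2 * z - z\<^sup>2) \<le> 2 * sqrt z - sqrt \<epsilon> * (2 - sqrt (2 + 2 * sqrt (1 - \<eta>\<^sup>2)))"
    unfolding eq .
qed

text \<open>By contradiction: if at every level more than a fraction \<delta> were intermediate, the
  mean \<open>S n\<close> of the square roots would drop by at least \<open>c * \<delta> / 2\<close>
  per level and become negative.\<close>

lemma few_intermediate:
  fixes \<epsilon> \<eta> \<delta> :: real
  assumes "0 < \<epsilon>" "0 < \<eta>" "0 < \<delta>"
  shows "\<exists>n. (\<Sum>i<2 ^ n. of_bool (mid \<epsilon> \<eta> n i)) \<le> \<delta> * 2 ^ n"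
proof (rule ccontr)
  assume "\<not> ?thesis"
  then have neg: "\<delta> * 2 ^ n < (\<Sum>i<2 ^ n. of_bool (mid \<epsilon> \<eta> n i))" for n by (simp add: not_le)
  define c where "c = sqrt \<epsilon> * (2 - sqrt (2 + 2 * sqrt (1 - \<eta>\<^sup>2)))"
  have "sqrt (1 - \<eta>\<^sup>2) < 1" using assms by simp
  then have "sqrt (2 + 2 * sqrt (1 - \<eta>\<^sup>2)) < sqrt 4" by (intro real_sqrt_less_mono) linarith
  then have c: "0 < c" using assms by (simp add: c_def)
  define S where "S n = (\<Sum>i<2 ^ n. sqrt (Z n i)) / 2 ^ n" for n
  have step: "S (Suc n) \<le> S n - c * \<delta> / 2" for n
  proof -
    have pt: "sqrt (Z (Suc n) (2 * k)) + sqrt (Z (Suc n) (Suc (2 * k)))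
        \<le> 2 * sqrt (Z n k) - c * of_bool (mid \<epsilon> \<eta> n k)" if k: "k < 2 ^ n" for k
    proof -
      have "sqrt (Z (Suc n) (2 * k)) \<le> sqrt (2 * Z n k - (Z n k)\<^sup>2)" using Z_minus[OF k] by simp
      moreover have "sqrt (Z (Suc n) (Suc (2 * k))) \<le> Z n k"
        using Z_plus[OF k] Z_nonneg[OF k] by (intro real_le_lsqrt) auto
      ultimately have calc: "sqrt (Z (Suc n) (2 * k)) + sqrt (Z (Suc n) (Suc (2 * k)))
          \<le> Z n k + sqrt (2 * Z n k - (Z n k)\<^sup>2)" by linarith
      show ?thesis
      proof (cases "mid \<epsilon> \<eta> n k")
        case True
        then show ?thesis
          using gap_nonneg(2)[OF Z_nonneg[OF k] Z_le_1[OF k], of \<epsilon> \<eta>, folded c_def] assms True calc by simp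
      next
        case False
        then have "c * of_bool (mid \<epsilon> \<eta> n k) = 0" by (simp only: of_bool_eq mult_zero_right)
        then show ?thesis
          using gap_nonneg(1)[OF Z_nonneg[OF k] Z_le_1[OF k]] calc by linarith
      qed
    qed
    have "(\<Sum>i<2 ^ Suc n. sqrt (Z (Suc n) i)) = (\<Sum>k<2 ^ n. sqrt (Z (Suc n) (2 * k)) + sqrt (Z (Suc n) (Suc (2 * k))))"
      by (rule sum_double_index)
    also have "\<dots> \<le> (\<Sum>k<2 ^ n. 2 * sqrt (Z n k) - c * of_bool (mid \<epsilon> \<eta> n k))"
      by (intro sum_mono pt) auto
    also have "\<dots> = 2 * (\<Sum>k<2 ^ n. sqrt (Z n k)) - c * (\<Sum>k<2 ^ n. of_bool (mid \<epsilon> \<eta> n k))"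
      by (simp add: sum_subtractf sum_distrib_left)
    also have "\<dots> \<le> 2 * (\<Sum>k<2 ^ n. sqrt (Z n k)) - c * (\<delta> * 2 ^ n)"
      using c neg[of n] by (intro diff_left_mono mult_left_mono) auto
    finally have "(\<Sum>i<2 ^ Suc n. sqrt (Z (Suc n) i)) / 2 ^ Suc n
        \<le> (2 * (\<Sum>k<2 ^ n. sqrt (Z n k)) - c * (\<delta> * 2 ^ n)) / 2 ^ Suc n"
      by (rule divide_right_mono) simp
    also have "\<dots> = S n - c * \<delta> / 2" by (simp add: S_def diff_divide_distrib)
    finally show ?thesis by (simp add: S_def)
  qed
  have "S n \<le> S 0 - n * (c * \<delta> / 2)" for n
  proof (induction n)
    case (Suc n)
    then show ?case using step[of n] by (simp add: algebra_simps add_divide_distrib)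
  qed simp
  moreover have "0 \<le> S n" for n unfolding S_def by (intro divide_nonneg_nonneg sum_nonneg) (auto simp: Z_nonneg)
  moreover obtain n :: nat where "S 0 < n * (c * \<delta> / 2)"
    using reals_Archimedean3[of "c * \<delta> / 2"] c assms by auto
  ultimately show False by (smt (verit))
qed

text \<open>The potential is \<open>y powr (-s)\<close> for a lower bound \<open>y\<close> on
  \<open>- log 2 Z\<close>. The plus branch doubles \<open>y\<close> and the minus branch lowers it
  by 1, so the mean potential contracts by \<kappa> as long as \<open>y \<ge> y0\<close>. The term
  \<open>y0 powr s\<close> pays for paths that fall below \<open>y0\<close>, the term with
  \<open>\<kappa> ^ k\<close> for paths that stay above it but do not reach
  \<open>t\<close>.\<close>

lemma few_slow_descendants:
  fixes s y0 y t \<kappa> :: real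
  assumes s: "0 < s" and y0: "1 < y0" and t: "0 \<le> t"
    and lam: "\<kappa> = (2 powr (-s) + (1 - 1 / y0) powr (-s)) / 2" "\<kappa> \<le> 1"
  shows "\<lbrakk>i < 2 ^ n; y0 \<le> y; Z n i \<le> 2 powr (-y)\<rbrakk> \<Longrightarrow>
    (\<Sum>j\<in>leaves k i. of_bool (2 powr (-t) < Z (n + k) j))
      \<le> 2 ^ k * ((y0 powr s + \<kappa> ^ k * t powr s) * y powr (-s))"
proof (induction k arbitrary: n i y)
  case 0
  have yp: "0 < y" using 0 y0 by simp
  show ?case
  proof (cases "2 powr (-t) < Z n i")
    case True
    then have "2 powr (-t) < 2 powr (-y)" using 0 by linarith
    then have "y < t" by simp
    then have "y powr s \<le> t powr s" using yp s by (intro powr_mono2) auto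
    then have "1 \<le> t powr s * y powr (-s)" using yp by (simp add: powr_minus field_simps)
    moreover have "0 \<le> y0 powr s * y powr (-s)" by simp
    ultimately have "1 \<le> y0 powr s * y powr (-s) + t powr s * y powr (-s)" by linarith
    then show ?thesis using True by (simp add: distrib_right)
  next
    case False
    then show ?thesis by simp
  qed
next
  case (Suc k)
  define C where "C = y0 powr s + \<kappa> ^ k * t powr s"
  have l0: "0 \<le> \<kappa>" unfolding lam(1) by simp
  have C0: "0 \<le> C" using l0 by (simp add: C_def)
  have yp: "1 < y" using Suc y0 by simp
  note z = Z_nonneg[OF Suc.prems(1)]
  let ?b = "\<lambda>j. of_bool (2 powr (-t) < Z (Suc n + k) j) :: real"
  have split: "leaves (Suc k) i
     = leaves k (2 * i) \<union> leaves k (Suc (2 * i))"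
    by (auto simp: algebra_simps)
  have "(\<Sum>j\<in>leaves (Suc k) i. of_bool (2 powr (-t) < Z (n + Suc k) j))
     = (\<Sum>j\<in>leaves k (2 * i). ?b j)
      + (\<Sum>j\<in>leaves k (Suc (2 * i)). ?b j)"
    unfolding split by (subst sum.union_disjoint) auto
  moreover have "(\<Sum>j\<in>leaves k (Suc (2 * i)). ?b j) \<le> 2 ^ k * (C * (2 powr (-s) * y powr (-s)))"
  proof -
    have "(Z n i)\<^sup>2 \<le> (2 powr (-y))\<^sup>2" using Suc.prems(3) z by (intro power_mono) auto
    also have "\<dots> = 2 powr (-(2 * y))" by (simp add: powr_add[symmetric] power2_eq_square)
    finally have "Z (Suc n) (Suc (2 * i)) \<le> 2 powr (-(2 * y))" using Z_plus[OF Suc.prems(1)] by linarith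
    then have "(\<Sum>j\<in>leaves k (Suc (2 * i)). ?b j) \<le> 2 ^ k * (C * (2 * y) powr (-s))"
      unfolding C_def using Suc.prems yp by (intro Suc.IH) auto
    then show ?thesis using yp by (simp add: powr_mult)
  qed
  moreover have "(\<Sum>j\<in>leaves k (2 * i). ?b j) \<le> 2 ^ k * (C * ((1 - 1 / y0) powr (-s) * y powr (-s)))"
  proof -
    have "(\<Sum>j\<in>leaves k (2 * i). ?b j) \<le> 2 ^ k * (C * (y - 1) powr (-s))"
    proof (cases "y0 \<le> y - 1")
      case True
      have "Z (Suc n) (2 * i) \<le> 2 * Z n i" using Z_minus[OF Suc.prems(1)] zero_le_power2[of "Z n i"] by linarith
      also have "\<dots> \<le> 2 powr 1 * 2 powr (-y)" using Suc.prems(3) by simp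
      also have "\<dots> = 2 powr (-(y - 1))" unfolding powr_add[symmetric] by simp
      finally show ?thesis unfolding C_def using Suc.prems True by (intro Suc.IH) auto
    next
      case False
      \<comment> \<open>Below \<open>y0\<close> the induction hypothesis does not apply, but there
        the claimed bound is already at least the number of all leaves.\<close>
      have "(y - 1) powr s \<le> y0 powr s" using False yp s by (intro powr_mono2) auto
      also have "\<dots> \<le> C" using l0 by (simp add: C_def)
      finally have "1 \<le> C * (y - 1) powr (-s)" using yp by (simp add: powr_minus field_simps)
      then have "2 ^ k * 1 \<le> 2 ^ k * (C * (y - 1) powr (-s))" by (rule mult_left_mono) simp
      moreover have "(\<Sum>j\<in>leaves k (2 * i). ?b j) \<le> (\<Sum>j\<in>leaves k (2 * i). 1)"
        by (intro sum_mono) auto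
      moreover have "(\<Sum>j\<in>leaves k (2 * i). 1 :: real) = 2 ^ k * 1" by simp
      ultimately show ?thesis by linarith
    qed
    also have "(y - 1) powr (-s) = (1 - 1 / y) powr (-s) * y powr (-s)"
    proof -
      have "(1 - 1 / y) * y = y - 1" using yp by (simp add: field_simps)
      then show ?thesis using powr_mult[of "1 - 1 / y" y "-s"] yp by simp
    qed
    also have "2 ^ k * (C * ((1 - 1 / y) powr (-s) * y powr (-s))) \<le> 2 ^ k * (C * ((1 - 1 / y0) powr (-s) * y powr (-s)))"
    proof -
      have "1 - 1 / y0 \<le> 1 - 1 / y" using Suc.prems(2) y0 by (simp add: frac_le)
      then have "(1 - 1 / y) powr (-s) \<le> (1 - 1 / y0) powr (-s)"
        using y0 s by (intro powr_mono2') auto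
      then show ?thesis using C0 by (intro mult_left_mono mult_right_mono) auto
    qed
    finally show ?thesis .
  qed
  ultimately have "(\<Sum>j\<in>leaves (Suc k) i. of_bool (2 powr (-t) < Z (n + Suc k) j))
     \<le> 2 ^ k * (C * (2 powr (-s) * y powr (-s))) + 2 ^ k * (C * ((1 - 1 / y0) powr (-s) * y powr (-s)))" by linarith
  also have "\<dots> = 2 ^ Suc k * (\<kappa> * C * y powr (-s))" unfolding lam(1) by (simp add: field_simps)
  also have "\<kappa> * C \<le> y0 powr s + \<kappa> ^ Suc k * t powr s"
    unfolding C_def using mult_right_mono[OF lam(2), of "y0 powr s"] by (simp add: distrib_left mult.assoc)
  finally show ?case by (simp add: mult_right_mono mult_left_mono)
qed

text \<open>\<open>good\<close> supplies one fixed level \<open>m\<close> with enough good nodes;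
  letting only \<open>k\<close> grow then reaches every large level \<open>m + k\<close>. The
  contraction \<kappa> beats the growth of \<open>t powr s\<close>, so for large \<open>k\<close>
  all but a fraction \<open>2 * \<tau>\<close> of the descendants of each good node meet the
  target.\<close>

lemma polarization_rate:
  fixes I \<beta> R :: real
  assumes good: "\<And>\<epsilon> \<tau>. 0 < \<epsilon> \<Longrightarrow> 0 < \<tau> \<Longrightarrow> \<exists>n. (I - \<tau>) * 2 ^ n \<le> (\<Sum>i<2 ^ n. of_bool (Z n i \<le> \<epsilon>))"
    and I: "R < I" "I \<le> 1" and beta: "0 \<le> \<beta>" "\<beta> < 1 / 2"
  shows "eventually (\<lambda>n. R * 2 ^ n \<le> (\<Sum>i<2 ^ n. of_bool (Z n i \<le> 2 powr (- (2 powr (\<beta> * n)))))) sequentially"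
proof -
  obtain s y0 where s: "0 < s" and y0: "1 < y0"
    and lt: "2 powr (\<beta> * s) * ((2 powr (-s) + (1 - 1 / y0) powr (-s)) / 2) < (1::real)"
    using exists_exponent[OF beta(2)] by blast
  define \<kappa> where "\<kappa> = (2 powr (-s) + (1 - 1 / y0) powr (-s)) / 2"
  have l0: "0 \<le> \<kappa>" by (simp add: \<kappa>_def)
  have ge1: "1 \<le> 2 powr (\<beta> * s)" using beta s by (simp add: ge_one_powr_ge_zero)
  have l1: "\<kappa> \<le> 1" using mult_right_mono[OF ge1 l0] lt by (simp add: \<kappa>_def)
  \<comment> \<open>Three losses of \<tau> are budgeted: good nodes missing at level
    \<open>m\<close>, descendants that fall below \<open>y0\<close>, and descendants that are too
    slow. The cap \<open>1 / 2\<close> keeps \<open>1 - 2 * \<tau>\<close> nonnegative.\<close>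
  define \<tau> where "\<tau> = min (1 / 2) ((I - R) / 3)"
  have tau: "0 < \<tau>" "\<tau> \<le> 1 / 2" "R \<le> I - 3 * \<tau>" using I by (auto simp: \<tau>_def min_def field_simps)
  \<comment> \<open>The solution of \<open>(y0 / y1) powr s = \<tau>\<close>, which makes the first
    term of \<open>few_slow_descendants\<close> equal to \<tau>.\<close>
  define y1 where "y1 = y0 * (1 / \<tau>) powr (1 / s)"
  have "1 \<le> (1 / \<tau>) powr (1 / s)" using tau s by (intro ge_one_powr_ge_zero) auto
  then have y1: "y0 \<le> y1" using y0 by (simp add: y1_def mult_le_cancel_left1)
  have y1s: "y0 powr s * y1 powr (-s) = \<tau>"
    using y0 s tau by (simp add: y1_def powr_mult powr_powr powr_minus field_simps)
  obtain m where m: "(I - \<tau>) * 2 ^ m \<le> (\<Sum>i<2 ^ m. of_bool (Z m i \<le> 2 powr (- y1)))"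
    using good[of "2 powr (- y1)" \<tau>] tau by auto
  define g where "g = (\<Sum>i<2 ^ m. of_bool (Z m i \<le> 2 powr (- y1)) :: real)"
  define q where "q = 2 powr (\<beta> * s) * \<kappa>"
  have q: "0 \<le> q" "q < 1" using lt l0 by (simp_all add: q_def \<kappa>_def)
  have "(\<lambda>k. q ^ k * (2 powr (\<beta> * s * m) * y1 powr (-s))) \<longlonglongrightarrow> 0 * (2 powr (\<beta> * s * m) * y1 powr (-s))"
    using q by (intro tendsto_mult tendsto_const LIMSEQ_power_zero) auto
  then have ev: "eventually (\<lambda>k. q ^ k * (2 powr (\<beta> * s * m) * y1 powr (-s)) < \<tau>) sequentially"
    using tau by (auto dest: order_tendstoD(2))
  have main: "R * 2 ^ (m + k) \<le> (\<Sum>i<2 ^ (m + k). of_bool (Z (m + k) i \<le> 2 powr (- (2 powr (\<beta> * (m + k))))))"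
    if k: "q ^ k * (2 powr (\<beta> * s * m) * y1 powr (-s)) < \<tau>" for k
  proof -
    define t where "t = 2 powr (\<beta> * (m + k))"
    let ?b = "\<lambda>j. of_bool (2 powr (-t) < Z (m + k) j) :: real"
    have "t powr s = (2 powr (\<beta> * s)) ^ k * 2 powr (\<beta> * s * m)"
      by (simp add: t_def powr_powr powr_add[symmetric] powr_realpow[symmetric] algebra_simps)
    then have lt: "\<kappa> ^ k * t powr s = q ^ k * 2 powr (\<beta> * s * m)"
      by (simp add: q_def power_mult_distrib)
    have bmat: "(\<Sum>j\<in>leaves k i. ?b j) \<le> 2 ^ k - 2 ^ k * (1 - 2 * \<tau>) * of_bool (Z m i \<le> 2 powr (- y1))"
      if i: "i < 2 ^ m" for i
    proof (cases "Z m i \<le> 2 powr (- y1)")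
      case True
      have "(\<Sum>j\<in>leaves k i. ?b j) \<le> 2 ^ k * ((y0 powr s + \<kappa> ^ k * t powr s) * y1 powr (-s))"
        using few_slow_descendants[OF s y0 _ \<kappa>_def l1 i y1 True, of t k] by (simp add: t_def)
      also have "\<dots> = 2 ^ k * (\<tau> + q ^ k * (2 powr (\<beta> * s * m) * y1 powr (-s)))"
        unfolding lt distrib_right y1s by (simp add: mult.assoc)
      also have "\<dots> \<le> 2 ^ k * (\<tau> + \<tau>)" using k by (intro mult_left_mono) auto
      finally show ?thesis using True by (simp add: algebra_simps)
    next
      case False
      have "(\<Sum>j\<in>leaves k i. ?b j) \<le> (\<Sum>j\<in>leaves k i. 1)"
        by (intro sum_mono) auto
      then show ?thesis using False by simp
    qed
    have "(\<Sum>j<2 ^ (m + k). ?b j) = (\<Sum>i<2 ^ m. \<Sum>j\<in>leaves k i. ?b j)"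
      by (simp only: sum.nat_group power_add)
    also have "\<dots> \<le> (\<Sum>i<2 ^ m. 2 ^ k - 2 ^ k * (1 - 2 * \<tau>) * of_bool (Z m i \<le> 2 powr (- y1)))"
      by (intro sum_mono bmat) auto
    also have "\<dots> = 2 ^ (m + k) - 2 ^ k * (1 - 2 * \<tau>) * g"
      by (simp add: g_def sum_subtractf sum_distrib_left power_add)
    finally have bad: "(\<Sum>j<2 ^ (m + k). ?b j) \<le> 2 ^ (m + k) - 2 ^ k * (1 - 2 * \<tau>) * g" .
    have "(\<Sum>j<2 ^ (m + k). of_bool (Z (m + k) j \<le> 2 powr (-t))) = (\<Sum>j<2 ^ (m + k). 1 - ?b j)"
      by (intro sum.cong refl) auto
    also have "\<dots> = 2 ^ (m + k) - (\<Sum>j<2 ^ (m + k). ?b j)" by (simp add: sum_subtractf)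
    also have "\<dots> \<ge> 2 ^ k * (1 - 2 * \<tau>) * g" using bad by linarith
    finally have 1: "2 ^ k * (1 - 2 * \<tau>) * g \<le> (\<Sum>j<2 ^ (m + k). of_bool (Z (m + k) j \<le> 2 powr (-t)))" .
    \<comment> \<open>The product expands to \<open>I - 3 * \<tau>\<close> plus
      \<open>2 * \<tau> * (1 - I) + 2 * \<tau> * \<tau>\<close>, and \<open>I \<le> 1\<close> makes
      the remainder nonnegative.\<close>
    have "R \<le> (1 - 2 * \<tau>) * (I - \<tau>)"
    proof -
      have "0 \<le> 2 * \<tau> * (1 - I) + 2 * \<tau> * \<tau>" using tau I by simp
      then show ?thesis using tau(3) by (simp add: algebra_simps)
    qed
    then have "R * 2 ^ (m + k) \<le> (1 - 2 * \<tau>) * (I - \<tau>) * 2 ^ (m + k)" by (intro mult_right_mono) auto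
    also have "\<dots> = 2 ^ k * (1 - 2 * \<tau>) * ((I - \<tau>) * 2 ^ m)" by (simp add: power_add)
    also have "\<dots> \<le> 2 ^ k * (1 - 2 * \<tau>) * g" using m tau unfolding g_def by (intro mult_left_mono) auto
    finally show ?thesis using 1 by (simp add: t_def)
  qed
  obtain k0 where "\<And>k. k0 \<le> k \<Longrightarrow> q ^ k * (2 powr (\<beta> * s * m) * y1 powr (-s)) < \<tau>"
    using ev by (auto simp: eventually_sequentially)
  then have "R * 2 ^ n \<le> (\<Sum>i<2 ^ n. of_bool (Z n i \<le> 2 powr (- (2 powr (\<beta> * n)))))" if "m + k0 \<le> n" for n
    using main[of "n - m"] that by simp
  then show ?thesis by (auto simp: eventually_sequentially)
qed

text \<open>\<open>J\<close> is at most 1 on good and intermediate nodes and at most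
  \<open>2 * (\<tau> / 3)\<close> where \<open>Z\<close> is near 1. Its mean is \<open>I\<close> at
  every level, so at a level where intermediate nodes make up at most a fraction
  \<open>\<tau> / 3\<close>, the good ones account for at least \<open>I - \<tau>\<close>.\<close>

lemma good_fraction:
  fixes J :: "nat \<Rightarrow> nat \<Rightarrow> real" and I :: real
  assumes J_sum: "\<And>n. (\<Sum>i<2 ^ n. J n i) = 2 ^ n * I" and J1: "\<And>n i. i < 2 ^ n \<Longrightarrow> J n i \<le> 1"
    and JZ: "\<And>\<delta>. 0 < \<delta> \<Longrightarrow> \<exists>K\<ge>0. \<forall>n. \<forall>i<2 ^ n. J n i \<le> \<delta> + K * (1 - Z n i)"
    and pos: "0 < \<epsilon>" "0 < \<tau>"
  shows "\<exists>n. (I - \<tau>) * 2 ^ n \<le> (\<Sum>i<2 ^ n. of_bool (Z n i \<le> \<epsilon>))"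
proof -
  obtain K where K: "0 \<le> K" "\<And>n i. i < 2 ^ n \<Longrightarrow> J n i \<le> \<tau> / 3 + K * (1 - Z n i)"
    using JZ[of "\<tau> / 3"] pos by auto
  \<comment> \<open>Chosen so that \<open>K * \<eta> \<le> \<tau> / 3\<close>; the added 1 keeps the
    denominator positive when \<open>K = 0\<close>.\<close>
  define \<eta> where "\<eta> = \<tau> / (3 * (K + 1))"
  have eta: "0 < \<eta>" "K * \<eta> \<le> \<tau> / 3" using K pos by (auto simp: \<eta>_def field_simps)
  obtain n where n: "(\<Sum>i<2 ^ n. of_bool (mid \<epsilon> \<eta> n i)) \<le> (\<tau> / 3) * 2 ^ n"
    using few_intermediate[OF pos(1) eta(1), of "\<tau> / 3"] pos by auto
  have "J n i \<le> of_bool (Z n i \<le> \<epsilon>) + of_bool (mid \<epsilon> \<eta> n i) + 2 * (\<tau> / 3)" if i: "i < 2 ^ n" for i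
  proof (cases "Z n i \<le> 1 - \<eta>")
    case True
    then have "1 \<le> of_bool (Z n i \<le> \<epsilon>) + (of_bool (mid \<epsilon> \<eta> n i) :: real)"
      by (cases "Z n i \<le> \<epsilon>") auto
    then show ?thesis using J1[OF i] pos by linarith
  next
    case False
    then have "K * (1 - Z n i) \<le> K * \<eta>" using K by (intro mult_left_mono) auto
    then have "J n i \<le> 2 * (\<tau> / 3)" using K(2)[OF i] eta by linarith
    moreover have "0 \<le> of_bool (Z n i \<le> \<epsilon>) + (of_bool (mid \<epsilon> \<eta> n i) :: real)" by simp
    ultimately show ?thesis by linarith
  qed
  then have "(\<Sum>i<2 ^ n. J n i) \<le> (\<Sum>i<2 ^ n. of_bool (Z n i \<le> \<epsilon>) + of_bool (mid \<epsilon> \<eta> n i) + 2 * (\<tau> / 3))"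
    by (intro sum_mono) auto
  also have "\<dots> = (\<Sum>i<2 ^ n. of_bool (Z n i \<le> \<epsilon>)) + (\<Sum>i<2 ^ n. of_bool (mid \<epsilon> \<eta> n i)) + 2 ^ n * (2 * (\<tau> / 3))"
    unfolding sum.distrib by simp
  finally have "2 ^ n * I \<le> (\<Sum>i<2 ^ n. of_bool (Z n i \<le> \<epsilon>)) + (\<tau> / 3) * 2 ^ n + 2 ^ n * (2 * (\<tau> / 3))"
    using n J_sum[of n] by linarith
  then have "(I - \<tau>) * 2 ^ n \<le> (\<Sum>i<2 ^ n. of_bool (Z n i \<le> \<epsilon>))" by (simp add: algebra_simps)
  then show ?thesis by blast
qed

end

text \<open>With \<open>N = 2 ^ n\<close>, the larger power \<open>N powr \<gamma>\<close> outgrows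
  both \<open>N powr \<beta>\<close> and the logarithm of the factor \<open>2 N\<close>. In the
  proof \<open>c ^ n\<close> is \<open>N powr \<gamma>\<close> and \<open>d ^ n\<close> is the ratio
  of \<open>N powr \<beta>\<close> to it, so eventually at least half of \<open>c ^ n\<close>
  remains after the subtraction.\<close>

lemma doubly_exponential_smallo:
  fixes \<beta> \<gamma> :: real
  assumes "\<beta> < \<gamma>" "0 < \<gamma>"
  shows "(\<lambda>n::nat. 2 * 2 ^ n * 2 powr (- (1/2) * 2 powr (\<gamma> * n))) \<in> o(\<lambda>n. 2 powr (- (1/2) * (2 ^ n) powr \<beta>))"
proof (rule smalloI_tendsto)
  define c d where "c = 2 powr \<gamma>" and "d = 2 powr (\<beta> - \<gamma>)"
  have c: "1 < c" using assms by (simp add: c_def)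
  have d: "0 < d" "d < 1" using assms by (simp_all add: d_def powr_less_one)
  have eq: "2 * 2 ^ n * 2 powr (- (1/2) * 2 powr (\<gamma> * n)) / 2 powr (- (1/2) * (2 ^ n) powr \<beta>)
      = 2 powr (1 + n - (1/2) * (c ^ n * (1 - d ^ n)))" for n :: nat
  proof -
    have b: "(2 ^ n) powr \<beta> = c ^ n * d ^ n" "2 powr (\<gamma> * n) = c ^ n"
      by (simp_all add: c_def d_def powr_realpow[symmetric] powr_powr powr_add[symmetric] algebra_simps)
    have "2 * 2 ^ n = (2::real) powr (1 + n)" by (simp add: powr_add powr_realpow)
    then show ?thesis unfolding b
      by (simp add: powr_add[symmetric] powr_diff[symmetric] algebra_simps)
  qed
  have "filterlim (\<lambda>n::nat. 1 + real n - (1/2) * (c ^ n * (1 - d ^ n))) at_bot sequentially"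
  proof (rule filterlim_at_bot_mono)
    show "filterlim (\<lambda>n::nat. 1 + real n - c ^ n / 4) at_bot sequentially"
      using c by real_asymp
    have "(\<lambda>n. d ^ n) \<longlonglongrightarrow> 0" using d by (intro LIMSEQ_power_zero) auto
    then have "eventually (\<lambda>n. d ^ n < 1 / 2) sequentially" by (rule order_tendstoD(2)) simp
    then show "eventually (\<lambda>n. 1 + real n - (1/2) * (c ^ n * (1 - d ^ n)) \<le> 1 + real n - c ^ n / 4) sequentially"
    proof (rule eventually_mono)
      fix n assume "d ^ n < 1 / 2"
      then have "c ^ n * (1 / 2) \<le> c ^ n * (1 - d ^ n)" using c by (intro mult_left_mono) auto
      then show "1 + real n - (1/2) * (c ^ n * (1 - d ^ n)) \<le> 1 + real n - c ^ n / 4" by simp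
    qed
  qed
  then have "((\<lambda>n::nat. exp (ln 2 * (1 + real n - (1/2) * (c ^ n * (1 - d ^ n))))) \<longlongrightarrow> 0) sequentially"
    by (intro filterlim_compose[OF exp_at_bot] filterlim_tendsto_pos_mult_at_bot[OF tendsto_const]) auto
  then show "(\<lambda>n. 2 * 2 ^ n * 2 powr (- (1/2) * 2 powr (\<gamma> * n)) / 2 powr (- (1/2) * (2 ^ n) powr \<beta>)) \<longlonglongrightarrow> 0"
    unfolding eq by (simp add: powr_def mult.commute)
qed simp

section \<open>Error probability of polar codes\<close>

theorem theorem3:
  fixes \<rho> :: "bool \<Rightarrow> complex mat" and d :: nat and R \<beta> :: real and A :: "nat \<Rightarrow> nat set"
  assumes dens: "\<And>x. density_op d (\<rho> x)"
    and rate: "R < symm_info \<rho>"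
    and beta: "\<beta> < 1/2"
    and Asub: "\<And>n. A n \<subseteq> {1..2^n}"
    and Acard: "\<And>n. int (card (A n)) = \<lfloor>2^n * R\<rfloor>"
    and polar: "\<And>n i j. i \<in> A n \<Longrightarrow> j \<in> {1..2^n} - A n \<Longrightarrow> split_fid \<rho> d n i \<le> split_fid \<rho> d n j"
  shows "(\<lambda>n. Pe \<rho> d n (A n)) \<in> o(\<lambda>n. 2 powr (- (1/2) * (2^n) powr \<beta>))"
proof -
  interpret cq_channel \<rho> d by unfold_locales (rule dens)
  interpret polarization split_bhatt
    by unfold_locales (rule split_bhatt_range split_bhatt_plus split_bhatt_minus, assumption)+
  \<comment> \<open>A rate strictly between \<beta> and \<open>1 / 2\<close> leaves room for the
    factor \<open>2 * 2 ^ n\<close>. The maximum with 0 meets the sign condition of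
    \<open>polarization_rate\<close> also for negative \<beta>.\<close>
  define \<gamma> where "\<gamma> = (max \<beta> 0 + 1 / 2) / 2"
  have \<gamma>: "\<beta> < \<gamma>" "0 < \<gamma>" "\<gamma> < 1 / 2" using beta by (auto simp: \<gamma>_def max_def)
  define \<theta> where "\<theta> n = 2 powr (- (2 powr (\<gamma> * real n)))" for n :: nat
  have le1: "symm_info \<rho> \<le> 1" using sum_split_holevo[of 0] split_holevo_le_1[of 0 0] by simp
  have many: "eventually (\<lambda>n. R * 2 ^ n \<le> (\<Sum>i<2 ^ n. of_bool (split_bhatt n i \<le> \<theta> n))) sequentially"
    unfolding \<theta>_def
    by (rule polarization_rate[OF _ rate le1]) (use good_fraction[OF sum_split_holevo split_holevo_le_1 split_holevo_affine_bound] \<gamma> in auto)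
  have small: "Pe \<rho> d n (A n) \<le> 2 * 2 ^ n * 2 powr (- (1/2) * 2 powr (\<gamma> * real n))"
    if n: "R * 2 ^ n \<le> (\<Sum>i<2 ^ n. of_bool (split_bhatt n i \<le> \<theta> n))" for n
  proof -
    have fin: "finite (A n)" using finite_subset[OF Asub] by blast
    have sq: "sqfid n i \<le> \<theta> n" if i: "i \<in> A n" for i
    proof (rule ccontr)
      assume "\<not> sqfid n i \<le> \<theta> n"
      then have gt: "\<theta> n < sqfid n i" by simp
      \<comment> \<open>If a chosen \<open>i\<close> had root fidelity above
        \<open>\<theta> n\<close>, the coding rule would force every index counted in
        \<open>G\<close> to be chosen as well, and each differs from \<open>i\<close>. So the chosen
        set would be strictly larger than \<open>G\<close>. Indices in \<open>G\<close> are
        zero-based, hence the shift by \<open>Suc\<close>.\<close>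
      define G where "G = {k. k < 2 ^ n \<and> split_bhatt n k \<le> \<theta> n}"
      have "Suc ` G \<subseteq> A n - {i}"
      proof (rule image_subsetI)
        fix k assume "k \<in> G"
        then have k: "k < 2 ^ n" and Zk: "split_bhatt n k \<le> \<theta> n" by (auto simp: G_def)
        have lt: "sqfid n (Suc k) < sqfid n i" using sqfid_le_split_bhatt[OF k] Zk gt by linarith
        have "Suc k \<in> A n"
        proof (rule ccontr)
          assume "Suc k \<notin> A n"
          then have "split_fid \<rho> d n i \<le> split_fid \<rho> d n (Suc k)"
            using k by (intro polar[OF i]) auto
          then have "sqfid n i \<le> sqfid n (Suc k)"
            unfolding split_fid_sqfid using sqfid_blocks(2)[OF k] by (rule power2_le_imp_le)
          then show False using lt by simp
        qed
        then show "Suc k \<in> A n - {i}" using lt by auto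
      qed
      then have "card (Suc ` G) \<le> card (A n - {i})" using fin by (intro card_mono) auto
      then have "card G < card (A n)"
        using i fin card_gt_0_iff[of "A n"] by (auto simp: card_image)
      moreover have "real (card G) = (\<Sum>k<2 ^ n. of_bool (split_bhatt n k \<le> \<theta> n))"
        by (simp add: G_def sum_of_bool_eq Int_def)
      ultimately have "R * 2 ^ n < real (card (A n))" using n by simp
      \<comment> \<open>The prescribed size of the chosen set is the floor of
        \<open>R * 2 ^ n\<close>, hence at most \<open>card G\<close>, against the strict inequality
        above.\<close>
      moreover have "\<lfloor>R * 2 ^ n\<rfloor> \<le> int (card G)"
        using n \<open>real (card G) = _\<close> by (simp add: floor_le_iff)
      ultimately show False using Acard[of n] \<open>card G < card (A n)\<close> by (simp add: mult.commute)
    qed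
    have "Pe \<rho> d n (A n) \<le> 2 * (\<Sum>i\<in>A n. sqrt (sqfid n i / 2))" by (rule Pe_bounds(2)[OF Asub])
    also have "\<dots> \<le> 2 * (\<Sum>i\<in>A n. sqrt (\<theta> n))"
    proof (intro mult_left_mono sum_mono)
      fix i assume i: "i \<in> A n"
      have "0 \<le> \<theta> n" by (simp add: \<theta>_def)
      then show "sqrt (sqfid n i / 2) \<le> sqrt (\<theta> n)" using sq[OF i] by simp
    qed simp
    also have "\<dots> = 2 * real (card (A n)) * sqrt (\<theta> n)" by simp
    also have "\<dots> \<le> 2 * 2 ^ n * sqrt (\<theta> n)"
    proof -
      have "card (A n) \<le> 2 ^ n" using card_mono[OF _ Asub[of n]] by simp
      then have "real (card (A n)) \<le> 2 ^ n" by (metis of_nat_le_iff of_nat_numeral of_nat_power)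
      then show ?thesis by (intro mult_right_mono mult_left_mono) (auto simp: \<theta>_def)
    qed
    also have "sqrt (\<theta> n) = 2 powr (- (1/2) * 2 powr (\<gamma> * real n))"
      by (simp add: \<theta>_def powr_half_sqrt[symmetric] powr_powr)
    finally show ?thesis .
  qed
  have "(\<lambda>n. Pe \<rho> d n (A n)) \<in> O(\<lambda>n. 2 * 2 ^ n * 2 powr (- (1/2) * 2 powr (\<gamma> * real n)))"
  proof (rule bigoI[of _ 1], rule eventually_mono[OF many])
    fix n :: nat assume "R * 2 ^ n \<le> (\<Sum>i<2 ^ n. of_bool (split_bhatt n i \<le> \<theta> n))"
    from small[OF this] Pe_bounds(1)[OF Asub]
    show "norm (Pe \<rho> d n (A n)) \<le> 1 * norm (2 * 2 ^ n * 2 powr (- (1/2) * 2 powr (\<gamma> * real n)))"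
      by simp
  qed
  then show ?thesis
    using doubly_exponential_smallo[OF \<gamma>(1,2)] by (rule landau_o.big_small_trans)
qed

end
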